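(* Let $p$ be an odd prime, let $\mu$ be a character of $\mathbb Q_p^\times$ of conductor exponent $n>1$, let $\eta$ be trivial or $\left(\frac{\cdot}{p}\right)$, with $\mu(-1)=\eta(-1)$. Let $p^*=\left(\frac{-1}{p}\right)p$. There is a sign $s\in\{\pm1\}$ depending on $\mu$ such that for all $\kappa,\beta,\delta\in\{1,\lambda\}$ with $\beta\ne\kappa$: $$\mathcal V_{2n-1,\kappa}(f_\kappa)\big((y(\delta p^n),1)\big)=\begin{cases}\frac{-1+s\sqrt{p^*}}{2}&\delta=\kappa,\\ 0&\delta\ne\kappa,\end{cases}\qquad \mathcal V_{2n-1,\beta}(f_\kappa)\big((y(\delta p^n),1)\big)=\begin{cases}\frac{-1-s\sqrt{p^*}}{2}&\delta=\kappa,\\ 0&\delta\ne\kappa.\end{cases}$$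
   Context: Let $G=\mathrm{SL}_2(\mathbb Q_p)$, $K=\mathrm{SL}_2(\mathbb Z_p)$, $K_m=K_0(p^m)=\{\begin{pmatrix}a&b\\ c&d\end{pmatrix}\in K:c\in p^m\mathbb Z_p\}$. $(\cdot,\cdot)_p$ is the quadratic Hilbert symbol. For $A=\begin{pmatrix}a&b\\ c&d\end{pmatrix}$ put $\tau(A)=c$ if $c\ne0$, $\tau(A)=d$ if $c=0$; for $g\in G$ put $s_p(g)=(c,d)_p$ if $cd\neq0$ and $\mathrm{ord}_p(c)$ is odd, $s_p(g)=1$ otherwise; $c(g,h)=(\tau(gh)\tau(g),\tau(gh)\tau(h))_p\,s_p(g)s_p(h)s_p(gh)$. $\widetilde G=G\times\{\pm1\}$ with $(g,\epsilon_1)(h,\epsilon_2)=(gh,\epsilon_1\epsilon_2c(g,h))$; $\overline S$ is the full inverse image of $S\subset G$. The cover splits over $K$ by $k\mapsto (k,1)$. $\eta$ defines the genuine character $\eta((\begin{pmatrix}a&b\\ c&d\end{pmatrix},\epsilon))=\epsilon\eta(d)$ of $\overline{K_m}$ ($m\ge1$). $\lambda\in\mathbb Z_p^\times$ is a nonsquare mod $p$; $x(s)=\begin{pmatrix}1&s\\ 0&1\end{pmatrix}$, $y(s)=\begin{pmatrix}1&0\\ s&1\end{pmatrix}$, $h(t)=\mathrm{diag}(t,t^{-1})$. $B\subset\widetilde G$ is the full inverse image of the upper triangular Borel subgroup. $\psi$ is a nontrivial additive character of $\mathbb Q_p$ of conductor $0$ (trivial on $\mathbb Z_p$, not on $p^{-1}\mathbb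 Z_p$); $\gamma(\psi')$ is the Weil index of $x\mapsto x^2$ with respect to $\psi'$, $\gamma(a,\psi)=\gamma(\psi_a)/\gamma(\psi)$, $\psi_a(x)=\psi(ax)$. Put $\mu_B((h(a)x(b),\epsilon))=\epsilon|a|\mu(a)\gamma(a,\psi)^{-1}$. $V(\mu)$ is the space of locally constant $f:\widetilde G\to\mathbb C$ with $f(bg)=\mu_B(b)f(g)$, $b\in B$, with right translation action, and $V(\mu)_\eta^{K_m}=\{f\in V(\mu):f(g\tilde k)=f(g)\eta(\tilde k)\ \forall \tilde k\in\overline{K_m}\}$. For $\kappa\in\{1,\lambda\}$, $f_\kappa\in V(\mu)_\eta^{K_{2n}}$ is the function with $f_\kappa(b(y(\kappa p^n),1)k_0)=\mu_B(b)\eta(k_0)$ for $b\in B,k_0\in\overline{K_{2n}}$, and zero elsewhere. $\mathcal V_{2n-1,\beta}$ is the function on $\widetilde G$ supported on $\overline{K_{2n}}(y(\beta p^{2n-1}),1)\overline{K_{2n}}$, with value $1$ at $(y(\beta p^{2n-1}),1)$ and satisfying $\mathcal V(\tilde k\tilde g\tilde k')=\overline\eta(\tilde k)\overline\eta(\tilde k')\mathcal V(\tilde g)$ for $\tilde k,\tilde k'\in\overline{K_{2n}}$; it acts on $V(\mu)_\eta^{K_{2n}}$ by convolution with $\mathrm{vol}(\overline{K_{2n}})=1$, i.e. $\mathcal V_{2n-1,\beta}(f)(g)=\sum_{u\in\mathbb Z_p^\times/\sqrt{1+p\mathbb Z_p}}\eta(u)f\big(g\,(h(u),1)(y(\beta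 p^{2n-1}),1)\big)$, where $\sqrt{1+p\mathbb Z_p}=\{u\in\mathbb Z_p^\times:u^2\in1+p\mathbb Z_p\}$. $\sqrt{p^*}=\epsilon_p\sqrt p$ with $\epsilon_p=\gamma(p,\psi)$ (so $\epsilon_p^2=\left(\frac{-1}p\right)$). *)

theory Defs
  imports "HOL-Analysis.Analysis"
begin

text \<open>The field of p-adic numbers, as Cauchy sequences of rationals for the p-adic absolute value modulo
  null sequences. The prime is the cardinality of a type argument.\<close>

definition padic_rat_norm :: "nat \<Rightarrow> rat \<Rightarrow> real" where
  "padic_rat_norm p r = (if r = 0 then 0 else
     (case quotient_of r of (a, b) \<Rightarrow>
       real p powi (int (multiplicity (int p) b) - int (multiplicity (int p) a))))"

lemma padic_rat_norm_zero [simp]: "padic_rat_norm p 0 = 0"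
  by (simp add: padic_rat_norm_def)

definition padic_cauchy :: "nat \<Rightarrow> (nat \<Rightarrow> rat) \<Rightarrow> bool" where
  "padic_cauchy p X \<longleftrightarrow>
     (\<forall>e>0. \<exists>k. \<forall>m\<ge>k. \<forall>n\<ge>k. padic_rat_norm p (X m - X n) < e)"

definition padic_vanishes :: "nat \<Rightarrow> (nat \<Rightarrow> rat) \<Rightarrow> bool" where
  "padic_vanishes p X \<longleftrightarrow> (\<lambda>n. padic_rat_norm p (X n)) \<longlonglongrightarrow> 0"

context
  fixes p :: nat
  assumes p: "prime p"
begin

lemma prime_elem_p: "prime_elem (int p)"
  using p by simp

lemma padic_rat_norm_Fract:
  assumes "a \<noteq> 0" "b \<noteq> 0"
  shows "padic_rat_norm p (of_int a / of_int b) =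
    real p powi (int (multiplicity (int p) b) - int (multiplicity (int p) a))"
proof -
  define r :: rat where "r = of_int a / of_int b"
  obtain c d where cd: "quotient_of r = (c, d)" by (cases "quotient_of r")
  have d: "d > 0" using quotient_of_denom_pos[OF cd] .
  have r: "r = of_int c / of_int d" using quotient_of_div[OF cd] .
  have r0: "r \<noteq> 0" using assms by (simp add: r_def)
  hence c0: "c \<noteq> 0" using r by auto
  have "(of_int (a * d) :: rat) = of_int (c * b)"
    using r assms d unfolding r_def by (simp add: field_simps)
  hence "a * d = c * b" by (simp only: of_int_eq_iff)
  hence "multiplicity (int p) (a * d) = multiplicity (int p) (c * b)" by simp
  hence "multiplicity (int p) a + multiplicity (int p) d =
    multiplicity (int p) c + multiplicity (int p) b"
    using assms c0 d prime_elem_p by (simp add: prime_elem_multiplicity_mult_distrib)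
  hence "int (multiplicity (int p) d) - int (multiplicity (int p) c) =
    int (multiplicity (int p) b) - int (multiplicity (int p) a)" by linarith
  thus ?thesis using r0 by (simp add: padic_rat_norm_def cd flip: r_def)
qed

lemma padic_rat_norm_nonneg [simp]: "padic_rat_norm p r \<ge> 0"
  by (auto simp: padic_rat_norm_def split: prod.splits)

lemma rat_rep:
  fixes r :: rat
  obtains a b :: int where "r = of_int a / of_int b" "b \<noteq> 0"
  proof -
  obtain a b where "quotient_of r = (a, b)" by (cases "quotient_of r")
  thus ?thesis using that quotient_of_div quotient_of_denom_pos by (metis less_irrefl)
qed

lemma padic_rat_norm_pos: "r \<noteq> 0 \<Longrightarrow> padic_rat_norm p r > 0"
  using p by (auto simp: padic_rat_norm_def prime_gt_0_nat split: prod.splits)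

lemma padic_rat_norm_eq_0 [simp]: "padic_rat_norm p r = 0 \<longleftrightarrow> r = 0"
  using padic_rat_norm_pos[of r] by (cases "r = 0") auto

lemma padic_rat_norm_mult: "padic_rat_norm p (r * s) = padic_rat_norm p r * padic_rat_norm p s"
proof (cases "r = 0 \<or> s = 0")
  case False
  obtain a b where r: "r = of_int a / of_int b" "b \<noteq> 0" by (rule rat_rep)
  obtain c d where s: "s = of_int c / of_int d" "d \<noteq> 0" by (rule rat_rep)
  have nz: "a \<noteq> 0" "c \<noteq> 0" using False r s by auto
  have "r * s = of_int (a * c) / of_int (b * d)" using r s by simp
  hence "padic_rat_norm p (r * s) = real p powi (int (multiplicity (int p) (b * d)) - int (multiplicity (int p) (a * c)))"
    using padic_rat_norm_Fract[of "a * c" "b * d"] nz r(2) s(2) by simp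
  also have "int (multiplicity (int p) (b * d)) - int (multiplicity (int p) (a * c)) =
      (int (multiplicity (int p) b) - int (multiplicity (int p) a)) +
      (int (multiplicity (int p) d) - int (multiplicity (int p) c))"
    using nz r(2) s(2) prime_elem_p by (simp add: prime_elem_multiplicity_mult_distrib)
  also have "real p powi \<dots> = padic_rat_norm p r * padic_rat_norm p s"
    using nz r s prime_gt_0_nat[OF p] by (simp add: padic_rat_norm_Fract power_int_add)
  finally show ?thesis .
qed auto

lemma padic_rat_norm_one [simp]: "padic_rat_norm p 1 = 1"
  using padic_rat_norm_Fract[of 1 1] by simp

lemma padic_rat_norm_minus [simp]: "padic_rat_norm p (- r) = padic_rat_norm p r"
proof -
  have "padic_rat_norm p (-1) * padic_rat_norm p (-1) = 1" by (simp flip: padic_rat_norm_mult)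
  hence "padic_rat_norm p (-1) = 1" using padic_rat_norm_nonneg[of "-1"] by (simp add: square_eq_1_iff)
  thus ?thesis using padic_rat_norm_mult[of "-1" r] by simp
qed

lemma padic_rat_norm_diff_commute: "padic_rat_norm p (r - s) = padic_rat_norm p (s - r)"
  using padic_rat_norm_minus[of "r - s"] by simp

lemma padic_rat_norm_inverse: "padic_rat_norm p (inverse r) = inverse (padic_rat_norm p r)"
proof (cases "r = 0")
  case False
  hence "padic_rat_norm p (inverse r) * padic_rat_norm p r = 1" by (simp flip: padic_rat_norm_mult)
  thus ?thesis using False by (simp add: field_simps)
qed simp

lemma padic_rat_norm_add: "padic_rat_norm p (r + s) \<le> max (padic_rat_norm p r) (padic_rat_norm p s)"
proof (cases "r = 0 \<or> s = 0 \<or> r + s = 0")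
  case True
  thus ?thesis using padic_rat_norm_nonneg[of r] padic_rat_norm_nonneg[of s]
    by (auto simp: max_def)
next
  case False
  obtain a b where r: "r = of_int a / of_int b" "b \<noteq> 0" by (rule rat_rep)
  obtain c d where s: "s = of_int c / of_int d" "d \<noteq> 0" by (rule rat_rep)
  have r': "r = of_int (a * d) / of_int (b * d)" and s': "s = of_int (c * b) / of_int (b * d)"
    using r s by simp_all
  have rs: "r + s = of_int (a * d + c * b) / of_int (b * d)"
    using r s by (simp add: field_simps)
  have nz: "a * d \<noteq> 0" "c * b \<noteq> 0" "b * d \<noteq> 0" using False r s by auto
  have nz': "a * d + c * b \<noteq> 0"
  proof
    assume "a * d + c * b = 0"
    hence "r + s = 0" using rs by simp
    thus False using False by simp
  qed
  let ?m = "multiplicity (int p)"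
  have up: "\<not> is_unit (int p)" using prime_elem_p prime_elem_not_unit by blast
  have "int p ^ min (?m (a * d)) (?m (c * b)) dvd a * d + c * b"
    by (intro dvd_add multiplicity_dvd') auto
  hence "min (?m (a * d)) (?m (c * b)) \<le> ?m (a * d + c * b)"
    using nz' up by (intro multiplicity_geI) auto
  hence "?m (a * d) \<le> ?m (a * d + c * b) \<or> ?m (c * b) \<le> ?m (a * d + c * b)"
    by (auto simp: min_def split: if_splits)
  moreover have p1: "1 \<le> real p" using prime_ge_1_nat[OF p] by simp
  have N: "padic_rat_norm p r = real p powi (int (?m (b * d)) - int (?m (a * d)))"
       "padic_rat_norm p s = real p powi (int (?m (b * d)) - int (?m (c * b)))"
       "padic_rat_norm p (r + s) = real p powi (int (?m (b * d)) - int (?m (a * d + c * b)))"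
    using padic_rat_norm_Fract[OF nz(1,3)] padic_rat_norm_Fract[OF nz(2,3)]
        padic_rat_norm_Fract[OF nz' nz(3)] by (simp_all only: r' s' rs[unfolded r' s'])
  ultimately have "padic_rat_norm p (r + s) \<le> padic_rat_norm p r \<or> padic_rat_norm p (r + s) \<le> padic_rat_norm p s"
    unfolding N using p1 by (auto intro!: power_int_increasing)
  thus ?thesis by (auto simp: le_max_iff_disj)
qed

lemma padic_rat_norm_triangle: "padic_rat_norm p (r + s) \<le> padic_rat_norm p r + padic_rat_norm p s"
  by (rule order_trans[OF padic_rat_norm_add]) simp

lemma padic_rat_norm_triangle3: "\<bar>padic_rat_norm p r - padic_rat_norm p s\<bar> \<le> padic_rat_norm p (r - s)"
proof -
  have "padic_rat_norm p r \<le> padic_rat_norm p (r - s) + padic_rat_norm p s" "padic_rat_norm p s \<le> padic_rat_norm p (s - r) + padic_rat_norm p r"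
    using padic_rat_norm_triangle[of "r - s" s] padic_rat_norm_triangle[of "s - r" r] by simp_all
  thus ?thesis using padic_rat_norm_diff_commute[of s r] by linarith
qed

lemma padic_vanishes_zero [simp]: "padic_vanishes p (\<lambda>n. 0)"
  by (simp add: padic_vanishes_def)

lemma padic_vanishes_const: "padic_vanishes p (\<lambda>n. c) \<longleftrightarrow> c = 0"
  by (simp add: padic_vanishes_def tendsto_const_iff)

lemma padic_vanishes_minus: "padic_vanishes p X \<Longrightarrow> padic_vanishes p (\<lambda>n. - X n)"
  by (simp add: padic_vanishes_def)

lemma padic_vanishes_dominated:
  assumes "padic_vanishes p X" "eventually (\<lambda>n. padic_rat_norm p (Y n) \<le> C * padic_rat_norm p (X n)) sequentially"
  shows "padic_vanishes p Y"
proof -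
  have "(\<lambda>n. C * padic_rat_norm p (X n)) \<longlonglongrightarrow> C * 0"
    using assms(1) unfolding padic_vanishes_def by (rule tendsto_mult_left)
  hence "(\<lambda>n. C * padic_rat_norm p (X n)) \<longlonglongrightarrow> 0" by simp
  thus ?thesis unfolding padic_vanishes_def
    by (rule tendsto_sandwich[OF _ assms(2) tendsto_const, rotated]) simp
qed

lemma padic_vanishes_add:
  assumes "padic_vanishes p X" "padic_vanishes p Y"
  shows "padic_vanishes p (\<lambda>n. X n + Y n)"
proof -
  have "(\<lambda>n. padic_rat_norm p (X n) + padic_rat_norm p (Y n)) \<longlonglongrightarrow> 0 + 0"
    using assms unfolding padic_vanishes_def by (rule tendsto_add)
  hence "(\<lambda>n. padic_rat_norm p (X n) + padic_rat_norm p (Y n)) \<longlonglongrightarrow> 0" by simp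
  moreover have "eventually (\<lambda>n. padic_rat_norm p (X n + Y n) \<le> padic_rat_norm p (X n) + padic_rat_norm p (Y n)) sequentially"
    by (simp add: padic_rat_norm_triangle)
  ultimately show ?thesis unfolding padic_vanishes_def
    using tendsto_sandwich[of "\<lambda>_. 0" "\<lambda>n. padic_rat_norm p (X n + Y n)" sequentially, OF _ _ tendsto_const] by simp
qed

lemma padic_cauchy_const [simp]: "padic_cauchy p (\<lambda>n. c)"
  by (simp add: padic_cauchy_def)

lemma padic_cauchy_minus:
  assumes "padic_cauchy p X"
  shows "padic_cauchy p (\<lambda>n. - X n)"
proof -
  have "padic_rat_norm p (- X m + X n) = padic_rat_norm p (X m - X n)" for m n
    using padic_rat_norm_minus[of "X m - X n"] by (simp add: algebra_simps)
  thus ?thesis using assms by (simp add: padic_cauchy_def)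
qed

lemma padic_cauchy_add:
  assumes "padic_cauchy p X" "padic_cauchy p Y"
  shows "padic_cauchy p (\<lambda>n. X n + Y n)"
  unfolding padic_cauchy_def
proof (intro allI impI)
  fix e :: real assume e: "e > 0"
  obtain k l where k: "\<forall>m\<ge>k. \<forall>n\<ge>k. padic_rat_norm p (X m - X n) < e" 
    and l: "\<forall>m\<ge>l. \<forall>n\<ge>l. padic_rat_norm p (Y m - Y n) < e"
    using assms e unfolding padic_cauchy_def by metis
  have "padic_rat_norm p ((X m + Y m) - (X n + Y n)) < e" if "m \<ge> max k l" "n \<ge> max k l" for m n
  proof -
    have "padic_rat_norm p ((X m + Y m) - (X n + Y n)) = padic_rat_norm p ((X m - X n) + (Y m - Y n))"
      by (simp add: algebra_simps)
    also have "\<dots> \<le> max (padic_rat_norm p (X m - X n)) (padic_rat_norm p (Y m - Y n))" by (rule padic_rat_norm_add)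
    also have "\<dots> < e" using k l that by simp
    finally show ?thesis .
  qed
  thus "\<exists>k. \<forall>m\<ge>k. \<forall>n\<ge>k. padic_rat_norm p ((X m + Y m) - (X n + Y n)) < e" by blast
qed

lemma padic_cauchy_Cauchy_norm:
  assumes "padic_cauchy p X"
  shows "convergent (\<lambda>n. padic_rat_norm p (X n))"
proof -
  have "Cauchy (\<lambda>n. padic_rat_norm p (X n))"
    unfolding Cauchy_def dist_real_def
  proof (intro allI impI)
    fix e :: real assume "e > 0"
    then obtain k where "\<forall>m\<ge>k. \<forall>n\<ge>k. padic_rat_norm p (X m - X n) < e"
      using assms unfolding padic_cauchy_def by blast
    thus "\<exists>M. \<forall>m\<ge>M. \<forall>n\<ge>M. \<bar>padic_rat_norm p (X m) - padic_rat_norm p (X n)\<bar> < e"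
      using padic_rat_norm_triangle3 le_less_trans by blast
  qed
  thus ?thesis by (simp add: Cauchy_convergent_iff)
qed

lemma padic_cauchy_bounded:
  assumes "padic_cauchy p X"
  shows "\<exists>b>0. \<forall>n. padic_rat_norm p (X n) \<le> b"
proof -
  have "Bseq (\<lambda>n. padic_rat_norm p (X n))" using padic_cauchy_Cauchy_norm[OF assms] by (rule convergent_imp_Bseq)
  then obtain b where "b > 0" "\<And>n. norm (padic_rat_norm p (X n)) \<le> b" by (auto elim: BseqE)
  thus ?thesis by auto
qed

lemma padic_cauchy_mult:
  assumes "padic_cauchy p X" "padic_cauchy p Y"
  shows "padic_cauchy p (\<lambda>n. X n * Y n)"
  unfolding padic_cauchy_def
proof (intro allI impI)
  fix e :: real assume e: "e > 0"
  obtain a where a: "a > 0" "\<And>n. padic_rat_norm p (X n) \<le> a" using padic_cauchy_bounded[OF assms(1)] by blast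
  obtain b where b: "b > 0" "\<And>n. padic_rat_norm p (Y n) \<le> b" using padic_cauchy_bounded[OF assms(2)] by blast
  have "e / b > 0" "e / a > 0" using e a b by simp_all
  then obtain k l where k: "\<forall>m\<ge>k. \<forall>n\<ge>k. padic_rat_norm p (X m - X n) < e / b" 
    and l: "\<forall>m\<ge>l. \<forall>n\<ge>l. padic_rat_norm p (Y m - Y n) < e / a"
    using assms e unfolding padic_cauchy_def by metis
  have "padic_rat_norm p (X m * Y m - X n * Y n) < e" if "m \<ge> max k l" "n \<ge> max k l" for m n
  proof -
    have "padic_rat_norm p (X m * Y m - X n * Y n) = padic_rat_norm p (X m * (Y m - Y n) + (X m - X n) * Y n)"
      by (simp add: algebra_simps)
    also have "\<dots> \<le> max (padic_rat_norm p (X m * (Y m - Y n))) (padic_rat_norm p ((X m - X n) * Y n))"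
      by (rule padic_rat_norm_add)
    also have "\<dots> = max (padic_rat_norm p (X m) * padic_rat_norm p (Y m - Y n)) (padic_rat_norm p (X m - X n) * padic_rat_norm p (Y n))"
      by (simp add: padic_rat_norm_mult)
    also have "\<dots> < e"
    proof -
      have "padic_rat_norm p (X m) * padic_rat_norm p (Y m - Y n) \<le> a * padic_rat_norm p (Y m - Y n)"
        using a by (intro mult_right_mono) auto
      also have "\<dots> < e" using l that a by (simp add: field_simps)
      finally have 1: "padic_rat_norm p (X m) * padic_rat_norm p (Y m - Y n) < e" .
      have "padic_rat_norm p (X m - X n) * padic_rat_norm p (Y n) \<le> padic_rat_norm p (X m - X n) * b"
        using b by (intro mult_left_mono) auto
      also have "\<dots> < e" using k that b by (simp add: field_simps)
      finally show ?thesis using 1 by simp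
    qed
    finally show ?thesis .
  qed
  thus "\<exists>k. \<forall>m\<ge>k. \<forall>n\<ge>k. padic_rat_norm p (X m * Y m - X n * Y n) < e" by blast
qed

lemma padic_cauchy_not_vanishes:
  assumes "padic_cauchy p X" "\<not> padic_vanishes p X"
  shows "\<exists>b>0. \<exists>k. \<forall>n\<ge>k. padic_rat_norm p (X n) > b"
proof -
  obtain L where L: "(\<lambda>n. padic_rat_norm p (X n)) \<longlonglongrightarrow> L"
    using padic_cauchy_Cauchy_norm[OF assms(1)] by (auto simp: convergent_def)
  have "L \<noteq> 0" using L assms(2) by (auto simp: padic_vanishes_def)
  moreover have "L \<ge> 0" using L by (rule LIMSEQ_le_const) simp
  ultimately have "L / 2 < L" "L / 2 > 0" by simp_all
  moreover from order_tendstoD(1)[OF L this(1)]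
  obtain k where "\<forall>n\<ge>k. padic_rat_norm p (X n) > L / 2" by (auto simp: eventually_sequentially)
  ultimately show ?thesis by blast
qed

lemma padic_norm_inverse_diff:
  assumes "x \<noteq> 0" "y \<noteq> 0"
  shows "padic_rat_norm p (inverse x - inverse y) = padic_rat_norm p (x - y) / (padic_rat_norm p x * padic_rat_norm p y)"
proof -
  have "inverse x - inverse y = (y - x) * inverse x * inverse y"
    using assms by (simp add: field_simps)
  thus ?thesis using padic_rat_norm_diff_commute[of y x]
    by (simp add: padic_rat_norm_mult padic_rat_norm_inverse divide_inverse)
qed

lemma padic_norm_inverse_diff_le:
  assumes "padic_rat_norm p x > a" "padic_rat_norm p y > b" "a > 0" "b > 0"
  shows "padic_rat_norm p (inverse x - inverse y) \<le> (1 / (a * b)) * padic_rat_norm p (x - y)"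
proof -
  have "x \<noteq> 0" "y \<noteq> 0" using assms by auto
  moreover have "padic_rat_norm p (x - y) / (padic_rat_norm p x * padic_rat_norm p y) \<le> padic_rat_norm p (x - y) / (a * b)"
    using assms by (intro divide_left_mono mult_mono mult_pos_pos) auto
  ultimately show ?thesis by (simp add: padic_norm_inverse_diff)
qed

lemma padic_cauchy_inverse:
  assumes "padic_cauchy p X" "\<not> padic_vanishes p X"
  shows "padic_cauchy p (\<lambda>n. inverse (X n))"
  unfolding padic_cauchy_def
proof (intro allI impI)
  fix e :: real assume e: "e > 0"
  obtain b k where b: "b > 0" "\<And>n. n \<ge> k \<Longrightarrow> padic_rat_norm p (X n) > b"
    using padic_cauchy_not_vanishes[OF assms] by blast
  have "e * (b * b) > 0" using e b by simp
  then obtain l where l: "\<forall>m\<ge>l. \<forall>n\<ge>l. padic_rat_norm p (X m - X n) < e * (b * b)"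
    using assms e unfolding padic_cauchy_def by metis
  have "padic_rat_norm p (inverse (X m) - inverse (X n)) < e" if "m \<ge> max k l" "n \<ge> max k l" for m n
  proof -
    have "padic_rat_norm p (inverse (X m) - inverse (X n)) \<le> (1 / (b * b)) * padic_rat_norm p (X m - X n)"
      using b that by (intro padic_norm_inverse_diff_le) auto
    also have "\<dots> < e" using l that b by (simp add: field_simps)
    finally show ?thesis .
  qed
  thus "\<exists>k. \<forall>m\<ge>k. \<forall>n\<ge>k. padic_rat_norm p (inverse (X m) - inverse (X n)) < e" by blast
qed

lemma padic_vanishes_diff_inverse:
  assumes "padic_cauchy p X" "\<not> padic_vanishes p X" "padic_cauchy p Y" "\<not> padic_vanishes p Y"
    "padic_vanishes p (\<lambda>n. X n - Y n)"
  shows "padic_vanishes p (\<lambda>n. inverse (X n) - inverse (Y n))"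
proof -
  obtain a k where a: "a > 0" "\<And>n. n \<ge> k \<Longrightarrow> padic_rat_norm p (X n) > a"
    using padic_cauchy_not_vanishes[OF assms(1,2)] by blast
  obtain b l where b: "b > 0" "\<And>n. n \<ge> l \<Longrightarrow> padic_rat_norm p (Y n) > b"
    using padic_cauchy_not_vanishes[OF assms(3,4)] by blast
  have "padic_rat_norm p (inverse (X n) - inverse (Y n)) \<le> (1 / (a * b)) * padic_rat_norm p (X n - Y n)" if "n \<ge> max k l" for n
    using a b that by (intro padic_norm_inverse_diff_le) auto
  hence "eventually (\<lambda>n. padic_rat_norm p (inverse (X n) - inverse (Y n)) \<le> (1 / (a * b)) * padic_rat_norm p (X n - Y n)) sequentially"
    unfolding eventually_sequentially by blast
  thus ?thesis by (rule padic_vanishes_dominated[OF assms(5)])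
qed

lemma padic_vanishes_diff_mult:
  assumes "padic_cauchy p X" "padic_cauchy p W"
    "padic_vanishes p (\<lambda>n. X n - Y n)" "padic_vanishes p (\<lambda>n. V n - W n)"
  shows "padic_vanishes p (\<lambda>n. X n * V n - Y n * W n)"
proof -
  obtain a where a: "a > 0" "\<And>n. padic_rat_norm p (X n) \<le> a" using padic_cauchy_bounded[OF assms(1)] by blast
  obtain b where b: "b > 0" "\<And>n. padic_rat_norm p (W n) \<le> b" using padic_cauchy_bounded[OF assms(2)] by blast
  have "padic_vanishes p (\<lambda>n. X n * (V n - W n))"
    by (rule padic_vanishes_dominated[OF assms(4), of _ a])
       (use a in \<open>simp add: padic_rat_norm_mult mult_right_mono\<close>)
  moreover have "padic_vanishes p (\<lambda>n. (X n - Y n) * W n)"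
    by (rule padic_vanishes_dominated[OF assms(3), of _ b])
       (use b in \<open>simp add: padic_rat_norm_mult mult.commute[of b] mult_left_mono\<close>)
  ultimately have "padic_vanishes p (\<lambda>n. X n * (V n - W n) + (X n - Y n) * W n)"
    by (rule padic_vanishes_add)
  thus ?thesis by (simp add: algebra_simps)
qed

end

definition padic_rel :: "nat \<Rightarrow> (nat \<Rightarrow> rat) \<Rightarrow> (nat \<Rightarrow> rat) \<Rightarrow> bool" where
  "padic_rel p X Y \<longleftrightarrow>
     padic_cauchy p X \<and> padic_cauchy p Y \<and> padic_vanishes p (\<lambda>n. X n - Y n)"

lemma part_equivp_padic_rel:
  assumes "prime p"
  shows "part_equivp (padic_rel p)"
proof (rule part_equivpI)
  show "\<exists>X. padic_rel p X X"
    by (rule exI[of _ "\<lambda>_. 0"]) (simp add: padic_rel_def padic_vanishes_def padic_cauchy_def)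
  show "symp (padic_rel p)"
    using padic_vanishes_minus[OF assms] by (fastforce simp: symp_def padic_rel_def)
  show "transp (padic_rel p)"
    using padic_vanishes_add[OF assms] by (fastforce simp: transp_def padic_rel_def)
qed

class prime_card =
  assumes prime_card: "prime CARD('a)"

instance Enum.finite_3 :: prime_card
proof
  have "prime (3 :: nat)" by simp
  thus "prime CARD(Enum.finite_3)" by (simp add: UNIV_finite_3 numeral_3_eq_3)
qed

typedef (overloaded) 'p padic =
  "{C. \<exists>X. padic_cauchy CARD('p::prime_card) X \<and> C = Collect (padic_rel CARD('p) X)}"
  by (auto intro: padic_cauchy_const[OF prime_card])

definition abs_padic :: "(nat \<Rightarrow> rat) \<Rightarrow> 'p::prime_card padic" where
  "abs_padic X = Abs_padic (Collect (padic_rel CARD('p) X))"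

definition rep_padic :: "'p::prime_card padic \<Rightarrow> nat \<Rightarrow> rat" where
  "rep_padic x = (SOME X. X \<in> Rep_padic x)"

lemma padic_rel_refl: "padic_rel p X X \<longleftrightarrow> padic_cauchy p X"
  by (simp add: padic_rel_def padic_vanishes_def)

lemma padic_exhaust:
  obtains X where "padic_cauchy CARD('p::prime_card) X" "(x :: 'p padic) = abs_padic X"
proof -
  obtain X where "padic_cauchy CARD('p) X" "Rep_padic x = Collect (padic_rel CARD('p) X)"
    using Rep_padic[of x] by auto
  thus ?thesis using that Rep_padic_inverse[of x] by (simp add: abs_padic_def)
qed

lemma abs_padic_eq_iff:
  assumes "padic_cauchy CARD('p::prime_card) X" "padic_cauchy CARD('p) Y"
  shows "(abs_padic X :: 'p padic) = abs_padic Y \<longleftrightarrow> padic_vanishes CARD('p) (\<lambda>n. X n - Y n)"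
proof -
  have pe: "part_equivp (padic_rel CARD('p))" by (rule part_equivp_padic_rel[OF prime_card])
  have "(abs_padic X :: 'p padic) = abs_padic Y \<longleftrightarrow>
      Collect (padic_rel CARD('p) X) = Collect (padic_rel CARD('p) Y)"
    unfolding abs_padic_def using assms by (subst Abs_padic_inject) auto
  also have "\<dots> \<longleftrightarrow> padic_rel CARD('p) X = padic_rel CARD('p) Y" by auto
  also have "\<dots> \<longleftrightarrow> padic_rel CARD('p) X Y"
    using pe assms unfolding part_equivp_def by (metis padic_rel_refl)
  finally show ?thesis using assms by (simp add: padic_rel_def)
qed

lemma abs_padic_eqI:
  assumes "padic_cauchy CARD('p::prime_card) X" "padic_cauchy CARD('p) Y"
    "padic_vanishes CARD('p) (\<lambda>n. X n - Y n)"
  shows "(abs_padic X :: 'p padic) = abs_padic Y"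
  using assms by (simp add: abs_padic_eq_iff)

lemma rep_abs_padic:
  assumes "padic_cauchy CARD('p::prime_card) X"
  shows "padic_cauchy CARD('p) (rep_padic (abs_padic X :: 'p padic))"
    "padic_vanishes CARD('p) (\<lambda>n. X n - rep_padic (abs_padic X :: 'p padic) n)"
proof -
  have "Rep_padic (abs_padic X :: 'p padic) = Collect (padic_rel CARD('p) X)"
    unfolding abs_padic_def using assms by (subst Abs_padic_inverse) auto
  moreover have "padic_rel CARD('p) X X" using assms by (simp add: padic_rel_refl)
  ultimately have "padic_rel CARD('p) X (rep_padic (abs_padic X :: 'p padic))"
    unfolding rep_padic_def by (metis mem_Collect_eq someI_ex)
  thus "padic_cauchy CARD('p) (rep_padic (abs_padic X :: 'p padic))"
    "padic_vanishes CARD('p) (\<lambda>n. X n - rep_padic (abs_padic X :: 'p padic) n)"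
    by (simp_all add: padic_rel_def)
qed

lemma rep_abs_padic':
  assumes "padic_cauchy CARD('p::prime_card) X"
  shows "padic_vanishes CARD('p) (\<lambda>n. rep_padic (abs_padic X :: 'p padic) n - X n)"
  using padic_vanishes_minus[OF prime_card rep_abs_padic(2)[OF assms]] by simp

instantiation padic :: (prime_card) field
begin

definition zero_padic :: "'a padic" where
  "0 = abs_padic (\<lambda>n. 0)"

definition one_padic :: "'a padic" where
  "1 = abs_padic (\<lambda>n. 1)"

definition plus_padic :: "'a padic \<Rightarrow> 'a padic \<Rightarrow> 'a padic" where
  "x + y = abs_padic (\<lambda>n. rep_padic x n + rep_padic y n)"

definition uminus_padic :: "'a padic \<Rightarrow> 'a padic" where
  "- x = abs_padic (\<lambda>n. - rep_padic x n)"

definition minus_padic :: "'a padic \<Rightarrow> 'a padic \<Rightarrow> 'a padic" where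
  "minus_padic x y = x + - y"

definition times_padic :: "'a padic \<Rightarrow> 'a padic \<Rightarrow> 'a padic" where
  "x * y = abs_padic (\<lambda>n. rep_padic x n * rep_padic y n)"

definition inverse_padic :: "'a padic \<Rightarrow> 'a padic" where
  "inverse x = (if x = 0 then 0 else abs_padic (\<lambda>n. inverse (rep_padic x n)))"

definition divide_padic :: "'a padic \<Rightarrow> 'a padic \<Rightarrow> 'a padic" where
  "divide_padic x y = x * inverse y"

lemma abs_padic_add:
  assumes "padic_cauchy CARD('a) X" "padic_cauchy CARD('a) Y"
  shows "(abs_padic X :: 'a padic) + abs_padic Y = abs_padic (\<lambda>n. X n + Y n)"
  unfolding plus_padic_def
proof (rule abs_padic_eqI)
  show "padic_vanishes CARD('a)
     (\<lambda>n. rep_padic (abs_padic X :: 'a padic) n + rep_padic (abs_padic Y :: 'a padic) n - (X n + Y n))"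
    unfolding add_diff_add by (intro padic_vanishes_add[OF prime_card] rep_abs_padic' assms)
qed (intro padic_cauchy_add[OF prime_card] rep_abs_padic assms)+

lemma abs_padic_minus:
  assumes "padic_cauchy CARD('a) X"
  shows "- (abs_padic X :: 'a padic) = abs_padic (\<lambda>n. - X n)"
  unfolding uminus_padic_def
proof (rule abs_padic_eqI)
  show "padic_vanishes CARD('a) (\<lambda>n. - rep_padic (abs_padic X :: 'a padic) n - - X n)"
    unfolding minus_diff_minus by (intro padic_vanishes_minus[OF prime_card] rep_abs_padic' assms)
qed (intro padic_cauchy_minus[OF prime_card] rep_abs_padic assms)+

lemma abs_padic_mult:
  assumes "padic_cauchy CARD('a) X" "padic_cauchy CARD('a) Y"
  shows "(abs_padic X :: 'a padic) * abs_padic Y = abs_padic (\<lambda>n. X n * Y n)"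
  unfolding times_padic_def
  by (intro abs_padic_eqI padic_vanishes_diff_mult[OF prime_card] padic_cauchy_mult[OF prime_card]
      rep_abs_padic rep_abs_padic' assms)

lemma abs_padic_eq_0_iff:
  assumes "padic_cauchy CARD('a) X"
  shows "(abs_padic X :: 'a padic) = 0 \<longleftrightarrow> padic_vanishes CARD('a) X"
  using abs_padic_eq_iff[OF assms padic_cauchy_const[OF prime_card, of 0]]
  by (simp add: zero_padic_def)

lemma abs_padic_inverse:
  assumes X: "padic_cauchy CARD('a) X" and nv: "\<not> padic_vanishes CARD('a) X"
  shows "inverse (abs_padic X :: 'a padic) = abs_padic (\<lambda>n. inverse (X n))"
proof -
  let ?Y = "rep_padic (abs_padic X :: 'a padic)"
  have Y: "padic_cauchy CARD('a) ?Y" by (rule rep_abs_padic[OF X])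
  have "\<not> padic_vanishes CARD('a) ?Y"
    using padic_vanishes_add[OF prime_card rep_abs_padic(2)[OF X]] nv by fastforce
  hence "(abs_padic (\<lambda>n. inverse (?Y n)) :: 'a padic) = abs_padic (\<lambda>n. inverse (X n))"
    using X Y nv
    by (intro abs_padic_eqI padic_vanishes_diff_inverse[OF prime_card]
        padic_cauchy_inverse[OF prime_card] rep_abs_padic') auto
  thus ?thesis using abs_padic_eq_0_iff[OF X] nv by (simp add: inverse_padic_def)
qed

instance
proof
  note [simp] = padic_cauchy_add[OF prime_card] padic_cauchy_mult[OF prime_card]
    padic_cauchy_minus[OF prime_card] padic_cauchy_const[OF prime_card]
    abs_padic_add abs_padic_minus abs_padic_mult
  fix a b c :: "'a padic"
  obtain X where X [simp]: "padic_cauchy CARD('a) X" and a: "a = abs_padic X" by (rule padic_exhaust)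
  obtain Y where Y [simp]: "padic_cauchy CARD('a) Y" and b: "b = abs_padic Y" by (rule padic_exhaust)
  obtain Z where Z [simp]: "padic_cauchy CARD('a) Z" and c: "c = abs_padic Z" by (rule padic_exhaust)
  show "a + b = b + a"
    by (simp add: a b add.commute)
  show "(a + b) + c = a + (b + c)"
    by (simp add: a b c add.assoc)
  show "0 + a = a"
    by (simp add: a zero_padic_def)
  show "- a + a = 0"
    by (simp add: a zero_padic_def)
  show "a - b = a + - b"
    by (rule minus_padic_def)
  show "(a * b) * c = a * (b * c)"
    by (simp add: a b c mult.assoc)
  show "a * b = b * a"
    by (simp add: a b mult.commute)
  show "1 * a = a"
    by (simp add: a one_padic_def)
  show "(a + b) * c = a * c + b * c"
    by (simp add: a b c distrib_right)
  show "(0::'a padic) \<noteq> 1"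
  proof -
    have "(1 :: 'a padic) \<noteq> 0"
      unfolding one_padic_def
      by (subst abs_padic_eq_0_iff) (simp_all add: padic_vanishes_const[OF prime_card])
    thus ?thesis by simp
  qed
  show "inverse a * a = 1" if "a \<noteq> 0"
  proof -
    have nv: "\<not> padic_vanishes CARD('a) X" using that by (simp add: a abs_padic_eq_0_iff)
    obtain b k where "b > 0" and k: "\<forall>n\<ge>k. padic_rat_norm CARD('a) (X n) > b"
      using padic_cauchy_not_vanishes[OF prime_card X nv] by blast
    then have "X n \<noteq> 0" if "n \<ge> k" for n using that by force
    then have "eventually (\<lambda>n. padic_rat_norm CARD('a) (inverse (X n) * X n - 1) = 0) sequentially"
      unfolding eventually_sequentially by (intro exI[of _ k]) auto
    then have "padic_vanishes CARD('a) (\<lambda>n. inverse (X n) * X n - 1)"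
      unfolding padic_vanishes_def by (rule tendsto_eventually)
    moreover have "padic_cauchy CARD('a) (\<lambda>n. inverse (X n))"
      by (rule padic_cauchy_inverse[OF prime_card X nv])
    ultimately show ?thesis
      by (simp add: a abs_padic_inverse nv one_padic_def abs_padic_eq_iff)
  qed
  show "a div b = a * inverse b"
    by (rule divide_padic_def)
  show "inverse (0::'a padic) = 0"
    by (simp add: inverse_padic_def)
qed

end

definition padic_norm :: "'p::prime_card padic \<Rightarrow> real" where
  "padic_norm x = lim (\<lambda>n. padic_rat_norm CARD('p) (rep_padic x n))"

lemma padic_norm_LIMSEQ:
  assumes X: "padic_cauchy CARD('p::prime_card) X"
  shows "(\<lambda>n. padic_rat_norm CARD('p) (X n)) \<longlonglongrightarrow> padic_norm (abs_padic X :: 'p padic)"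
proof -
  let ?Y = "rep_padic (abs_padic X :: 'p padic)"
  have L: "(\<lambda>n. padic_rat_norm CARD('p) (?Y n)) \<longlonglongrightarrow> padic_norm (abs_padic X :: 'p padic)"
    unfolding padic_norm_def
    using padic_cauchy_Cauchy_norm[OF prime_card rep_abs_padic(1)[OF X]]
    by (simp add: convergent_LIMSEQ_iff)
  have "(\<lambda>n. padic_rat_norm CARD('p) (X n) - padic_rat_norm CARD('p) (?Y n)) \<longlonglongrightarrow> 0"
    by (rule Lim_null_comparison[OF _ rep_abs_padic(2)[OF X, unfolded padic_vanishes_def]])
       (simp add: padic_rat_norm_triangle3[OF prime_card])
  from tendsto_add[OF this L] show ?thesis by simp
qed

lemma padic_norm_nonneg [simp]: "padic_norm (x :: 'p::prime_card padic) \<ge> 0"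
proof -
  obtain X where X: "padic_cauchy CARD('p) X" "x = abs_padic X" by (rule padic_exhaust)
  show ?thesis unfolding X(2)
    by (rule LIMSEQ_le_const[OF padic_norm_LIMSEQ[OF X(1)]]) (simp add: padic_rat_norm_nonneg[OF prime_card])
qed

lemma padic_norm_eq_0 [simp]: "padic_norm (x :: 'p::prime_card padic) = 0 \<longleftrightarrow> x = 0"
proof -
  obtain X where X: "padic_cauchy CARD('p) X" "x = abs_padic X" by (rule padic_exhaust)
  have "padic_norm x = 0 \<longleftrightarrow> padic_vanishes CARD('p) X"
    using padic_norm_LIMSEQ[OF X(1)] LIMSEQ_unique unfolding padic_vanishes_def X(2) by metis
  also have "\<dots> \<longleftrightarrow> x = 0" using X by (simp add: abs_padic_eq_0_iff)
  finally show ?thesis .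
qed

lemma padic_norm_mult: "padic_norm (x * y) = padic_norm x * padic_norm (y :: 'p::prime_card padic)"
proof -
  obtain X where X: "padic_cauchy CARD('p) X" "x = abs_padic X" by (rule padic_exhaust)
  obtain Y where Y: "padic_cauchy CARD('p) Y" "y = abs_padic Y" by (rule padic_exhaust)
  have "x * y = abs_padic (\<lambda>n. X n * Y n)"
    using X Y by (simp add: abs_padic_mult)
  moreover have "(\<lambda>n. padic_rat_norm CARD('p) (X n * Y n)) \<longlonglongrightarrow> padic_norm x * padic_norm y"
    using tendsto_mult[OF padic_norm_LIMSEQ[OF X(1)] padic_norm_LIMSEQ[OF Y(1)]] X Y
    by (simp add: padic_rat_norm_mult[OF prime_card])
  ultimately show ?thesis
    using padic_norm_LIMSEQ[OF padic_cauchy_mult[OF prime_card X(1) Y(1)]] LIMSEQ_unique by metis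
qed

lemma padic_norm_add: "padic_norm (x + y) \<le> max (padic_norm x) (padic_norm (y :: 'p::prime_card padic))"
proof -
  obtain X where X: "padic_cauchy CARD('p) X" "x = abs_padic X" by (rule padic_exhaust)
  obtain Y where Y: "padic_cauchy CARD('p) Y" "y = abs_padic Y" by (rule padic_exhaust)
  have "x + y = abs_padic (\<lambda>n. X n + Y n)"
    using X Y by (simp add: abs_padic_add)
  moreover have "(\<lambda>n. max (padic_rat_norm CARD('p) (X n)) (padic_rat_norm CARD('p) (Y n)))
      \<longlonglongrightarrow> max (padic_norm x) (padic_norm y)"
    using tendsto_max[OF padic_norm_LIMSEQ[OF X(1)] padic_norm_LIMSEQ[OF Y(1)]] X Y by simp
  moreover have "padic_rat_norm CARD('p) (X n + Y n) \<le>
      max (padic_rat_norm CARD('p) (X n)) (padic_rat_norm CARD('p) (Y n))" for n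
    by (rule padic_rat_norm_add[OF prime_card])
  ultimately show ?thesis
    using LIMSEQ_le[OF padic_norm_LIMSEQ[OF padic_cauchy_add[OF prime_card X(1) Y(1)]]] by simp
qed

lemma padic_norm_one [simp]: "padic_norm (1 :: 'p::prime_card padic) = 1"
proof -
  have "padic_norm (1 :: 'p padic) * padic_norm (1 :: 'p padic) = padic_norm (1 :: 'p padic)"
    by (simp flip: padic_norm_mult)
  moreover have "padic_norm (1 :: 'p padic) \<noteq> 0" by simp
  ultimately show ?thesis by simp
qed

lemma padic_norm_minus [simp]: "padic_norm (- x) = padic_norm (x :: 'p::prime_card padic)"
proof -
  have "padic_norm (-1 :: 'p padic) * padic_norm (-1 :: 'p padic) = 1" by (simp flip: padic_norm_mult)
  hence "padic_norm (-1 :: 'p padic) = 1"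
    using padic_norm_nonneg[of "-1 :: 'p padic"] by (simp add: square_eq_1_iff)
  thus ?thesis using padic_norm_mult[of "-1" x] by simp
qed

instantiation padic :: (prime_card) metric_space
begin

definition dist_padic :: "'a padic \<Rightarrow> 'a padic \<Rightarrow> real" where
  "dist_padic x y = padic_norm (x - y)"

definition uniformity_padic :: "('a padic \<times> 'a padic) filter" where
  "uniformity_padic = (INF e\<in>{0 <..}. principal {(x, y). dist x y < e})"

definition open_padic :: "'a padic set \<Rightarrow> bool" where
  "open_padic U \<longleftrightarrow> (\<forall>x\<in>U. eventually (\<lambda>(x', y). x' = x \<longrightarrow> y \<in> U) uniformity)"

instance
proof
  fix x y z :: "'a padic"
  show "uniformity = (INF e\<in>{0 <..}. principal {(x, y). dist x y < (e::real)} :: ('a padic \<times> 'a padic) filter)"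
    by (rule uniformity_padic_def)
  show "open U \<longleftrightarrow> (\<forall>x\<in>U. eventually (\<lambda>(x', y). x' = x \<longrightarrow> y \<in> U) uniformity)" for U :: "'a padic set"
    by (rule open_padic_def)
  show "dist x y = 0 \<longleftrightarrow> x = y"
    by (simp add: dist_padic_def)
  show "dist x y \<le> dist x z + dist y z"
  proof -
    have "padic_norm (x - y) = padic_norm ((x - z) + - (y - z))" by simp
    also have "\<dots> \<le> max (padic_norm (x - z)) (padic_norm (- (y - z)))" by (rule padic_norm_add)
    also have "\<dots> \<le> padic_norm (x - z) + padic_norm (y - z)" unfolding padic_norm_minus by simp
    finally show ?thesis by (simp add: dist_padic_def)
  qed
qed

end

lemma of_nat_padic: "(of_nat k :: 'p::prime_card padic) = abs_padic (\<lambda>_. of_nat k)"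
proof (induct k)
  case (Suc k)
  thus ?case
    by (simp add: one_padic_def abs_padic_add padic_cauchy_const[OF prime_card])
qed (simp add: zero_padic_def)

lemma padic_norm_const: "padic_norm (abs_padic (\<lambda>_. r) :: 'p padic) = padic_rat_norm CARD('p::prime_card) r"
  using padic_norm_LIMSEQ[where ?'p = 'p, OF padic_cauchy_const[OF prime_card, of r]]
  by (simp add: LIMSEQ_const_iff)

instance padic :: (prime_card) field_char_0
proof
  show "inj (of_nat :: nat \<Rightarrow> 'a padic)"
  proof (rule injI)
    fix k l :: nat
    assume "(of_nat k :: 'a padic) = of_nat l"
    thus "k = l"
      by (simp add: of_nat_padic abs_padic_eq_iff padic_cauchy_const[OF prime_card]
          padic_vanishes_const[OF prime_card])
  qed
qed

lemma of_rat_padic: "(of_rat r :: 'p::prime_card padic) = abs_padic (\<lambda>_. r)"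
proof -
  have int: "(of_int k :: 'p padic) = abs_padic (\<lambda>_. of_int k)" for k
  proof (cases k)
    case (neg m)
    have "(of_int k :: 'p padic) = - of_nat (Suc m)" using neg by simp
    also have "\<dots> = abs_padic (\<lambda>_. of_int k)"
      unfolding of_nat_padic using neg by (simp add: abs_padic_minus padic_cauchy_const[OF prime_card])
    finally show ?thesis .
  qed (simp add: of_nat_padic)
  obtain a b where r: "r = of_int a / of_int b" "b \<noteq> 0" by (rule rat_rep[OF prime_card])
  have "(abs_padic (\<lambda>_. r) :: 'p padic) * of_int b = of_int a"
    unfolding int using r by (simp add: abs_padic_mult padic_cauchy_const[OF prime_card])
  hence "(abs_padic (\<lambda>_. r) :: 'p padic) = of_int a / of_int b"
    using r(2) nonzero_eq_divide_eq[of "of_int b :: 'p padic"] by simp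
  also have "\<dots> = of_rat r" by (simp add: r(1) of_rat_divide)
  finally show ?thesis by (rule sym)
qed

lemma padic_norm_of_rat: "padic_norm (of_rat r :: 'p padic) = padic_rat_norm CARD('p::prime_card) r"
  by (simp add: of_rat_padic padic_norm_const)

lemma padic_cauchy_LIMSEQ:
  assumes "padic_cauchy CARD('p::prime_card) X"
  shows "(\<lambda>n. of_rat (X n)) \<longlonglongrightarrow> (abs_padic X :: 'p padic)"
proof (rule metric_LIMSEQ_I)
  fix e :: real assume e: "e > 0"
  obtain k where k: "\<forall>m\<ge>k. \<forall>n\<ge>k. padic_rat_norm CARD('p) (X m - X n) < e / 2"
    using assms e unfolding padic_cauchy_def by (meson half_gt_zero)
  show "\<exists>no. \<forall>n\<ge>no. dist (of_rat (X n)) (abs_padic X :: 'p padic) < e"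
  proof (intro exI allI impI)
    fix n assume n: "n \<ge> k"
    have C: "padic_cauchy CARD('p) (\<lambda>m. X n + - X m)"
      by (intro padic_cauchy_add[OF prime_card] padic_cauchy_minus[OF prime_card] assms
          padic_cauchy_const[OF prime_card])
    have "(of_rat (X n) - abs_padic X :: 'p padic) = abs_padic (\<lambda>m. X n + - X m)"
      unfolding of_rat_padic minus_padic_def using assms
      by (simp add: abs_padic_minus abs_padic_add padic_cauchy_const[OF prime_card]
          padic_cauchy_minus[OF prime_card])
    hence "padic_norm (of_rat (X n) - abs_padic X :: 'p padic) \<le> e / 2"
      using LIMSEQ_le_const2[OF padic_norm_LIMSEQ[OF C], of "e / 2"] k n by (auto intro: less_imp_le)
    thus "dist (of_rat (X n)) (abs_padic X :: 'p padic) < e"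
      using e by (simp add: dist_padic_def)
  qed
qed

lemma padic_rat_dense:
  assumes "e > 0"
  shows "\<exists>r. dist (of_rat r) (x :: 'p::prime_card padic) < e"
proof -
  obtain X where X: "padic_cauchy CARD('p) X" "x = abs_padic X" by (rule padic_exhaust)
  show ?thesis using metric_LIMSEQ_D[OF padic_cauchy_LIMSEQ[OF X(1)] assms] X(2) by blast
qed

instance padic :: (prime_card) complete_space
proof
  fix X :: "nat \<Rightarrow> 'a padic"
  assume X: "Cauchy X"
  have "\<forall>n. \<exists>r. dist (of_rat r) (X n) < inverse (real (Suc n))"
    by (intro allI padic_rat_dense) simp
  then obtain R where R: "\<And>n. dist (of_rat (R n)) (X n) < inverse (real (Suc n))"
    by metis
  have lim: "(\<lambda>n. dist (of_rat (R n)) (X n)) \<longlonglongrightarrow> 0"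
  proof (rule tendsto_sandwich[OF _ _ tendsto_const LIMSEQ_inverse_real_of_nat])
    show "\<forall>\<^sub>F n in sequentially. dist (of_rat (R n)) (X n) \<le> inverse (real (Suc n))"
      by (intro always_eventually allI less_imp_le R)
  qed simp
  have C: "padic_cauchy CARD('a) R"
    unfolding padic_cauchy_def
  proof (intro allI impI)
    fix e :: real assume e: "e > 0"
    obtain k where k: "\<forall>m\<ge>k. \<forall>n\<ge>k. dist (X m) (X n) < e / 3"
      using metric_CauchyD[OF X, of "e / 3"] e by auto
    obtain l where l: "\<forall>n\<ge>l. dist (of_rat (R n)) (X n) < e / 3"
      using order_tendstoD(2)[OF lim, of "e / 3"] e by (auto simp: eventually_sequentially)
    have "padic_rat_norm CARD('a) (R m - R n) < e" if "m \<ge> max k l" "n \<ge> max k l" for m n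
    proof -
      have "padic_rat_norm CARD('a) (R m - R n) = dist (of_rat (R m) :: 'a padic) (of_rat (R n))"
        by (simp add: dist_padic_def padic_norm_of_rat flip: of_rat_diff)
      also have "\<dots> \<le> dist (of_rat (R m)) (X m) + dist (X m) (X n) + dist (of_rat (R n)) (X n)"
        using dist_triangle[of "of_rat (R m)" "of_rat (R n)" "X m"]
          dist_triangle2[of "X m" "of_rat (R n)" "X n"] by linarith
      also have "\<dots> < e / 3 + e / 3 + e / 3" using k l that by (intro add_strict_mono) auto
      finally show ?thesis by simp
    qed
    thus "\<exists>k. \<forall>m\<ge>k. \<forall>n\<ge>k. padic_rat_norm CARD('a) (R m - R n) < e" by blast
  qed
  have "(\<lambda>n. dist (of_rat (R n)) (abs_padic R :: 'a padic)) \<longlonglongrightarrow> 0"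
    by (rule tendsto_dist_iff[THEN iffD1, OF padic_cauchy_LIMSEQ[OF C]])
  from tendsto_add[OF lim this]
  have "(\<lambda>n. dist (of_rat (R n)) (X n) + dist (of_rat (R n)) (abs_padic R :: 'a padic)) \<longlonglongrightarrow> 0"
    by simp
  moreover have "\<forall>n. norm (dist (X n) (abs_padic R :: 'a padic)) \<le>
      dist (of_rat (R n)) (X n) + dist (of_rat (R n)) (abs_padic R :: 'a padic)"
    using dist_triangle3[of _ "abs_padic R :: 'a padic"] by simp
  ultimately have "(\<lambda>n. dist (X n) (abs_padic R)) \<longlonglongrightarrow> 0"
    by (rule Lim_null_comparison[OF always_eventually, rotated])
  hence "X \<longlonglongrightarrow> abs_padic R" by (rule tendsto_dist_iff[THEN iffD2])
  thus "convergent X" by (auto simp: convergent_def)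
qed


definition padic_p :: "'p::prime_card padic" where
  "padic_p = of_nat CARD('p)"

definition padic_ints :: "'p::prime_card padic set" where
  "padic_ints = {x. padic_norm x \<le> 1}"

definition padic_units :: "'p::prime_card padic set" where
  "padic_units = {x. padic_norm x = 1}"

text \<open>The ideal \<open>p\<^sup>m \<int>\<^sub>p\<close>.\<close>

definition padic_ideal :: "nat \<Rightarrow> 'p::prime_card padic set" where
  "padic_ideal m = {padic_p ^ m * z |z. z \<in> padic_ints}"

definition padic_ord :: "'p::prime_card padic \<Rightarrow> int" where
  "padic_ord x = (THE k. padic_norm x = real CARD('p) powi (- k))"

definition square_mod_p :: "'p::prime_card padic \<Rightarrow> bool" where
  "square_mod_p u \<longleftrightarrow> (\<exists>z\<in>padic_ints. u - z\<^sup>2 \<in> padic_ideal 1)"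

definition padic_legendre :: "'p::prime_card padic \<Rightarrow> int" where
  "padic_legendre u = (if u \<in> padic_ideal 1 then 0 else if square_mod_p u then 1 else -1)"

definition hilbert_symbol :: "'p::prime_card padic \<Rightarrow> 'p padic \<Rightarrow> int" where
  "hilbert_symbol a b =
     (if \<exists>x y z. (x, y, z) \<noteq> (0, 0, 0) \<and> z\<^sup>2 = a * x\<^sup>2 + b * y\<^sup>2 then 1 else -1)"

type_synonym 'p matr = "'p padic ^ 2 ^ 2"

definition mat2 :: "'p::prime_card padic \<Rightarrow> 'p padic \<Rightarrow> 'p padic \<Rightarrow> 'p padic \<Rightarrow> 'p matr" where
  "mat2 a b c d = vector [vector [a, b], vector [c, d]]"

definition upper_x :: "'p::prime_card padic \<Rightarrow> 'p matr" where
  "upper_x s = mat2 1 s 0 1"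

definition lower_y :: "'p::prime_card padic \<Rightarrow> 'p matr" where
  "lower_y s = mat2 1 0 s 1"

definition diag_h :: "'p::prime_card padic \<Rightarrow> 'p matr" where
  "diag_h t = mat2 t 0 0 (inverse t)"

definition SL2 :: "'p::prime_card matr set" where
  "SL2 = {g. det g = 1}"

definition SL2_ints :: "'p::prime_card matr set" where
  "SL2_ints = {g \<in> SL2. \<forall>i j. g $ i $ j \<in> padic_ints}"

definition K0 :: "nat \<Rightarrow> 'p::prime_card matr set" where
  "K0 m = {g \<in> SL2_ints. g $ 2 $ 1 \<in> padic_ideal m}"

definition tau :: "'p::prime_card matr \<Rightarrow> 'p padic" where
  "tau A = (if A $ 2 $ 1 \<noteq> 0 then A $ 2 $ 1 else A $ 2 $ 2)"

definition s_p :: "'p::prime_card matr \<Rightarrow> int" where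
  "s_p g = (if g $ 2 $ 1 * g $ 2 $ 2 \<noteq> 0 \<and> odd (padic_ord (g $ 2 $ 1))
            then hilbert_symbol (g $ 2 $ 1) (g $ 2 $ 2) else 1)"

definition cocycle :: "'p::prime_card matr \<Rightarrow> 'p matr \<Rightarrow> int" where
  "cocycle g h = hilbert_symbol (tau (g ** h) * tau g) (tau (g ** h) * tau h) *
     s_p g * s_p h * s_p (g ** h)"

type_synonym 'p cover = "'p matr \<times> int"

definition full_preimage :: "'p::prime_card matr set \<Rightarrow> 'p cover set" where
  "full_preimage S = S \<times> {1, -1}"

definition cover_group :: "'p::prime_card cover set" where
  "cover_group = full_preimage SL2"

definition cover_mult :: "'p::prime_card cover \<Rightarrow> 'p cover \<Rightarrow> 'p cover" (infixl "\<odot>" 70) where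
  "x \<odot> y = (fst x ** fst y, snd x * snd y * cocycle (fst x) (fst y))"

definition cover_borel :: "'p::prime_card cover set" where
  "cover_borel = full_preimage {g \<in> SL2. g $ 2 $ 1 = 0}"

definition eta_cover :: "('p::prime_card padic \<Rightarrow> complex) \<Rightarrow> 'p cover \<Rightarrow> complex" where
  "eta_cover \<eta> k = of_int (snd k) * \<eta> (fst k $ 2 $ 2)"

definition additive_character :: "('p::prime_card padic \<Rightarrow> complex) \<Rightarrow> bool" where
  "additive_character \<psi> \<longleftrightarrow> continuous_on UNIV \<psi> \<and>
     (\<forall>x y. \<psi> (x + y) = \<psi> x * \<psi> y) \<and> (\<forall>x. norm (\<psi> x) = 1)"

definition conductor_zero :: "('p::prime_card padic \<Rightarrow> complex) \<Rightarrow> bool" where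
  "conductor_zero \<psi> \<longleftrightarrow>
     (\<forall>x\<in>padic_ints. \<psi> x = 1) \<and> (\<exists>x. padic_p * x \<in> padic_ints \<and> \<psi> x \<noteq> 1)"

text \<open>Characters of \<open>\<rat>\<^sub>p\<^sup>\<times>\<close> are not assumed unitary; their value at \<open>0\<close> is irrelevant.\<close>

definition mult_character :: "('p::prime_card padic \<Rightarrow> complex) \<Rightarrow> bool" where
  "mult_character \<mu> \<longleftrightarrow> continuous_on (- {0}) \<mu> \<and>
     (\<forall>x y. x \<noteq> 0 \<longrightarrow> y \<noteq> 0 \<longrightarrow> \<mu> (x * y) = \<mu> x * \<mu> y) \<and> (\<forall>x. x \<noteq> 0 \<longrightarrow> \<mu> x \<noteq> 0)"

definition unit_filtration :: "nat \<Rightarrow> 'p::prime_card padic set" where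
  "unit_filtration m = {u \<in> padic_units. m = 0 \<or> u - 1 \<in> padic_ideal m}"

definition conductor_exponent :: "('p::prime_card padic \<Rightarrow> complex) \<Rightarrow> nat \<Rightarrow> bool" where
  "conductor_exponent \<mu> n \<longleftrightarrow> (\<forall>u\<in>unit_filtration n. \<mu> u = 1) \<and>
     (\<forall>m<n. \<exists>u\<in>unit_filtration m. \<mu> u \<noteq> 1)"

text \<open>Haar integral of a continuous function over \<open>p\<^sup>-\<^sup>N \<int>\<^sub>p\<close>, with \<open>\<int>\<^sub>p\<close> of volume 1, as the limit of the
  Riemann sums over the cosets of \<open>p\<^sup>M \<int>\<^sub>p\<close>, which are represented by \<open>j / p\<^sup>N\<close>.\<close>

definition ball_integral :: "nat \<Rightarrow> ('p::prime_card padic \<Rightarrow> complex) \<Rightarrow> complex" where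
  "ball_integral N f =
     lim (\<lambda>M. (\<Sum>j<CARD('p) ^ (N + M). f (of_nat j / padic_p ^ N)) / of_nat (CARD('p) ^ M))"

text \<open>The Weil index of \<open>x \<mapsto> x\<^sup>2\<close> with respect to \<open>\<phi>\<close> is the phase of the conditionally convergent
  integral of \<open>\<phi>(x\<^sup>2)\<close>; passing to the phase makes it independent of the Haar measure.\<close>

definition weil_index :: "('p::prime_card padic \<Rightarrow> complex) \<Rightarrow> complex" where
  "weil_index \<phi> = lim (\<lambda>N. sgn (ball_integral N (\<lambda>x. \<phi> (x\<^sup>2))))"

definition weil_gamma :: "'p::prime_card padic \<Rightarrow> ('p padic \<Rightarrow> complex) \<Rightarrow> complex" where
  "weil_gamma a \<psi> = weil_index (\<lambda>x. \<psi> (a * x)) / weil_index \<psi>"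

definition mu_B :: "('p::prime_card padic \<Rightarrow> complex) \<Rightarrow> ('p padic \<Rightarrow> complex) \<Rightarrow> 'p cover \<Rightarrow> complex" where
  "mu_B \<mu> \<psi> x = (let a = fst x $ 1 $ 1 in
     of_int (snd x) * of_real (padic_norm a) * \<mu> a * inverse (weil_gamma a \<psi>))"

lemma mu_B_eq:
  "mu_B \<mu> \<psi> (diag_h a ** upper_x b, \<epsilon>) =
     of_int \<epsilon> * of_real (padic_norm a) * \<mu> a * inverse (weil_gamma a \<psi>)"
  by (simp add: mu_B_def diag_h_def upper_x_def mat2_def matrix_matrix_mult_def sum_2)

text \<open>The topology of the cover is the one for which \<open>k \<mapsto> (k, 1)\<close> is a homeomorphism of \<open>SL\<^sub>2(\<int>\<^sub>p)\<close> onto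
  an open subgroup, so small neighbourhoods of \<open>g\<close> are the sets \<open>g (k, 1)\<close> with \<open>k\<close> in a principal
  congruence subgroup. It differs from the product topology, since the cocycle is not
  locally constant at all upper triangular matrices.\<close>

definition principal_congruence :: "nat \<Rightarrow> 'p::prime_card matr set" where
  "principal_congruence m = {g \<in> SL2_ints. \<forall>i j. (g - mat 1) $ i $ j \<in> padic_ideal m}"

definition locally_constant :: "('p::prime_card cover \<Rightarrow> complex) \<Rightarrow> bool" where
  "locally_constant f \<longleftrightarrow>
     (\<forall>g\<in>cover_group. \<exists>m. \<forall>k\<in>principal_congruence m. f (g \<odot> (k, 1)) = f g)"

definition principal_series ::
    "('p::prime_card padic \<Rightarrow> complex) \<Rightarrow> ('p padic \<Rightarrow> complex) \<Rightarrow> ('p cover \<Rightarrow> complex) set" where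
  "principal_series \<mu> \<psi> = {f \<in> extensional cover_group. locally_constant f \<and>
     (\<forall>b\<in>cover_borel. \<forall>g\<in>cover_group. f (b \<odot> g) = mu_B \<mu> \<psi> b * f g)}"

definition eta_isotypic :: "('p::prime_card padic \<Rightarrow> complex) \<Rightarrow> ('p padic \<Rightarrow> complex) \<Rightarrow>
    ('p padic \<Rightarrow> complex) \<Rightarrow> nat \<Rightarrow> ('p cover \<Rightarrow> complex) set" where
  "eta_isotypic \<mu> \<psi> \<eta> m = {f \<in> principal_series \<mu> \<psi>.
     \<forall>g\<in>cover_group. \<forall>k\<in>full_preimage (K0 m). f (g \<odot> k) = f g * eta_cover \<eta> k}"

definition f_kappa :: "('p::prime_card padic \<Rightarrow> complex) \<Rightarrow> ('p padic \<Rightarrow> complex) \<Rightarrow>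
    ('p padic \<Rightarrow> complex) \<Rightarrow> nat \<Rightarrow> 'p padic \<Rightarrow> 'p cover \<Rightarrow> complex" where
  "f_kappa \<mu> \<psi> \<eta> n \<kappa> = (THE f. f \<in> eta_isotypic \<mu> \<psi> \<eta> (2 * n) \<and>
     (\<forall>b\<in>cover_borel. \<forall>k\<in>full_preimage (K0 (2 * n)).
        f (b \<odot> (lower_y (\<kappa> * padic_p ^ n), 1) \<odot> k) = mu_B \<mu> \<psi> b * eta_cover \<eta> k) \<and>
     (\<forall>g\<in>cover_group.
        (\<nexists>b k. b \<in> cover_borel \<and> k \<in> full_preimage (K0 (2 * n)) \<and>
           g = b \<odot> (lower_y (\<kappa> * padic_p ^ n), 1) \<odot> k) \<longrightarrow> f g = 0))"

definition sqrt_units :: "'p::prime_card padic set" where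
  "sqrt_units = {u \<in> padic_units. u\<^sup>2 - 1 \<in> padic_ideal 1}"

definition unit_classes :: "'p::prime_card padic set set" where
  "unit_classes =
     padic_units // {(u, v). u \<in> padic_units \<and> v \<in> padic_units \<and> v / u \<in> sqrt_units}"

text \<open>The operator \<open>\<V>\<^bsub>m,\<beta>\<^esub>\<close>; its summand depends only on the class of \<open>u\<close>.\<close>

definition hecke_V :: "('p::prime_card padic \<Rightarrow> complex) \<Rightarrow> nat \<Rightarrow> 'p padic \<Rightarrow>
    ('p cover \<Rightarrow> complex) \<Rightarrow> 'p cover \<Rightarrow> complex" where
  "hecke_V \<eta> m \<beta> f g = (\<Sum>C\<in>unit_classes. let u = (SOME u. u \<in> C) in
     \<eta> u * f (g \<odot> (diag_h u, 1) \<odot> (lower_y (\<beta> * padic_p ^ m), 1)))"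

definition sqrt_p_star :: "('p::prime_card padic \<Rightarrow> complex) \<Rightarrow> complex" where
  "sqrt_p_star \<psi> = weil_gamma padic_p \<psi> * of_real (sqrt (real CARD('p)))"

end

theory Submission
  imports Defs
begin

text \<open>
  The function \<open>f\<^sub>\<kappa>\<close> lives on the double coset \<open>B y(\<kappa> p\<^sup>n) K\<^sub>2\<^sub>n\<close>, the set of matrices whose bottom row
  \<open>(c, d)\<close> satisfies \<open>c = \<kappa> p\<^sup>n w\<^sup>2 d\<close> for a unit \<open>w\<close>. There it has a closed formula in \<open>w\<close>, \<open>d\<close> and Hilbert
  symbols, whose equivariance follows from bilinearity of the symbol and from
  \<open>\<gamma>(a b) = \<gamma>(a) \<gamma>(b) (a, b)\<close>; both are read off from explicit formulas for odd \<open>p\<close>, the latter by evaluating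
  quadratic Gauss sums. No associativity of the cover is needed.

  The summand of the operator at a unit \<open>u\<close> has bottom row proportional to
  \<open>(\<delta> p\<^sup>n u\<^sup>2 (1 + \<beta> \<delta>\<^sup>-\<^sup>1 p\<^sup>n\<^sup>-\<^sup>1 u\<^sup>-\<^sup>2), 1)\<close>. It misses the support unless \<open>\<delta> = \<kappa>\<close>, and then contributes
  \<open>\<mu>\<close> at the inverse square root of \<open>1 + \<beta> \<kappa>\<^sup>-\<^sup>1 p\<^sup>n\<^sup>-\<^sup>1 u\<^sup>-\<^sup>2\<close>. Since \<open>\<mu>\<close> has conductor exponent \<open>n > 1\<close>, this is a
  nontrivial additive character of \<open>\<int> / p\<close> at \<open>\<beta> \<kappa>\<^sup>-\<^sup>1 u\<^sup>-\<^sup>2\<close>. The sum thus runs over the nonzero squares, and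
  equals \<open>(\<plusminus>G - 1) / 2\<close> for a quadratic Gauss sum \<open>G\<close> with \<open>G\<^sup>2 = p\<^sup>*\<close>, the sign being the Legendre symbol
  of \<open>\<beta> / \<kappa>\<close>.
\<close>

section \<open>The valuation and residues of p-adic numbers\<close>

text \<open>Since \<open>f_kappa\<close> is a definite description, it has no value until such a
  function is shown to exist; this obstacle shapes the work on the cover. The bottom row fixes
  \<open>w\<close> only up to sign, and \<mu>(-1) = \<eta>(-1) is what makes the closed formula
  independent of that choice. The levels fit together because right translation by
  \<open>K0 (2 * n)\<close> perturbs the bottom row by factors in 1 + p^n Z_p: an entry in p^(2n)
  Z_p gets divided by \<kappa> p^n. Such factors are invisible to \<mu>; since p is odd they are
  also squares, hence invisible to \<eta>, to Hilbert symbols and to Weil factors. Two Gauss sums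
  occur, one built from \<mu> in the operator and one built from \<psi> in
  \<open>sqrt_p_star\<close>. Their squares agree, and s is their ratio.\<close>

lemma card_gt_1: "CARD('p::prime_card) > 1"
  by (rule prime_gt_1_nat[OF prime_card])

lemma card_pos [simp]: "CARD('p::prime_card) > 0"
  using card_gt_1[where 'p = 'p] by simp

lemma card_nonzero [simp]: "CARD('p::prime_card) \<noteq> 0"
  using card_gt_1[where 'p = 'p] by simp

lemma padic_norm_zero [simp]: "padic_norm (0 :: 'p::prime_card padic) = 0"
  by simp

lemma padic_norm_of_int: "padic_norm (of_int k :: 'p::prime_card padic) = padic_rat_norm CARD('p) (of_int k)"
  using padic_norm_of_rat[of "of_int k", where 'p = 'p] by simp

lemma padic_norm_of_int_eq:
  assumes "k \<noteq> 0"
  shows "padic_norm (of_int k :: 'p::prime_card padic) =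
    real CARD('p) powi (- int (multiplicity (int CARD('p)) k))"
  using padic_rat_norm_Fract[OF prime_card, of k 1] assms by (simp add: padic_norm_of_int)

lemma padic_norm_of_int_le: "padic_norm (of_int k :: 'p::prime_card padic) \<le> 1"
proof (cases "k = 0")
  case False
  show ?thesis
    unfolding padic_norm_of_int_eq[OF False] power_int_minus
    using card_gt_1[where 'p = 'p] one_le_power[of "real CARD('p)"]
    by (intro inverse_le_1_iff[THEN iffD2]) (simp add: power_int_of_nat)
qed simp

lemma padic_norm_of_nat_le: "padic_norm (of_nat k :: 'p::prime_card padic) \<le> 1"
  using padic_norm_of_int_le[of "int k", where 'p = 'p] by simp

lemma padic_norm_of_int_eq_1:
  assumes "\<not> int CARD('p) dvd k"
  shows "padic_norm (of_int k :: 'p::prime_card padic) = 1"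
  using assms padic_norm_of_int_eq[of k, where 'p = 'p]
  by (cases "k = 0") (auto simp: not_dvd_imp_multiplicity_0)

lemma padic_norm_p: "padic_norm (padic_p :: 'p::prime_card padic) = inverse (real CARD('p))"
proof -
  have "prime (int CARD('p))" using prime_card by simp
  then have "multiplicity (int CARD('p)) (int CARD('p)) = 1"
    by (intro multiplicity_self) auto
  thus ?thesis
    using padic_norm_of_int_eq[of "int CARD('p)", where 'p = 'p] card_gt_1[where 'p = 'p]
    by (simp add: padic_p_def power_int_minus)
qed

lemma padic_p_nonzero [simp]: "(padic_p :: 'p::prime_card padic) \<noteq> 0"
  by (simp add: padic_p_def)

lemma padic_norm_of_int_less_1:
  assumes "int CARD('p) dvd k"
  shows "padic_norm (of_int k :: 'p::prime_card padic) < 1"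
proof -
  obtain l where "k = int CARD('p) * l" using assms by auto
  hence "padic_norm (of_int k :: 'p padic) = inverse (real CARD('p)) * padic_norm (of_int l :: 'p padic)"
    using padic_norm_p[where 'p = 'p] by (simp add: padic_norm_mult padic_p_def)
  also have "\<dots> \<le> inverse (real CARD('p)) * 1"
    by (intro mult_left_mono padic_norm_of_int_le) auto
  also have "\<dots> < 1" using card_gt_1[where 'p = 'p] by (simp add: field_simps)
  finally show ?thesis .
qed

lemma padic_norm_of_int_less_1_iff:
  "padic_norm (of_int k :: 'p::prime_card padic) < 1 \<longleftrightarrow> int CARD('p) dvd k"
  using padic_norm_of_int_less_1[of k, where 'p = 'p] padic_norm_of_int_eq_1[of k, where 'p = 'p] by fastforce

lemma padic_norm_of_nat_less_1_iff:
  "padic_norm (of_nat k :: 'p::prime_card padic) < 1 \<longleftrightarrow> CARD('p) dvd k"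
  using padic_norm_of_int_less_1_iff[of "int k", where 'p = 'p] by simp

lemma padic_norm_of_nat_eq_1:
  "0 < k \<Longrightarrow> k < CARD('p) \<Longrightarrow> padic_norm (of_nat k :: 'p::prime_card padic) = 1"
  using padic_norm_of_nat_less_1_iff[of k, where 'p = 'p] padic_norm_of_nat_le[of k, where 'p = 'p]
    dvd_imp_le[of "CARD('p)" k] by linarith

lemma padic_norm_inverse: "padic_norm (inverse x) = inverse (padic_norm (x :: 'p::prime_card padic))"
proof (cases "x = 0")
  case False
  hence "padic_norm (inverse x) * padic_norm x = 1" by (simp flip: padic_norm_mult)
  thus ?thesis using False by (simp add: field_simps)
qed simp

lemma padic_norm_divide: "padic_norm (x / y) = padic_norm x / padic_norm (y :: 'p::prime_card padic)"
  by (simp add: divide_inverse padic_norm_mult padic_norm_inverse)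

lemma padic_norm_power: "padic_norm (x ^ m) = padic_norm (x :: 'p::prime_card padic) ^ m"
  by (induction m) (simp_all add: padic_norm_mult)

lemma padic_norm_powi: "padic_norm (x powi k) = padic_norm (x :: 'p::prime_card padic) powi k"
  by (simp add: power_int_def padic_norm_power padic_norm_inverse)

lemma padic_norm_pos: "x \<noteq> 0 \<Longrightarrow> padic_norm (x :: 'p::prime_card padic) > 0"
  using padic_norm_nonneg[of x] padic_norm_eq_0[of x] by linarith

lemma padic_norm_diff: "padic_norm (x - y) \<le> max (padic_norm x) (padic_norm (y :: 'p::prime_card padic))"
  using padic_norm_add[of x "- y"] by simp

lemma padic_norm_diff_commute: "padic_norm (x - y) = padic_norm (y - x :: 'p::prime_card padic)"
  using padic_norm_minus[of "x - y"] by simp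

lemma padic_norm_add_eq:
  assumes "padic_norm y < padic_norm (x :: 'p::prime_card padic)"
  shows "padic_norm (x + y) = padic_norm x"
  using padic_norm_add[of x y] padic_norm_diff[of "x + y" y] assms by simp

text \<open>A rational closer to x than |x| has the same norm as x by the ultrametric inequality,
  and norms of nonzero rationals are powers of p.\<close>

lemma padic_norm_discrete:
  assumes "x \<noteq> (0 :: 'p::prime_card padic)"
  shows "\<exists>k. padic_norm x = real CARD('p) powi k"
proof -
  obtain r where r: "padic_norm (of_rat r - x) < padic_norm x"
    using padic_rat_dense[OF padic_norm_pos[OF assms], of x] by (auto simp: dist_padic_def)
  have "padic_norm x = padic_norm (of_rat r :: 'p padic)"
    using padic_norm_add_eq[OF r] by simp
  also have "\<dots> = padic_rat_norm CARD('p) r" by (rule padic_norm_of_rat)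
  finally have *: "padic_norm x = padic_rat_norm CARD('p) r" .
  moreover have "r \<noteq> 0" using * assms by auto
  ultimately show ?thesis by (auto simp: padic_rat_norm_def split: prod.splits)
qed

text \<open>Makes the definite description \<open>padic_ord\<close> usable: existence is
  discreteness of the norm, uniqueness is strict monotonicity of the powers of p.\<close>

lemma padic_norm_ord:
  assumes "x \<noteq> (0 :: 'p::prime_card padic)"
  shows "padic_norm x = real CARD('p) powi (- padic_ord x)"
proof -
  obtain k where k: "padic_norm x = real CARD('p) powi k" using padic_norm_discrete[OF assms] by blast
  show ?thesis unfolding padic_ord_def
  proof (rule theI)
    show "padic_norm x = real CARD('p) powi (- (- k))" using k by simp
    fix l assume "padic_norm x = real CARD('p) powi (- l)"
    thus "l = - k" using k card_gt_1[where 'p = 'p]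
      by (metis minus_equation_iff nat_neq_iff of_nat_1 of_nat_less_iff power_int_strict_increasing less_irrefl linorder_less_linear)
  qed
qed

lemma padic_ord_unique:
  assumes "padic_norm (x :: 'p::prime_card padic) = real CARD('p) powi (- k)"
  shows "padic_ord x = k"
proof -
  have q: "real CARD('p) > 1" using card_gt_1[where 'p = 'p] by simp
  hence "x \<noteq> 0" using assms by (metis padic_norm_eq_0 power_int_eq_0_iff not_one_less_zero)
  hence "real CARD('p) powi (- k) = real CARD('p) powi (- padic_ord x)"
    using assms padic_norm_ord by metis
  thus ?thesis using power_int_strict_increasing[OF _ q] by (metis less_irrefl linorder_neqE_linordered_idom neg_equal_iff_equal)
qed

lemma padic_ord_mult:
  "x \<noteq> 0 \<Longrightarrow> y \<noteq> 0 \<Longrightarrow> padic_ord (x * y) = padic_ord x + padic_ord (y :: 'p::prime_card padic)"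
  by (rule padic_ord_unique)
     (use card_gt_1[where 'p = 'p] in \<open>simp add: padic_norm_mult padic_norm_ord[of x] padic_norm_ord[of y] flip: power_int_add\<close>)

lemma padic_ord_p_power [simp]: "padic_ord (padic_p ^ m :: 'p::prime_card padic) = int m"
  by (rule padic_ord_unique) (simp add: padic_norm_power padic_norm_p power_int_minus power_inverse)

lemma padic_ord_p [simp]: "padic_ord (padic_p :: 'p::prime_card padic) = 1"
  using padic_ord_p_power[of 1] by simp

lemma padic_ord_unit [simp]: "x \<in> padic_units \<Longrightarrow> padic_ord (x :: 'p::prime_card padic) = 0"
  by (rule padic_ord_unique) (simp add: padic_units_def)

lemma unit_nonzero: "x \<in> padic_units \<Longrightarrow> x \<noteq> (0 :: 'p::prime_card padic)"
  by (auto simp: padic_units_def)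

text \<open>No norm lies strictly between 1/p and 1. So \<open>padic_norm (x - y) < 1\<close> can
  serve as congruence modulo p, and it yields the contraction factor 1/p in Hensel's lemma.\<close>

lemma padic_norm_less_1_iff: 
  "padic_norm (x :: 'p::prime_card padic) < 1 \<longleftrightarrow> padic_norm x \<le> inverse (real CARD('p))"
proof (cases "x = 0")
  case False
  have q: "real CARD('p) > 1" using card_gt_1[where 'p = 'p] by simp
  obtain k where k: "padic_norm x = real CARD('p) powi k" using padic_norm_discrete[OF False] by blast
  have "real CARD('p) powi k < real CARD('p) powi 0 \<longleftrightarrow> k \<le> -1"
    using power_int_increasing[of 0 k "real CARD('p)"] power_int_strict_increasing[of k 0 "real CARD('p)"] q
    by (smt (verit))
  moreover have "real CARD('p) powi k \<le> real CARD('p) powi (-1) \<longleftrightarrow> k \<le> -1"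
    using power_int_increasing[of k "-1" "real CARD('p)"] power_int_strict_increasing[of "-1" k "real CARD('p)"] q
    by (cases "k \<le> -1") auto
  ultimately show ?thesis using k by (simp add: power_int_minus)
qed simp

section \<open>Ideals, integers and units\<close>

lemma padic_ideal_iff:
  "x \<in> padic_ideal m \<longleftrightarrow> padic_norm (x :: 'p::prime_card padic) \<le> inverse (real CARD('p)) ^ m"
proof -
  have q: "0 < inverse (real CARD('p)) ^ m" by simp
  show ?thesis
  proof
    assume "x \<in> padic_ideal m"
    then obtain z where "x = padic_p ^ m * z" "padic_norm z \<le> 1"
      by (auto simp: padic_ideal_def padic_ints_def)
    thus "padic_norm x \<le> inverse (real CARD('p)) ^ m"
      using q by (simp add: padic_norm_mult padic_norm_power padic_norm_p mult_left_le)
  next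
    assume *: "padic_norm x \<le> inverse (real CARD('p)) ^ m"
    have "x = padic_p ^ m * (x / padic_p ^ m)" by simp
    moreover have "padic_norm (x / padic_p ^ m) \<le> 1"
      using * q by (simp add: padic_norm_divide padic_norm_power padic_norm_p)
    ultimately show "x \<in> padic_ideal m" unfolding padic_ideal_def padic_ints_def by blast
  qed
qed

lemma padic_ideal_1_iff: "x \<in> padic_ideal 1 \<longleftrightarrow> padic_norm (x :: 'p::prime_card padic) < 1"
  by (simp add: padic_ideal_iff padic_norm_less_1_iff)

lemma padic_ideal_antimono: "x \<in> padic_ideal m \<Longrightarrow> l \<le> m \<Longrightarrow> (x :: 'p::prime_card padic) \<in> padic_ideal l"
  using power_decreasing[of l m "inverse (real CARD('p))"] card_gt_1[where 'p = 'p]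
  by (simp add: padic_ideal_iff inverse_le_1_iff)

lemma padic_ideal_0_iff: "x \<in> padic_ideal 0 \<longleftrightarrow> (x :: 'p::prime_card padic) \<in> padic_ints"
  by (simp add: padic_ideal_iff padic_ints_def)

lemma padic_ideal_add: "x \<in> padic_ideal m \<Longrightarrow> y \<in> padic_ideal m \<Longrightarrow> (x + y :: 'p::prime_card padic) \<in> padic_ideal m"
  using padic_norm_add[of x y] by (auto simp: padic_ideal_iff)

lemma padic_ideal_mult:
  "x \<in> padic_ideal m \<Longrightarrow> y \<in> padic_ints \<Longrightarrow> (x * y :: 'p::prime_card padic) \<in> padic_ideal m"
  using mult_mono[of "padic_norm x" _ "padic_norm y" 1]
  by (auto simp: padic_ideal_iff padic_norm_mult padic_ints_def)

lemma padic_ideal_mult_ideal: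
  "x \<in> padic_ideal m \<Longrightarrow> y \<in> padic_ideal l \<Longrightarrow> (x * y :: 'p::prime_card padic) \<in> padic_ideal (m + l)"
  using mult_mono[of "padic_norm x" "inverse (real CARD('p)) ^ m" "padic_norm y" "inverse (real CARD('p)) ^ l"]
  by (simp add: padic_ideal_iff padic_norm_mult power_add)

lemma p_power_in_ideal [simp]: "(padic_p ^ m :: 'p::prime_card padic) \<in> padic_ideal m"
  by (simp add: padic_ideal_iff padic_norm_power padic_norm_p)

lemma padic_ints_add: "x \<in> padic_ints \<Longrightarrow> y \<in> padic_ints \<Longrightarrow> (x + y :: 'p::prime_card padic) \<in> padic_ints"
  using padic_ideal_add[of x 0 y] by (simp add: padic_ideal_0_iff)

lemma padic_ints_mult: "x \<in> padic_ints \<Longrightarrow> y \<in> padic_ints \<Longrightarrow> (x * y :: 'p::prime_card padic) \<in> padic_ints"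
  using padic_ideal_mult[of x 0 y] by (simp add: padic_ideal_0_iff)

lemma padic_ints_of_nat [simp]: "(of_nat k :: 'p::prime_card padic) \<in> padic_ints"
  by (simp add: padic_ints_def padic_norm_of_nat_le)

lemma padic_units_ints: "x \<in> padic_units \<Longrightarrow> (x :: 'p::prime_card padic) \<in> padic_ints"
  by (simp add: padic_ints_def padic_units_def)

lemma padic_units_1 [simp]: "(1 :: 'p::prime_card padic) \<in> padic_units"
  by (simp add: padic_units_def)

lemma padic_units_mult: "x \<in> padic_units \<Longrightarrow> y \<in> padic_units \<Longrightarrow> (x * y :: 'p::prime_card padic) \<in> padic_units"
  by (simp add: padic_units_def padic_norm_mult)

lemma padic_units_divide: "x \<in> padic_units \<Longrightarrow> y \<in> padic_units \<Longrightarrow> (x / y :: 'p::prime_card padic) \<in> padic_units"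
  by (simp add: padic_units_def padic_norm_divide)

lemma padic_units_inverse: "x \<in> padic_units \<Longrightarrow> (inverse x :: 'p::prime_card padic) \<in> padic_units"
  by (simp add: padic_units_def padic_norm_inverse)

lemma padic_units_minus: "x \<in> padic_units \<Longrightarrow> (- x :: 'p::prime_card padic) \<in> padic_units"
  by (simp add: padic_units_def)

lemma unit_add_ideal:
  assumes "x \<in> padic_units" "y \<in> padic_ideal m" "m > 0"
  shows "(x + y :: 'p::prime_card padic) \<in> padic_units"
  using padic_norm_add_eq[of y x] assms padic_ideal_antimono[of y m 1]
  by (simp add: padic_units_def padic_ideal_1_iff[symmetric])

text \<open>Approximate x by a rational a/b in lowest terms. Integrality forces b to be prime to p,
  so Bezout inverts b modulo p.\<close>

lemma padic_residue_exists:
  assumes "x \<in> padic_ints"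
  shows "\<exists>j<CARD('p). padic_norm (x - of_nat j :: 'p::prime_card padic) < 1"
proof -
  let ?q = "int CARD('p)"
  have pr: "prime ?q" using prime_card by simp
  obtain r where r: "padic_norm (of_rat r - x) < 1"
    using padic_rat_dense[of 1 x] by (auto simp: dist_padic_def)
  obtain a b where ab: "quotient_of r = (a, b)" by (cases "quotient_of r")
  have b: "b > 0" "coprime a b" and rab: "r = of_int a / of_int b"
    using quotient_of_denom_pos[OF ab] quotient_of_coprime[OF ab] quotient_of_div[OF ab] by auto
  have "padic_norm (of_rat r :: 'p padic) \<le> 1"
    using padic_norm_add[of "of_rat r - x" x] r assms by (auto simp: padic_ints_def)
  hence le: "padic_norm (of_int a :: 'p padic) \<le> padic_norm (of_int b :: 'p padic)"
    using b padic_norm_pos[of "of_int b :: 'p padic"]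
    by (simp add: rab of_rat_divide padic_norm_divide field_simps)
  have nb: "\<not> ?q dvd b"
  proof
    assume qb: "?q dvd b"
    hence "?q dvd a" using le padic_norm_of_int_less_1_iff[of _, where 'p = 'p] by (meson order.strict_trans1)
    with qb b(2) pr show False by (meson coprime_common_divisor not_prime_unit)
  qed
  hence "coprime b ?q" using prime_imp_coprime[OF pr nb] by (simp add: coprime_commute)
  then obtain u v where uv: "u * b + v * ?q = 1" using bezout_int[of b ?q] by auto
  define j where "j = (a * u) mod ?q"
  have "?q dvd a * u - j" by (simp add: j_def minus_mod_eq_mult_div)
  hence "?q dvd b * (a * u - j) + a * v * ?q" by simp
  also have "b * (a * u - j) + a * v * ?q = a * (u * b + v * ?q) - j * b" by (simp add: algebra_simps)
  finally have dv: "?q dvd a - j * b" using uv by simp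
  have j: "0 \<le> j" "j < ?q" using card_gt_1[where 'p = 'p] by (simp_all add: j_def)
  have "of_rat r - of_int j = (of_int (a - j * b) / of_int b :: 'p padic)"
    using b by (simp add: rab of_rat_divide field_simps)
  hence "padic_norm (of_rat r - of_int j :: 'p padic) < 1"
    using padic_norm_of_int_less_1[OF dv] padic_norm_of_int_eq_1[OF nb]
    by (simp only: padic_norm_divide)
  hence "padic_norm (x - of_int j) < 1"
    using padic_norm_diff[of "of_rat r - of_int j" "of_rat r - x"] r by simp
  thus ?thesis using j by (intro exI[of _ "nat j"]) auto
qed

section \<open>Square roots and the Legendre symbol\<close>

definition padic_residue :: "'p::prime_card padic \<Rightarrow> nat" where
  "padic_residue x = (SOME j. j < CARD('p) \<and> padic_norm (x - of_nat j) < 1)"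

lemma padic_residue:
  assumes "x \<in> padic_ints"
  shows "padic_residue x < CARD('p)" "padic_norm (x - of_nat (padic_residue x) :: 'p::prime_card padic) < 1"
  using someI_ex[OF padic_residue_exists[OF assms]] unfolding padic_residue_def by blast+

lemma congruent_trans:
  "padic_norm (x - y) < 1 \<Longrightarrow> padic_norm (y - z) < 1 \<Longrightarrow> padic_norm (x - z :: 'p::prime_card padic) < 1"
  using padic_norm_add[of "x - y" "y - z"] by simp

lemma congruent_sym: "padic_norm (x - y) < 1 \<Longrightarrow> padic_norm (y - x :: 'p::prime_card padic) < 1"
  by (simp add: padic_norm_diff_commute)

lemma of_nat_congruent_eq:
  assumes "padic_norm (of_nat i - of_nat j :: 'p::prime_card padic) < 1" "i < CARD('p)" "j < CARD('p)"
  shows "i = j"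
proof -
  have "int CARD('p) dvd int i - int j"
    using assms(1) padic_norm_of_int_less_1_iff[of "int i - int j", where 'p = 'p] by simp
  hence "int i mod int CARD('p) = int j mod int CARD('p)" by (simp add: mod_eq_dvd_iff)
  thus ?thesis using assms by simp
qed

lemma congruent_unit: "x \<in> padic_units \<Longrightarrow> padic_norm (x - y) < 1 \<Longrightarrow> (y :: 'p::prime_card padic) \<in> padic_units"
  using padic_norm_add_eq[of "y - x" x] by (simp add: padic_units_def padic_norm_diff_commute)

lemma congruent_mult:
  assumes "padic_norm (x - y) < 1" "padic_norm z \<le> (1 :: real)"
  shows "padic_norm (z * x - z * y :: 'p::prime_card padic) < 1"
proof -
  have "padic_norm z * padic_norm (x - y) \<le> 1 * padic_norm (x - y)"
    using assms by (intro mult_right_mono) auto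
  thus ?thesis using assms(1) by (simp add: padic_norm_mult flip: right_diff_distrib)
qed

lemma square_mod_p_iff:
  "square_mod_p u \<longleftrightarrow> (\<exists>z. padic_norm z \<le> 1 \<and> padic_norm (u - z\<^sup>2 :: 'p::prime_card padic) < 1)"
  by (simp add: square_mod_p_def padic_ideal_1_iff[unfolded One_nat_def] padic_ints_def)

lemma unit_square_root_unit: "w\<^sup>2 \<in> padic_units \<Longrightarrow> (w :: 'p::prime_card padic) \<in> padic_units"
  by (simp add: padic_units_def padic_norm_power power2_eq_1_iff)
     (metis padic_norm_nonneg not_one_le_zero neg_0_le_iff_le)

lemma square_mod_p_1 [simp]: "square_mod_p (1 :: 'p::prime_card padic)"
  unfolding square_mod_p_iff by (intro exI[of _ 1]) auto

context
  assumes odd_card: "odd CARD('p::prime_card)"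
begin

lemma padic_norm_2: "padic_norm (2 :: 'p padic) = 1"
proof -
  have "2 < CARD('p)" using card_gt_1[where 'p = 'p] odd_card by (cases "CARD('p) = 2") auto
  thus ?thesis using padic_norm_of_nat_eq_1[of 2, where 'p = 'p] by simp
qed

lemma padic_units_2: "2 \<in> (padic_units :: 'p padic set)"
  by (simp add: padic_units_def padic_norm_2)

text \<open>Hensel's lemma for square roots: Newton's iteration with the derivative frozen at \<open>z\<close> is a contraction of the
  residue class of \<open>z\<close>.\<close>

lemma hensel_square_root:
  fixes u z :: "'p padic"
  assumes z: "z \<in> padic_units" and uz: "padic_norm (u - z\<^sup>2) < 1"
  shows "\<exists>w. w\<^sup>2 = u \<and> padic_norm (w - z) < 1"
proof -
  let ?q = "inverse (real CARD('p))"
  define S where "S = cball z ?q"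
  define T where "T = (\<lambda>x. x - (x\<^sup>2 - u) / (2 * z))"
  have S: "x \<in> S \<longleftrightarrow> padic_norm (x - z) < 1" for x
    by (simp add: S_def dist_padic_def padic_norm_less_1_iff padic_norm_diff_commute)
  have n2z: "padic_norm (2 * z) = 1" using z padic_norm_2 by (simp add: padic_norm_mult padic_units_def)
  have z0: "z \<noteq> 0" using z by (rule unit_nonzero)
  have q: "?q < 1" using card_gt_1[where 'p = 'p] by (simp add: inverse_less_1_iff)
  have contr: "dist (T x) (T y) \<le> ?q * dist x y" if "x \<in> S" "y \<in> S" for x y
  proof -
    have "T x - T y = (x - y) * (((z - x) + (z - y)) / (2 * z))"
      using z0 by (simp add: T_def field_simps power2_eq_square)
    hence "dist (T x) (T y) = dist x y * padic_norm ((z - x) + (z - y))"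
      by (simp only: dist_padic_def padic_norm_mult[of "x - y"] padic_norm_divide n2z div_by_1)
    moreover have "padic_norm ((z - x) + (z - y)) < 1"
      using padic_norm_add[of "z - x" "z - y"] that by (simp add: S padic_norm_diff_commute)
    ultimately show ?thesis
      by (simp add: padic_norm_less_1_iff mult.commute[of ?q] mult_left_mono)
  qed
  have Tz: "padic_norm (T z - z) < 1"
    using uz by (simp add: T_def padic_norm_divide n2z padic_norm_diff_commute)
  have "T x \<in> S" if "x \<in> S" for x
  proof -
    have "z \<in> S" by (simp add: S)
    have "dist (T x) (T z) \<le> ?q * dist x z" by (rule contr[OF that \<open>z \<in> S\<close>])
    also have "\<dots> \<le> 1 * dist x z" using q by (intro mult_right_mono) auto
    also have "\<dots> < 1" using that by (simp add: S dist_padic_def)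
    finally have "padic_norm (T x - T z) < 1" by (simp add: dist_padic_def)
    thus ?thesis using Tz congruent_trans S by blast
  qed
  moreover have "complete S" unfolding S_def by (simp add: complete_eq_closed)
  moreover have "S \<noteq> {}" using S[of z] by auto
  ultimately obtain x where x: "x \<in> S" "T x = x"
    using Banach_fix[of S ?q T] contr q by (auto simp: image_subset_iff)
  have "(x\<^sup>2 - u) / (2 * z) = 0" using x(2) by (simp add: T_def)
  hence "x\<^sup>2 = u" using z0 by simp
  thus ?thesis using x(1) S by blast
qed

text \<open>Hensel's lemma lifts a root modulo p to an exact one, so the Legendre symbol decides
  whether a unit is a square.\<close>

lemma unit_square_mod_p_iff:
  fixes u :: "'p padic"
  assumes "u \<in> padic_units"
  shows "square_mod_p u \<longleftrightarrow> (\<exists>w\<in>padic_units. w\<^sup>2 = u)"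
proof
  assume "square_mod_p u"
  then obtain z where z: "padic_norm (u - z\<^sup>2) < 1" by (auto simp: square_mod_p_iff)
  hence "z \<in> padic_units" using assms congruent_unit unit_square_root_unit by blast
  from hensel_square_root[OF this z] show "\<exists>w\<in>padic_units. w\<^sup>2 = u"
    using assms unit_square_root_unit by blast
next
  assume "\<exists>w\<in>padic_units. w\<^sup>2 = u"
  then obtain w where "w \<in> padic_units" "w\<^sup>2 = u" by blast
  thus "square_mod_p u" unfolding square_mod_p_iff
    by (intro exI[of _ w]) (auto simp: padic_units_def)
qed

lemma half_card: "2 * ((CARD('p) - 1) div 2) = CARD('p) - 1"
  using odd_card by (simp add: even_two_times_div_two)

text \<open>In (i - j)(i + j) the second factor is a unit because 0 < i + j < p.\<close>

lemma half_squares_distinct: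
  assumes "i \<in> {1..(CARD('p) - 1) div 2}" "j \<in> {1..(CARD('p) - 1) div 2}"
    "padic_norm ((of_nat i)\<^sup>2 - (of_nat j)\<^sup>2 :: 'p padic) < 1"
  shows "i = j"
proof -
  have b: "i + j < CARD('p)" "0 < i + j" using assms(1,2) half_card card_gt_1[where 'p = 'p] by auto
  have "padic_norm (of_nat (i + j) :: 'p padic) = 1" using padic_norm_of_nat_eq_1[of "i + j"] b by blast
  moreover have "((of_nat i)\<^sup>2 - (of_nat j)\<^sup>2 :: 'p padic) = (of_nat i - of_nat j) * of_nat (i + j)"
    by (simp add: power2_eq_square algebra_simps)
  ultimately have "padic_norm (of_nat i - of_nat j :: 'p padic) < 1"
    using assms(3) by (simp add: padic_norm_mult)
  thus ?thesis using of_nat_congruent_eq[of i j, where 'p = 'p] b by simp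
qed

lemma half_unit: "j \<in> {1..(CARD('p) - 1) div 2} \<Longrightarrow> (of_nat j :: 'p padic) \<in> padic_units"
  using padic_norm_of_nat_eq_1[of j, where 'p = 'p] half_card card_gt_1[where 'p = 'p]
  by (auto simp: padic_units_def)

lemma residue_eq_imp_congruent:
  fixes x y :: "'p padic"
  assumes "x \<in> padic_units" "y \<in> padic_units" "padic_residue x = padic_residue y"
  shows "padic_norm (x - y) < 1"
  using padic_residue(2)[OF padic_units_ints[OF assms(1)]] padic_residue(2)[OF padic_units_ints[OF assms(2)]]
    assms(3) congruent_trans congruent_sym by metis

lemma residue_unit_range:
  fixes x :: "'p padic"
  assumes "x \<in> padic_units"
  shows "padic_residue x \<in> {1..<CARD('p)}"
proof -
  have "padic_residue x \<noteq> 0"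
    using padic_residue(2)[OF padic_units_ints[OF assms]] assms by (auto simp: padic_units_def intro!: Nat.gr0I)
  thus ?thesis using padic_residue(1)[OF padic_units_ints[OF assms]] by auto
qed

text \<open>With \<open>c\<close> a nonsquare, the residues \<open>j\<^sup>2\<close> and \<open>c j\<^sup>2\<close> for \<open>1 \<le> j \<le> (p - 1) / 2\<close> are distinct; there are \<open>p - 1\<close> of them,
  so they exhaust the nonzero residues.\<close>

lemma residues_squares_nonsquares:
  fixes c :: "'p padic"
  assumes c: "c \<in> padic_units" "\<not> square_mod_p c"
  defines "A \<equiv> {1..(CARD('p) - 1) div 2}"
  defines "r \<equiv> \<lambda>a j. padic_residue (a * (of_nat j)\<^sup>2 :: 'p padic)"
  shows "inj_on (r 1) A" "inj_on (r c) A" "r 1 ` A \<inter> r c ` A = {}" "r 1 ` A \<union> r c ` A = {1..<CARD('p)}"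
proof -
  have u: "a * (of_nat j)\<^sup>2 \<in> padic_units" if "a \<in> padic_units" "j \<in> A" for j and a :: "'p padic"
    using half_unit[of j] that by (simp add: A_def power2_eq_square padic_units_mult)
  have inj: "inj_on (r a) A" if a: "a \<in> padic_units" for a
  proof (rule inj_onI)
    fix i j assume ij: "i \<in> A" "j \<in> A" "r a i = r a j"
    have "padic_norm (a * (of_nat i)\<^sup>2 - a * (of_nat j)\<^sup>2) < 1"
      using residue_eq_imp_congruent[OF u[OF a ij(1)] u[OF a ij(2)]] ij(3) by (simp add: r_def)
    hence "padic_norm ((of_nat i)\<^sup>2 - (of_nat j)\<^sup>2 :: 'p padic) < 1"
      using a by (simp add: padic_norm_mult padic_units_def flip: right_diff_distrib)
    thus "i = j" using half_squares_distinct ij by (simp add: A_def)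
  qed
  show 1: "inj_on (r 1) A" and 2: "inj_on (r c) A" using inj c by simp_all
  show 3: "r 1 ` A \<inter> r c ` A = {}"
  proof (rule ccontr)
    assume "r 1 ` A \<inter> r c ` A \<noteq> {}"
    then obtain x where "x \<in> r 1 ` A" "x \<in> r c ` A" by blast
    then obtain i j where ij: "i \<in> A" "j \<in> A" "r c i = r 1 j" by (metis imageE)
    have *: "padic_norm (c * (of_nat i)\<^sup>2 - (of_nat j)\<^sup>2) < 1"
      using residue_eq_imp_congruent[OF u[OF c(1) ij(1)] u[OF padic_units_1 ij(2)]] ij(3) by (simp add: r_def)
    have i: "(of_nat i :: 'p padic) \<in> padic_units" and j: "(of_nat j :: 'p padic) \<in> padic_units"
      using half_unit ij by (auto simp: A_def)
    have "c - (of_nat j / of_nat i)\<^sup>2 = (c * (of_nat i)\<^sup>2 - (of_nat j)\<^sup>2) / (of_nat i)\<^sup>2"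
      using unit_nonzero[OF i] by (simp add: field_simps)
    hence "padic_norm (c - (of_nat j / of_nat i)\<^sup>2) < 1"
      using * i by (simp only: padic_norm_divide padic_norm_power) (simp add: padic_units_def)
    moreover have "padic_norm (of_nat j / of_nat i :: 'p padic) \<le> 1"
      using i j by (simp add: padic_norm_divide padic_units_def)
    ultimately show False using c(2) unfolding square_mod_p_iff by blast
  qed
  show "r 1 ` A \<union> r c ` A = {1..<CARD('p)}"
  proof (rule card_subset_eq)
    show "r 1 ` A \<union> r c ` A \<subseteq> {1..<CARD('p)}"
      using residue_unit_range u c(1) padic_units_1 unfolding r_def by blast
    have "card (r 1 ` A \<union> r c ` A) = card A + card A"
      using 1 2 3 by (subst card_Un_disjoint) (auto simp: card_image A_def)
    thus "card (r 1 ` A \<union> r c ` A) = card {1..<CARD('p)}"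
      using half_card by (simp add: A_def)
  qed simp
qed

text \<open>The residue of v is some j^2 or some u j^2. The first is excluded as v is a nonsquare,
  and v = u j^2 gives u v = (u j)^2 modulo p.\<close>

lemma square_mod_p_mult_nonsquares:
  fixes u v :: "'p padic"
  assumes "u \<in> padic_units" "v \<in> padic_units" "\<not> square_mod_p u" "\<not> square_mod_p v"
  shows "square_mod_p (u * v)"
proof -
  let ?A = "{1..(CARD('p) - 1) div 2}"
  have "padic_residue v \<in> {1..<CARD('p)}" by (rule residue_unit_range) fact
  then obtain a j where aj: "j \<in> ?A" "a \<in> {1, u}" "padic_residue v = padic_residue (a * (of_nat j)\<^sup>2)"
    unfolding residues_squares_nonsquares(4)[OF assms(1,3), symmetric] by blast
  have j: "(of_nat j :: 'p padic) \<in> padic_units" by (rule half_unit) fact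
  have "a * (of_nat j)\<^sup>2 \<in> padic_units" using aj(2) assms(1) j
    by (auto simp: padic_units_mult power2_eq_square)
  hence cong: "padic_norm (v - a * (of_nat j)\<^sup>2) < 1"
    using residue_eq_imp_congruent assms(2) aj(3) by blast
  have "a = u"
  proof (rule ccontr)
    assume "a \<noteq> u"
    hence "padic_norm (v - (of_nat j)\<^sup>2) < 1" using cong aj(2) by simp
    thus False using assms(4) j unfolding square_mod_p_iff padic_units_def by auto
  qed
  have "padic_norm (u * v - (u * of_nat j)\<^sup>2) < 1"
    using congruent_mult[OF cong, of u] assms(1) \<open>a = u\<close>
    by (simp add: padic_units_def power2_eq_square mult_ac)
  thus ?thesis unfolding square_mod_p_iff using assms(1) j
    by (intro exI[of _ "u * of_nat j"]) (simp add: padic_norm_mult padic_units_def)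
qed

lemma square_mod_p_mult_square:
  fixes u v :: "'p padic"
  assumes "u \<in> padic_units" "v \<in> padic_units" "square_mod_p u"
  shows "square_mod_p (u * v) \<longleftrightarrow> square_mod_p v"
proof -
  obtain w where w: "w \<in> padic_units" "w\<^sup>2 = u" using assms unit_square_mod_p_iff by blast
  have "(\<exists>x\<in>padic_units. x\<^sup>2 = w\<^sup>2 * v) \<longleftrightarrow> (\<exists>x\<in>padic_units. x\<^sup>2 = v)"
  proof safe
    fix x assume x: "x \<in> padic_units" "x\<^sup>2 = w\<^sup>2 * v"
    thus "\<exists>y\<in>padic_units. y\<^sup>2 = v" using w unit_nonzero[OF w(1)]
      by (intro bexI[of _ "x / w"]) (auto simp: power_divide padic_units_divide)
  next
    fix x :: "'p padic" assume "x \<in> padic_units"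
    thus "\<exists>y\<in>padic_units. y\<^sup>2 = w\<^sup>2 * x\<^sup>2" using w
      by (intro bexI[of _ "x * w"]) (auto simp: power_mult_distrib padic_units_mult)
  qed
  thus ?thesis using assms w by (simp add: unit_square_mod_p_iff padic_units_mult)
qed

section \<open>The Legendre symbol on units\<close>

lemma legendre_unit:
  fixes u :: "'p padic"
  shows "u \<in> padic_units \<Longrightarrow> padic_legendre u = (if square_mod_p u then 1 else -1)"
  using padic_ideal_1_iff[of u] by (simp add: padic_legendre_def padic_units_def)

lemma legendre_mult:
  fixes u v :: "'p padic"
  assumes "u \<in> padic_units" "v \<in> padic_units"
  shows "padic_legendre (u * v) = padic_legendre u * padic_legendre v"
  using assms square_mod_p_mult_nonsquares[OF assms] square_mod_p_mult_square[OF assms]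
    square_mod_p_mult_square[OF assms(2,1)]
  by (auto simp: legendre_unit padic_units_mult mult.commute)

lemma legendre_1 [simp]: "padic_legendre (1 :: 'p padic) = 1"
  by (simp add: legendre_unit)

lemma legendre_square [simp]: "u \<in> padic_units \<Longrightarrow> padic_legendre (u :: 'p padic) * padic_legendre u = 1"
  by (simp add: legendre_unit)

text \<open>Otherwise induction from 0 would make every natural number a square modulo p, including
  the residue of u. This supplies the nonsquare s^2 + 1 from which Hilbert symbols of units are
  computed.\<close>

lemma ex_square_plus_1_nonsquare:
  assumes "u \<in> (padic_units :: 'p padic set)" "\<not> square_mod_p u"
  shows "\<exists>j. square_mod_p (of_nat j :: 'p padic) \<and> \<not> square_mod_p (of_nat (Suc j) :: 'p padic)"
proof (rule ccontr)
  assume *: "\<not> ?thesis"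
  have "square_mod_p (of_nat j :: 'p padic)" for j
  proof (induction j)
    case 0
    show ?case unfolding square_mod_p_iff by (intro exI[of _ 0]) simp
  next
    case (Suc j)
    thus ?case using * by blast
  qed
  hence "square_mod_p (of_nat (padic_residue u) :: 'p padic)" .
  hence "square_mod_p u"
    using padic_residue(2)[OF padic_units_ints[OF assms(1)]] congruent_trans
    unfolding square_mod_p_iff by blast
  thus False using assms(2) by blast
qed

end

section \<open>Quadratic Gauss sums\<close>

text \<open>A nontrivial character of Z_p / p Z_p. Additivity is asked only on Z_p so that the
  notion covers both \<psi>(x / p) and the character extracted from \<mu>.\<close>

definition residue_character :: "('p::prime_card padic \<Rightarrow> complex) \<Rightarrow> bool" where
  "residue_character \<xi> \<longleftrightarrow> (\<forall>x\<in>padic_ints. \<forall>y\<in>padic_ints. \<xi> (x + y) = \<xi> x * \<xi> y) \<and>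
     (\<forall>x. padic_norm x < 1 \<longrightarrow> \<xi> x = 1) \<and> (\<exists>x\<in>padic_ints. \<xi> x \<noteq> 1)"

definition gauss_sum :: "('p::prime_card padic \<Rightarrow> complex) \<Rightarrow> 'p padic \<Rightarrow> complex" where
  "gauss_sum \<xi> c = (\<Sum>j<CARD('p). \<xi> (c * (of_nat j)\<^sup>2))"

text \<open>An affine map with unit slope permutes the residues modulo p, and F depends only on the
  residue.\<close>

lemma sum_residues_affine:
  fixes a b :: "'p::prime_card padic" and F :: "'p padic \<Rightarrow> complex"
  assumes a: "a \<in> padic_units" and b: "b \<in> padic_ints"
    and F: "\<And>x y. x \<in> padic_ints \<Longrightarrow> y \<in> padic_ints \<Longrightarrow> padic_norm (x - y) < 1 \<Longrightarrow> F x = F y"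
  shows "(\<Sum>j<CARD('p). F (a * of_nat j + b)) = (\<Sum>j<CARD('p). F (of_nat j))"
proof -
  define f where "f = (\<lambda>j. padic_residue (a * of_nat j + b))"
  have int: "a * of_nat j + b \<in> padic_ints" for j
    using b by (intro padic_ints_add padic_ints_mult padic_units_ints[OF a] padic_ints_of_nat)
  have res: "padic_norm (a * of_nat j + b - of_nat (f j)) < 1" "f j < CARD('p)" for j
    using padic_residue[OF int] by (simp_all add: f_def)
  have inj: "inj_on f {..<CARD('p)}"
  proof (rule inj_onI)
    fix i j assume ij: "i \<in> {..<CARD('p)}" "j \<in> {..<CARD('p)}" "f i = f j"
    have "padic_norm ((a * of_nat i + b) - (a * of_nat j + b)) < 1"
      using congruent_trans[OF res(1)[of i], of "a * of_nat j + b"] res(1)[of j, THEN congruent_sym] ij(3) by simp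
    hence "padic_norm (a * (of_nat i - of_nat j)) < 1" by (simp add: algebra_simps)
    hence "padic_norm (of_nat i - of_nat j :: 'p padic) < 1"
      using a by (simp add: padic_norm_mult padic_units_def)
    thus "i = j" using of_nat_congruent_eq[of i j, where 'p = 'p] ij by simp
  qed
  have "f ` {..<CARD('p)} = {..<CARD('p)}"
    by (rule endo_inj_surj) (use inj res(2) in auto)
  hence "bij_betw f {..<CARD('p)} {..<CARD('p)}" using inj by (simp add: bij_betw_def)
  hence "(\<Sum>j<CARD('p). F (of_nat j)) = (\<Sum>j<CARD('p). F (of_nat (f j)))"
    by (rule sum.reindex_bij_betw[symmetric])
  also have "\<dots> = (\<Sum>j<CARD('p). F (a * of_nat j + b))"
    using F[OF int padic_ints_of_nat res(1)] by simp
  finally show ?thesis by simp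
qed

context
  fixes \<xi> :: "'p::prime_card padic \<Rightarrow> complex"
  assumes xi: "residue_character \<xi>"
begin

lemma residue_character_add: "x \<in> padic_ints \<Longrightarrow> y \<in> padic_ints \<Longrightarrow> \<xi> (x + y) = \<xi> x * \<xi> y"
  and residue_character_trivial: "padic_norm x < 1 \<Longrightarrow> \<xi> x = 1"
  using xi by (auto simp: residue_character_def)

lemma residue_character_cong:
  assumes "x \<in> padic_ints" "y \<in> padic_ints" "padic_norm (x - y) < 1"
  shows "\<xi> x = \<xi> y"
proof -
  have "\<xi> (y + (x - y)) = \<xi> y * \<xi> (x - y)"
    using assms by (intro residue_character_add) (auto simp: padic_ints_def)
  thus ?thesis using residue_character_trivial[OF assms(3)] by simp
qed

lemma residue_character_of_nat: "x \<in> padic_ints \<Longrightarrow> \<xi> (x * of_nat j) = \<xi> x ^ j"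
proof (induction j)
  case 0
  show ?case using residue_character_trivial[of 0] by simp
next
  case (Suc j)
  have "\<xi> (x + x * of_nat j) = \<xi> x * \<xi> (x * of_nat j)"
    using Suc.prems by (intro residue_character_add padic_ints_mult) auto
  thus ?case using Suc by (simp add: algebra_simps)
qed

text \<open>The multiples of a unit c reach every residue, so \<xi>(c) = 1 would make \<xi> trivial
  on Z_p.\<close>

lemma residue_character_unit:
  assumes "c \<in> padic_units"
  shows "\<xi> c \<noteq> 1"
proof
  assume c1: "\<xi> c = 1"
  obtain x where x: "x \<in> padic_ints" "\<xi> x \<noteq> 1" using xi by (auto simp: residue_character_def)
  have xc: "x / c \<in> padic_ints" using x assms by (simp add: padic_ints_def padic_units_def padic_norm_divide)
  have "padic_norm (c * (x / c) - c * of_nat (padic_residue (x / c))) < 1"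
    using padic_residue(2)[OF xc] assms by (intro congruent_mult) (auto simp: padic_units_def)
  hence "padic_norm (x - c * of_nat (padic_residue (x / c))) < 1"
    using unit_nonzero[OF assms] by simp
  hence "\<xi> x = \<xi> (c * of_nat (padic_residue (x / c)))"
    using x assms by (intro residue_character_cong padic_ints_mult) (auto simp: padic_units_ints)
  thus False using x c1 residue_character_of_nat[OF padic_units_ints[OF assms]] by simp
qed

lemma residue_character_sum:
  assumes "c \<in> padic_units"
  shows "(\<Sum>j<CARD('p). \<xi> (c * of_nat j)) = 0"
proof -
  have c: "c \<in> padic_ints" using assms by (rule padic_units_ints)
  have "padic_norm (c * of_nat CARD('p)) < 1"
    using assms padic_norm_of_nat_less_1_iff[of "CARD('p)", where 'p = 'p]
    by (simp add: padic_norm_mult padic_units_def)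
  hence "\<xi> c ^ CARD('p) = 1"
    using residue_character_of_nat[OF c] residue_character_trivial by metis
  thus ?thesis
    using geometric_sum[OF residue_character_unit[OF assms], of "CARD('p)"] residue_character_of_nat[OF c] by simp
qed

context
  assumes odd_card: "odd CARD('p)"
begin

text \<open>The indices j and p - j have the same square modulo p. The half sum on the right is what
  the operator produces, since its classes of units correspond to the nonzero squares.\<close>

lemma gauss_sum_half:
  assumes c: "c \<in> padic_ints"
  shows "gauss_sum \<xi> c = 1 + 2 * (\<Sum>j\<in>{1..(CARD('p) - 1) div 2}. \<xi> (c * (of_nat j)\<^sup>2))"
proof -
  let ?q = "CARD('p)" and ?h = "(CARD('p) - 1) div 2"
  let ?g = "\<lambda>j. \<xi> (c * (of_nat j)\<^sup>2)"
  have hq: "2 * ?h + 1 = ?q" using half_card[OF odd_card] card_pos[where 'p = 'p] by linarith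
  have refl: "?g (?q - j) = ?g j" if "j \<in> {1..?h}" for j
  proof (rule residue_character_cong)
    show "c * (of_nat (?q - j))\<^sup>2 \<in> padic_ints" "c * (of_nat j)\<^sup>2 \<in> padic_ints"
      using c by (simp_all add: power2_eq_square padic_ints_mult)
    have "(of_nat (?q - j))\<^sup>2 - (of_nat j)\<^sup>2 = (of_nat (?q * (?q - 2 * j)) :: 'p padic)"
      using that hq by (simp add: of_nat_diff power2_eq_square algebra_simps)
    moreover have "padic_norm (of_nat (?q * (?q - 2 * j)) :: 'p padic) < 1"
      by (subst padic_norm_of_nat_less_1_iff) simp
    ultimately have "padic_norm ((of_nat (?q - j))\<^sup>2 - (of_nat j)\<^sup>2 :: 'p padic) < 1" by (simp only:)
    thus "padic_norm (c * (of_nat (?q - j))\<^sup>2 - c * (of_nat j)\<^sup>2) < 1"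
      using c by (intro congruent_mult) (auto simp: padic_ints_def)
  qed
  have split: "{..<?q} = insert 0 ({1..?h} \<union> {?h + 1..<?q})" using hq by auto
  have "(\<Sum>j\<in>{?h + 1..<?q}. ?g j) = (\<Sum>j\<in>{1..?h}. ?g (?q - j))"
    by (rule sum.reindex_bij_witness[of _ "\<lambda>j. ?q - j" "\<lambda>j. ?q - j"]) (use hq in auto)
  also have "\<dots> = (\<Sum>j\<in>{1..?h}. ?g j)" using refl by (intro sum.cong) auto
  finally show ?thesis
    unfolding gauss_sum_def split
    by (subst sum.insert, simp, simp, subst sum.union_disjoint)
       (auto simp: residue_character_trivial)
qed

text \<open>The squares and the c-multiples of squares partition the nonzero residues, over which
  \<xi> sums to -1. So the two half sums add up to -1 and the two Gauss sums cancel.\<close>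

lemma gauss_sum_nonsquare:
  assumes c: "c \<in> padic_units" "\<not> square_mod_p c"
  shows "gauss_sum \<xi> c = - gauss_sum \<xi> 1"
proof -
  let ?A = "{1..(CARD('p) - 1) div 2}"
  let ?r = "\<lambda>a j. padic_residue (a * (of_nat j)\<^sup>2 :: 'p padic)"
  note R = residues_squares_nonsquares[OF odd_card c]
  have S: "(\<Sum>x\<in>?r a ` ?A. \<xi> (of_nat x)) = (\<Sum>j\<in>?A. \<xi> (a * (of_nat j)\<^sup>2))"
    if "inj_on (?r a) ?A" "a \<in> padic_units" for a
  proof -
    have int: "a * (of_nat j)\<^sup>2 \<in> padic_ints" for j
      using that(2) by (simp add: power2_eq_square padic_ints_mult padic_units_ints)
    have "\<xi> (of_nat (?r a j)) = \<xi> (a * (of_nat j)\<^sup>2)" for j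
      using int padic_residue(2)[OF int, THEN congruent_sym] by (intro residue_character_cong) auto
    thus ?thesis by (simp only: sum.reindex[OF that(1)] o_def)
  qed
  have "0 = (\<Sum>x<CARD('p). \<xi> (of_nat x))" using residue_character_sum[of 1] by simp
  also have "{..<CARD('p)} = insert 0 {1..<CARD('p)}" using card_pos[where 'p = 'p] by auto
  also have "(\<Sum>x\<in>\<dots>. \<xi> (of_nat x)) = 1 + (\<Sum>x\<in>{1..<CARD('p)}. \<xi> (of_nat x))"
    by (simp add: residue_character_trivial)
  also have "(\<Sum>x\<in>{1..<CARD('p)}. \<xi> (of_nat x)) =
      (\<Sum>j\<in>?A. \<xi> (1 * (of_nat j)\<^sup>2)) + (\<Sum>j\<in>?A. \<xi> (c * (of_nat j)\<^sup>2))"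
    unfolding R(4)[symmetric] S[OF R(1) padic_units_1, symmetric] S[OF R(2) c(1), symmetric]
    by (rule sum.union_disjoint[OF _ _ R(3)]) auto
  finally have "2 * (1 + (\<Sum>j\<in>?A. \<xi> (1 * (of_nat j)\<^sup>2)) + (\<Sum>j\<in>?A. \<xi> (c * (of_nat j)\<^sup>2))) = 0"
    by (simp add: add.assoc)
  thus ?thesis using c(1)
    by (simp add: gauss_sum_half padic_units_ints algebra_simps add_eq_0_iff)
qed

lemma gauss_sum_legendre:
  assumes c: "c \<in> padic_units"
  shows "gauss_sum \<xi> c = of_int (padic_legendre c) * gauss_sum \<xi> 1"
proof (cases "square_mod_p c")
  case True
  then obtain w where w: "w \<in> padic_units" "w\<^sup>2 = c" using unit_square_mod_p_iff[OF odd_card c] by blast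
  have "(\<Sum>j<CARD('p). \<xi> ((w * of_nat j + 0)\<^sup>2)) = (\<Sum>j<CARD('p). \<xi> ((of_nat j)\<^sup>2))"
  proof (rule sum_residues_affine[OF w(1)])
    fix x y :: "'p padic" assume xy: "x \<in> padic_ints" "y \<in> padic_ints" "padic_norm (x - y) < 1"
    have "x\<^sup>2 - y\<^sup>2 = (x + y) * x - (x + y) * y" by (simp add: power2_eq_square algebra_simps)
    hence "padic_norm (x\<^sup>2 - y\<^sup>2) < 1"
      using congruent_mult[OF xy(3), of "x + y"] padic_ints_add[OF xy(1,2)] by (simp add: padic_ints_def)
    thus "\<xi> (x\<^sup>2) = \<xi> (y\<^sup>2)"
      using xy by (intro residue_character_cong) (auto simp: power2_eq_square padic_ints_mult)
  qed (auto simp: padic_ints_def)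
  thus ?thesis using True c w(2) by (simp add: gauss_sum_def power_mult_distrib legendre_unit[OF odd_card])
next
  case False
  thus ?thesis using gauss_sum_nonsquare[OF c] c by (simp add: legendre_unit[OF odd_card])
qed

text \<open>In \<open>\<Sum> \<xi>(x\<^sup>2 - y\<^sup>2)\<close> substitute \<open>x = d + y\<close>: the sum over \<open>y\<close> of \<open>\<xi>(d\<^sup>2 + 2 d y)\<close> vanishes unless \<open>d = 0\<close>.\<close>

lemma gauss_sum_mult_minus: "gauss_sum \<xi> 1 * gauss_sum \<xi> (-1) = of_nat CARD('p)"
proof -
  let ?q = "CARD('p)"
  have "gauss_sum \<xi> 1 * gauss_sum \<xi> (-1) =
      (\<Sum>y<?q. \<Sum>x<?q. \<xi> ((of_nat x)\<^sup>2) * \<xi> (- (of_nat y)\<^sup>2))"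
    by (subst sum.swap) (simp add: gauss_sum_def sum_product)
  also have "\<dots> = (\<Sum>y<?q. \<Sum>x<?q. \<xi> ((of_nat x)\<^sup>2 - (of_nat y)\<^sup>2))"
  proof (intro sum.cong refl)
    fix x y :: nat
    show "\<xi> ((of_nat x)\<^sup>2) * \<xi> (- (of_nat y)\<^sup>2) = \<xi> ((of_nat x)\<^sup>2 - (of_nat y)\<^sup>2)"
      using residue_character_add[of "(of_nat x)\<^sup>2" "- (of_nat y)\<^sup>2"]
      by (simp add: padic_ints_def padic_norm_power padic_norm_of_nat_le power_le_one)
  qed
  also have "\<dots> = (\<Sum>y<?q. \<Sum>d<?q. \<xi> ((1 * of_nat d + of_nat y)\<^sup>2 - (of_nat y)\<^sup>2))"
  proof (rule sum.cong[OF refl], rule sum_residues_affine[OF padic_units_1 padic_ints_of_nat, symmetric])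
    fix k :: nat and x y :: "'p padic" assume xy: "x \<in> padic_ints" "y \<in> padic_ints" "padic_norm (x - y) < 1"
    have "(x\<^sup>2 - (of_nat k)\<^sup>2) - (y\<^sup>2 - (of_nat k)\<^sup>2) = (x + y) * x - (x + y) * y" by (simp add: power2_eq_square algebra_simps)
    hence *: "padic_norm ((x\<^sup>2 - (of_nat k)\<^sup>2) - (y\<^sup>2 - (of_nat k)\<^sup>2)) < 1"
      using congruent_mult[OF xy(3), of "x + y"] padic_ints_add[OF xy(1,2)] by (simp add: padic_ints_def)
    have "z\<^sup>2 - (of_nat k)\<^sup>2 \<in> padic_ints" if "z \<in> padic_ints" for z :: "'p padic"
      using that padic_norm_diff[of "z\<^sup>2" "(of_nat k)\<^sup>2"]
      by (auto simp: padic_ints_def padic_norm_power padic_norm_of_nat_le power_le_one intro: order_trans)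
    thus "\<xi> (x\<^sup>2 - (of_nat k)\<^sup>2) = \<xi> (y\<^sup>2 - (of_nat k)\<^sup>2)"
      using xy * by (intro residue_character_cong) auto
  qed
  also have "\<dots> = (\<Sum>y<?q. \<Sum>d<?q. \<xi> ((of_nat d)\<^sup>2) * \<xi> (2 * of_nat d * of_nat y))"
  proof (intro sum.cong refl)
    fix y d :: nat
    have "(1 * of_nat d + of_nat y)\<^sup>2 - (of_nat y)\<^sup>2 = (of_nat (d\<^sup>2) + of_nat (2 * d * y) :: 'p padic)"
      by (simp add: power2_eq_square algebra_simps)
    thus "\<xi> ((1 * of_nat d + of_nat y)\<^sup>2 - (of_nat y)\<^sup>2) = \<xi> ((of_nat d)\<^sup>2) * \<xi> (2 * of_nat d * of_nat y)"
      using residue_character_add[OF padic_ints_of_nat[of "d\<^sup>2"] padic_ints_of_nat[of "2 * d * y"]] by simp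
  qed
  also have "\<dots> = (\<Sum>d<?q. \<xi> ((of_nat d)\<^sup>2) * (\<Sum>y<?q. \<xi> (2 * of_nat d * of_nat y)))"
    by (subst sum.swap) (simp add: sum_distrib_left)
  also have "\<dots> = (\<Sum>d<?q. if d = 0 then of_nat ?q else 0)"
  proof (intro sum.cong refl)
    fix d assume "d \<in> {..<?q}"
    hence "(2 * of_nat d :: 'p padic) \<in> padic_units" if "d \<noteq> 0"
      using that padic_norm_of_nat_eq_1[of d, where 'p = 'p] padic_norm_2[OF odd_card]
      by (simp add: padic_units_def padic_norm_mult)
    thus "\<xi> ((of_nat d)\<^sup>2) * (\<Sum>y<?q. \<xi> (2 * of_nat d * of_nat y)) = (if d = 0 then of_nat ?q else 0)"
      using residue_character_sum[of "2 * of_nat d"] by (auto simp: residue_character_trivial)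
  qed
  also have "\<dots> = of_nat ?q" by simp
  finally show ?thesis .
qed

text \<open>Passing from 1 to -1 costs the Legendre symbol of -1, which turns the product formula
  into one for the square. The right-hand side is the same for every \<xi>; this is what allows
  Gauss sums of different origin to be compared.\<close>

lemma gauss_sum_square: "(gauss_sum \<xi> 1)\<^sup>2 = of_int (padic_legendre (-1 :: 'p padic)) * of_nat CARD('p)"
proof -
  have m1: "(-1 :: 'p padic) \<in> padic_units" by (simp add: padic_units_def)
  have "of_int (padic_legendre (-1 :: 'p padic)) * (gauss_sum \<xi> 1 * gauss_sum \<xi> (-1)) =
      of_int (padic_legendre (-1 :: 'p padic) * padic_legendre (-1 :: 'p padic)) * (gauss_sum \<xi> 1)\<^sup>2"
    using gauss_sum_legendre[OF m1] by (simp add: power2_eq_square)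
  thus ?thesis using legendre_square[OF odd_card m1] gauss_sum_mult_minus by simp
qed

end
end

section \<open>The Hilbert symbol\<close>

definition unit_part :: "'p::prime_card padic \<Rightarrow> 'p padic" where
  "unit_part x = x * padic_p powi (- padic_ord x)"

text \<open>For odd p this sign is multiplicative, and together with the parity of
  \<open>padic_ord\<close> it determines the class of a nonzero x modulo squares.\<close>

definition unit_sign :: "'p::prime_card padic \<Rightarrow> int" where
  "unit_sign x = padic_legendre (unit_part x)"

lemma unit_part_unit:
  assumes "x \<noteq> (0 :: 'p::prime_card padic)"
  shows "unit_part x \<in> padic_units"
proof -
  have "padic_norm (unit_part x) = real CARD('p) powi (- padic_ord x) * inverse (real CARD('p)) powi (- padic_ord x)"
    by (simp add: unit_part_def padic_norm_mult padic_norm_powi padic_norm_p padic_norm_ord[OF assms])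
  also have "\<dots> = 1" by (simp add: power_int_inverse power_int_minus)
  finally show ?thesis by (simp add: padic_units_def)
qed

lemma unit_part_eq: "x = unit_part x * padic_p powi (padic_ord x :: int)"
  by (simp add: unit_part_def power_int_minus)

lemma unit_part_mult:
  "x \<noteq> 0 \<Longrightarrow> y \<noteq> 0 \<Longrightarrow> unit_part (x * y) = unit_part x * unit_part (y :: 'p::prime_card padic)"
  by (simp add: unit_part_def padic_ord_mult power_int_add power_int_diff power_int_minus field_simps)

lemma unit_part_of_unit [simp]: "x \<in> padic_units \<Longrightarrow> unit_part x = (x :: 'p::prime_card padic)"
  by (simp add: unit_part_def)

lemma unit_part_p [simp]: "unit_part (padic_p :: 'p::prime_card padic) = 1"
  by (simp add: unit_part_def power_int_minus)

lemma even_ord_decomp: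
  assumes "even (padic_ord x)"
  shows "\<exists>y. (y :: 'p::prime_card padic) \<noteq> 0 \<and> x = unit_part x * y\<^sup>2"
proof -
  obtain l where l: "padic_ord x = l + l" using assms by (metis evenE mult_2)
  have "x = unit_part x * (padic_p powi l)\<^sup>2"
    by (subst unit_part_eq, unfold l) (simp only: power_int_add padic_p_nonzero power2_eq_square simp_thms)
  thus ?thesis by (intro exI[of _ "padic_p powi l"]) simp
qed

lemma odd_ord_decomp:
  assumes "odd (padic_ord x)"
  shows "\<exists>y. (y :: 'p::prime_card padic) \<noteq> 0 \<and> x = unit_part x * padic_p * y\<^sup>2"
proof -
  obtain l where l: "padic_ord x = l + l + 1" using assms by (metis oddE mult_2)
  have "x = unit_part x * padic_p * (padic_p powi l)\<^sup>2"
    by (subst unit_part_eq, unfold l)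
       (simp only: power_int_add padic_p_nonzero power2_eq_square simp_thms power_int_1_right mult_ac)
  thus ?thesis by (intro exI[of _ "padic_p powi l"]) simp
qed

lemma hilbert_commute: "hilbert_symbol a b = hilbert_symbol b (a :: 'p::prime_card padic)"
  unfolding hilbert_symbol_def by (intro if_cong refl) (metis add.commute prod.inject)

lemma hilbert_cases: "hilbert_symbol a (b :: 'p::prime_card padic) = 1 \<or> hilbert_symbol a b = -1"
  by (simp add: hilbert_symbol_def)

lemma hilbert_mult_square:
  assumes "y \<noteq> (0 :: 'p::prime_card padic)"
  shows "hilbert_symbol (a * y\<^sup>2) b = hilbert_symbol a b"
proof -
  have "(\<exists>x s z. (x, s, z) \<noteq> (0, 0, 0) \<and> z\<^sup>2 = a * y\<^sup>2 * x\<^sup>2 + b * s\<^sup>2) \<longleftrightarrow>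
      (\<exists>x s z. (x, s, z) \<noteq> (0, 0, 0) \<and> z\<^sup>2 = a * x\<^sup>2 + b * s\<^sup>2)" (is "?L \<longleftrightarrow> ?R")
  proof
    assume ?L
    then obtain x s z where "(x, s, z) \<noteq> (0, 0, 0)" "z\<^sup>2 = a * y\<^sup>2 * x\<^sup>2 + b * s\<^sup>2" by blast
    thus ?R using assms
      by (intro exI[of _ "y * x"] exI[of _ s] exI[of _ z]) (auto simp: power_mult_distrib)
  next
    assume ?R
    then obtain x s z where "(x, s, z) \<noteq> (0, 0, 0)" "z\<^sup>2 = a * x\<^sup>2 + b * s\<^sup>2" by blast
    thus ?L using assms
      by (intro exI[of _ "x / y"] exI[of _ s] exI[of _ z]) (auto simp: power_divide)
  qed
  thus ?thesis by (simp add: hilbert_symbol_def)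
qed

lemma hilbert_mult_square_right:
  "y \<noteq> (0 :: 'p::prime_card padic) \<Longrightarrow> hilbert_symbol a (b * y\<^sup>2) = hilbert_symbol a b"
  using hilbert_mult_square[of y b a] by (simp add: hilbert_commute)

lemma hilbert_square: "hilbert_symbol ((w :: 'p::prime_card padic)\<^sup>2) b = 1"
proof -
  have "(1, 0, w) \<noteq> (0 :: 'p padic, 0 :: 'p padic, 0) \<and> w\<^sup>2 = w\<^sup>2 * 1\<^sup>2 + b * 0\<^sup>2" by simp
  thus ?thesis unfolding hilbert_symbol_def by metis
qed

lemma hilbert_eq_1_iff:
  "hilbert_symbol a b = 1 \<longleftrightarrow>
    (\<exists>x y z. (x, y, z) \<noteq> (0, 0, 0) \<and> z\<^sup>2 = a * x\<^sup>2 + b * y\<^sup>2)" for a :: "'p::prime_card padic"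
  by (simp add: hilbert_symbol_def)

text \<open>Multiplying z^2 = a x^2 + c y^2 by a gives (a x)^2 = a z^2 - a c y^2, a solution for -a
  c. Doing this twice turns b into a^2 b, so the implication can be reversed. This is (a, -a) = 1 in
  a form available before bilinearity.\<close>

lemma hilbert_minus_mult:
  fixes a b :: "'p::prime_card padic"
  assumes "a \<noteq> 0"
  shows "hilbert_symbol a (- a * b) = hilbert_symbol a b"
proof -
  have *: "hilbert_symbol a (- a * c) = 1" if c: "hilbert_symbol a c = 1" for c
  proof -
    obtain x y z where xyz: "(x, y, z) \<noteq> (0, 0, 0)" "z\<^sup>2 = a * x\<^sup>2 + c * y\<^sup>2"
      using c unfolding hilbert_eq_1_iff by blast
    have "(a * x)\<^sup>2 = a * z\<^sup>2 + (- a * c) * y\<^sup>2"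
      unfolding xyz(2) by (simp add: power2_eq_square algebra_simps)
    moreover have "(z, y, a * x) \<noteq> (0, 0, 0)"
    proof
      assume 0: "(z, y, a * x) = (0, 0, 0)"
      hence "x = 0" using assms by simp
      thus False using 0 xyz(1) by simp
    qed
    ultimately show ?thesis unfolding hilbert_eq_1_iff by blast
  qed
  have "hilbert_symbol a (- a * (- a * b)) = hilbert_symbol a b"
    using hilbert_mult_square_right[OF assms, of a b] by (simp add: power2_eq_square mult_ac)
  thus ?thesis using *[of b] *[of "- a * b"] hilbert_cases[of a b] hilbert_cases[of a "- a * b"] by argo
qed

context
  assumes odd_card: "odd CARD('p::prime_card)"
begin

lemma hilbert_unit_square:
  "u \<in> padic_units \<Longrightarrow> square_mod_p (u :: 'p padic) \<Longrightarrow> hilbert_symbol u b = 1"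
  using unit_square_mod_p_iff[OF odd_card] hilbert_square by metis

text \<open>If u and v are both nonsquares, choose a nonsquare c = s^2 + 1. Then u c = w^2 and u v =
  m^2 for some w and m, and w^2 = u s^2 + u = u s^2 + v (m / v)^2.\<close>

lemma hilbert_units:
  fixes u v :: "'p padic"
  assumes uv: "u \<in> padic_units" "v \<in> padic_units"
  shows "hilbert_symbol u v = 1"
proof (cases "square_mod_p u \<or> square_mod_p v")
  case True
  thus ?thesis using hilbert_unit_square uv hilbert_commute by metis
next
  case False
  obtain j where j: "square_mod_p (of_nat j :: 'p padic)" "\<not> square_mod_p (of_nat (Suc j) :: 'p padic)"
    using ex_square_plus_1_nonsquare[OF odd_card] uv False by blast
  obtain s where s: "padic_norm s \<le> 1" "padic_norm (of_nat j - s\<^sup>2 :: 'p padic) < 1"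
    using j(1) by (auto simp: square_mod_p_iff)
  define c where "c = s\<^sup>2 + 1"
  have cc: "padic_norm (of_nat (Suc j) - c) < 1" using s(2) by (simp add: c_def)
  have nc: "\<not> square_mod_p c"
    using j(2) cc congruent_trans unfolding square_mod_p_iff by blast
  have "padic_norm c \<le> 1"
    using padic_norm_add[of "s\<^sup>2" 1] s(1) by (simp add: c_def padic_norm_power power_le_one order_trans)
  moreover have "\<not> padic_norm c < 1"
    using nc unfolding square_mod_p_iff by (auto dest: spec[of _ 0])
  ultimately have c: "c \<in> padic_units" by (simp add: padic_units_def)
  have "square_mod_p (u * c)" "square_mod_p (u * v)"
    using square_mod_p_mult_nonsquares[OF odd_card] uv c nc False by blast+
  then obtain w m where w: "w\<^sup>2 = u * c" and m: "m\<^sup>2 = u * v"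
    using unit_square_mod_p_iff[OF odd_card] uv c padic_units_mult by metis
  have v0: "v \<noteq> 0" using uv unit_nonzero by blast
  have "w\<^sup>2 = u * s\<^sup>2 + v * (m / v)\<^sup>2"
    using v0 by (simp add: w m c_def power_divide) (simp add: power2_eq_square field_simps)
  moreover have "w \<noteq> 0" using w c uv unit_nonzero by force
  ultimately have "\<exists>x y z. (x, y, z) \<noteq> (0, 0, 0) \<and> z\<^sup>2 = u * x\<^sup>2 + v * y\<^sup>2"
    by (intro exI[of _ s] exI[of _ "m / v"] exI[of _ w]) auto
  thus ?thesis by (simp add: hilbert_symbol_def)
qed

text \<open>This is the norm form of the unramified quadratic extension. It has no nontrivial zero
  modulo p, so its two terms cannot cancel even when their norms agree.\<close>

lemma norm_nonsquare_form:
  fixes u x z :: "'p padic"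
  assumes u: "u \<in> padic_units" "\<not> square_mod_p u"
  shows "padic_norm (z\<^sup>2 - u * x\<^sup>2) = max (padic_norm z) (padic_norm x) ^ 2"
proof -
  have n: "padic_norm (u * x\<^sup>2) = padic_norm x ^ 2" "padic_norm (z\<^sup>2) = padic_norm z ^ 2"
    using u by (simp_all add: padic_norm_mult padic_norm_power padic_units_def)
  consider "padic_norm x < padic_norm z" | "padic_norm z < padic_norm x" | "x = 0" "z = 0"
    | "padic_norm x = padic_norm z" "x \<noteq> 0" by fastforce
  thus ?thesis
  proof cases
    case 1
    hence "padic_norm (- (u * x\<^sup>2)) < padic_norm (z\<^sup>2)" by (simp add: n power_strict_mono)
    thus ?thesis using padic_norm_add_eq[of "- (u * x\<^sup>2)" "z\<^sup>2"] 1 n by simp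
  next
    case 2
    hence "padic_norm (z\<^sup>2) < padic_norm (- (u * x\<^sup>2))" by (simp add: n power_strict_mono)
    thus ?thesis using padic_norm_add_eq[of "z\<^sup>2" "- (u * x\<^sup>2)"] 2 n by simp
  next
    case 4
    have zx: "padic_norm (z / x) = 1"
      using 4(1) padic_norm_pos[OF 4(2)] by (simp add: padic_norm_divide del: padic_norm_eq_0)
    have "padic_norm ((z / x)\<^sup>2 - u) \<le> 1"
      using padic_norm_diff[of "(z / x)\<^sup>2" u] zx u by (simp add: padic_norm_power padic_units_def)
    moreover have "\<not> padic_norm ((z / x)\<^sup>2 - u) < 1"
      using u(2) zx unfolding square_mod_p_iff by (metis order_refl padic_norm_diff_commute)
    ultimately have 1: "padic_norm ((z / x)\<^sup>2 - u) = 1" by linarith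
    have "z\<^sup>2 - u * x\<^sup>2 = ((z / x)\<^sup>2 - u) * x\<^sup>2" using 4 by (simp add: field_simps)
    hence "padic_norm (z\<^sup>2 - u * x\<^sup>2) = 1 * padic_norm (x\<^sup>2)"
      by (simp only: padic_norm_mult 1)
    thus ?thesis using 4(1) by (simp add: padic_norm_power)
  qed simp
qed

text \<open>For nonsquare u, a solution would give v p y^2, of odd order, the same norm as the
  square of the larger of z and x, of even order.\<close>

lemma hilbert_unit_p:
  fixes u v :: "'p padic"
  assumes u: "u \<in> padic_units" and v: "v \<in> padic_units"
  shows "hilbert_symbol u (v * padic_p) = padic_legendre u"
proof (cases "square_mod_p u")
  case True
  thus ?thesis using hilbert_unit_square u by (simp add: legendre_unit[OF odd_card])
next
  case False
  have "\<not> (\<exists>x y z. (x, y, z) \<noteq> (0, 0, 0) \<and> z\<^sup>2 = u * x\<^sup>2 + v * padic_p * y\<^sup>2)"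
  proof
    assume "\<exists>x y z. (x, y, z) \<noteq> (0, 0, 0) \<and> z\<^sup>2 = u * x\<^sup>2 + v * padic_p * y\<^sup>2"
    then obtain x y z where xyz: "(x, y, z) \<noteq> (0, 0, 0)" "z\<^sup>2 = u * x\<^sup>2 + v * padic_p * y\<^sup>2" by blast
    have eq: "z\<^sup>2 - u * x\<^sup>2 = v * padic_p * y\<^sup>2" using xyz(2) by simp
    define m where "m = (if padic_norm z \<ge> padic_norm x then z else x)"
    have N: "padic_norm (v * padic_p * y\<^sup>2) = padic_norm (m\<^sup>2)"
      using norm_nonsquare_form[OF u False, of z x] eq by (simp add: m_def padic_norm_power max_def)
    have m: "m \<noteq> 0"
    proof
      assume "m = 0"
      hence "z = 0 \<and> x = 0" using padic_norm_nonneg[of x] padic_norm_pos[of x]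
        by (cases "padic_norm z \<ge> padic_norm x") (auto simp: m_def split: if_splits)
      hence "y = 0" using eq v unit_nonzero by auto
      thus False using \<open>z = 0 \<and> x = 0\<close> xyz(1) by simp
    qed
    have y: "y \<noteq> 0" using N m by auto
    have v0: "v \<noteq> 0" using v unit_nonzero by blast
    have "padic_ord (v * padic_p * y\<^sup>2) = padic_ord (m\<^sup>2)" using N by (simp add: padic_ord_def)
    hence "1 + (padic_ord y + padic_ord y) = padic_ord m + padic_ord m"
      using m y v v0 by (simp add: power2_eq_square padic_ord_mult)
    thus False by presburger
  qed
  thus ?thesis using False u by (simp add: hilbert_symbol_def legendre_unit[OF odd_card])
qed

lemma unit_sign_cases: "(x :: 'p padic) \<noteq> 0 \<Longrightarrow> unit_sign x = 1 \<or> unit_sign x = -1"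
  using unit_part_unit[of x] by (auto simp: unit_sign_def legendre_unit[OF odd_card])

lemma unit_sign_square:
  fixes x :: "'p padic"
  assumes "x \<noteq> 0"
  shows "unit_sign x * unit_sign x = 1" "unit_sign x * (unit_sign x * k) = k"
  using unit_sign_cases[OF assms] by auto

lemma unit_sign_mult:
  "x \<noteq> 0 \<Longrightarrow> y \<noteq> 0 \<Longrightarrow> unit_sign (x * y) = unit_sign x * unit_sign (y :: 'p padic)"
  by (simp add: unit_sign_def unit_part_mult legendre_mult[OF odd_card] unit_part_unit)

text \<open>The tame symbol. Stripping squares leaves units or units times p. If both orders are
  odd, \<open>hilbert_minus_mult\<close> replaces the second argument by a unit up to squares, and
  this is where the sign of -1 comes from.\<close>

lemma hilbert_formula:
  fixes a b :: "'p padic"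
  assumes "a \<noteq> 0" "b \<noteq> 0"
  shows "hilbert_symbol a b = (if odd (padic_ord b) then unit_sign a else 1) *
    (if odd (padic_ord a) then unit_sign b else 1) *
    (if odd (padic_ord a) \<and> odd (padic_ord b) then unit_sign (-1 :: 'p padic) else 1)"
proof -
  let ?u = "unit_part a" and ?v = "unit_part b"
  have uv: "?u \<in> padic_units" "?v \<in> padic_units" using assms by (simp_all add: unit_part_unit)
  have m1: "(-1 :: 'p padic) \<in> padic_units" by (simp add: padic_units_def)
  consider "even (padic_ord a)" "even (padic_ord b)" | "even (padic_ord a)" "odd (padic_ord b)"
    | "odd (padic_ord a)" "even (padic_ord b)" | "odd (padic_ord a)" "odd (padic_ord b)" by blast
  thus ?thesis
  proof cases
    case 1
    then obtain x y where xy: "x \<noteq> 0" "a = ?u * x\<^sup>2" "y \<noteq> 0" "b = ?v * y\<^sup>2"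
      using even_ord_decomp[of a] even_ord_decomp[of b] by blast
    have "hilbert_symbol a b = hilbert_symbol ?u ?v"
      using arg_cong2[where f = hilbert_symbol, OF xy(2,4)] xy(1,3)
      by (simp only: hilbert_mult_square hilbert_mult_square_right simp_thms)
    thus ?thesis using 1 hilbert_units[OF uv] by simp
  next
    case 2
    then obtain x y where xy: "x \<noteq> 0" "a = ?u * x\<^sup>2" "y \<noteq> 0" "b = ?v * padic_p * y\<^sup>2"
      using even_ord_decomp[of a] odd_ord_decomp[of b] by blast
    have "hilbert_symbol a b = hilbert_symbol ?u (?v * padic_p)"
      using arg_cong2[where f = hilbert_symbol, OF xy(2,4)] xy(1,3)
      by (simp only: hilbert_mult_square hilbert_mult_square_right simp_thms)
    thus ?thesis using 2 hilbert_unit_p[OF uv] by (simp add: unit_sign_def)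
  next
    case 3
    then obtain x y where xy: "x \<noteq> 0" "a = ?u * padic_p * x\<^sup>2" "y \<noteq> 0" "b = ?v * y\<^sup>2"
      using even_ord_decomp[of b] odd_ord_decomp[of a] by blast
    have "hilbert_symbol a b = hilbert_symbol ?v (?u * padic_p)"
      using arg_cong2[where f = hilbert_symbol, OF xy(2,4)] xy(1,3)
      by (simp only: hilbert_mult_square hilbert_mult_square_right hilbert_commute[of ?v] simp_thms)
    thus ?thesis using 3 hilbert_unit_p[OF uv(2,1)] by (simp add: unit_sign_def)
  next
    case 4
    then obtain x y where xy: "x \<noteq> 0" "a = ?u * padic_p * x\<^sup>2" "y \<noteq> 0" "b = ?v * padic_p * y\<^sup>2"
      using odd_ord_decomp[of a] odd_ord_decomp[of b] by blast
    have "hilbert_symbol a b = hilbert_symbol (?u * padic_p) (?v * padic_p)"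
      using arg_cong2[where f = hilbert_symbol, OF xy(2,4)] xy(1,3)
      by (simp only: hilbert_mult_square hilbert_mult_square_right simp_thms)
    also have "\<dots> = hilbert_symbol (?u * padic_p) (- (?u * padic_p) * (?v * padic_p))"
      using unit_nonzero[OF uv(1)] by (intro hilbert_minus_mult[symmetric]) simp
    also have "- (?u * padic_p) * (?v * padic_p) = - ?u * ?v * padic_p\<^sup>2"
      by (simp add: power2_eq_square)
    also have "hilbert_symbol (?u * padic_p) (- ?u * ?v * padic_p\<^sup>2) = hilbert_symbol (?u * padic_p) (- ?u * ?v)"
      by (rule hilbert_mult_square_right) simp
    also have "\<dots> = padic_legendre (-1 * ?u * ?v)"
      using hilbert_unit_p[of "- ?u * ?v" ?u] uv
      by (simp add: hilbert_commute padic_units_mult padic_units_minus)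
    also have "\<dots> = padic_legendre (-1 :: 'p padic) * padic_legendre ?u * padic_legendre ?v"
      using uv m1 by (simp only: legendre_mult[OF odd_card] padic_units_mult)
    finally show ?thesis using 4 m1 by (simp add: unit_sign_def)
  qed
qed

lemma hilbert_mult_left:
  fixes a b c :: "'p padic"
  assumes "a \<noteq> 0" "b \<noteq> 0" "c \<noteq> 0"
  shows "hilbert_symbol (a * b) c = hilbert_symbol a c * hilbert_symbol b c"
proof -
  have ab: "a * b \<noteq> 0" using assms by simp
  have m1: "(-1 :: 'p padic) \<noteq> 0" by simp
  show ?thesis
    unfolding hilbert_formula[OF assms(1,3)] hilbert_formula[OF assms(2,3)] hilbert_formula[OF ab assms(3)]
      padic_ord_mult[OF assms(1,2)] unit_sign_mult[OF assms(1,2)]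
    by (cases "odd (padic_ord a)"; cases "odd (padic_ord b)"; cases "odd (padic_ord c)")
       (simp_all add: unit_sign_square[OF assms(3)] unit_sign_square[OF m1] mult_ac)
qed

lemma hilbert_mult_right:
  fixes a b c :: "'p padic"
  assumes "a \<noteq> 0" "b \<noteq> 0" "c \<noteq> 0"
  shows "hilbert_symbol a (b * c) = hilbert_symbol a b * hilbert_symbol a c"
  using hilbert_mult_left[OF assms(2,3,1)] by (simp add: hilbert_commute)

end

section \<open>The Weil index\<close>

text \<open>The index is written i + a l. With suitable a this splits off either the top or the
  bottom digit in base p.\<close>

lemma sum_mixed_radix:
  fixes f :: "nat \<Rightarrow> complex"
  shows "(\<Sum>j<a * b. f j) = (\<Sum>i<a. \<Sum>l<b. f (i + a * l))"
proof -
  have "(\<Sum>j<a * b. f j) = (\<Sum>l<b. sum f {l * a..<l * a + a})"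
    by (simp add: sum.nat_group mult.commute)
  also have "\<dots> = (\<Sum>l<b. \<Sum>i<a. f (i + a * l))"
  proof (rule sum.cong[OF refl])
    fix l
    have "sum f {l * a..<l * a + a} = sum f {0 + l * a..<a + l * a}" by (simp add: add.commute)
    also have "\<dots> = (\<Sum>i<a. f (i + a * l))"
      by (subst sum.shift_bounds_nat_ivl) (simp add: atLeast0LessThan mult.commute)
    finally show "sum f {l * a..<l * a + a} = (\<Sum>i<a. f (i + a * l))" .
  qed
  also have "\<dots> = (\<Sum>i<a. \<Sum>l<b. f (i + a * l))" by (rule sum.swap)
  finally show ?thesis .
qed

context
  fixes \<psi> :: "'p::prime_card padic \<Rightarrow> complex"
  assumes odd_card: "odd CARD('p)" and psi: "additive_character \<psi>" and cond: "conductor_zero \<psi>"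
begin

lemma psi_add: "\<psi> (x + y) = \<psi> x * \<psi> y"
  using psi by (simp add: additive_character_def)

lemma psi_int: "padic_norm x \<le> 1 \<Longrightarrow> \<psi> x = 1"
  using cond by (simp add: conductor_zero_def padic_ints_def)

lemma psi_cong: "padic_norm (x - y) \<le> 1 \<Longrightarrow> \<psi> x = \<psi> y"
  using psi_add[of y "x - y"] psi_int by simp

lemma residue_character_psi: "residue_character (\<lambda>x. \<psi> (x / padic_p))"
  unfolding residue_character_def
proof (intro conjI ballI allI impI)
  fix x y :: "'p padic"
  show "\<psi> ((x + y) / padic_p) = \<psi> (x / padic_p) * \<psi> (y / padic_p)"
    by (simp add: add_divide_distrib psi_add)
next
  fix x :: "'p padic" assume "padic_norm x < 1"
  thus "\<psi> (x / padic_p) = 1"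
    by (intro psi_int) (simp add: padic_norm_divide padic_norm_p padic_norm_less_1_iff field_simps)
next
  obtain x where "padic_p * x \<in> padic_ints" "\<psi> x \<noteq> 1" using cond by (auto simp: conductor_zero_def)
  thus "\<exists>x\<in>padic_ints. \<psi> (x / padic_p) \<noteq> 1"
    by (intro bexI[of _ "padic_p * x"]) auto
qed

definition psi_gauss :: complex where
  "psi_gauss = gauss_sum (\<lambda>x. \<psi> (x / padic_p)) 1"

definition quad_sum :: "'p padic \<Rightarrow> nat \<Rightarrow> complex" where
  "quad_sum u k = (\<Sum>j<CARD('p) ^ k. \<psi> (u * (of_nat j)\<^sup>2 / padic_p ^ k))"

lemma quad_sum_0: "quad_sum u 0 = (1 :: complex)"
  by (simp add: quad_sum_def psi_int)

lemma quad_sum_1: "u \<in> padic_units \<Longrightarrow> quad_sum u 1 = of_int (padic_legendre u) * psi_gauss"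
  using gauss_sum_legendre[OF residue_character_psi odd_card, of u]
  by (simp add: quad_sum_def psi_gauss_def gauss_sum_def)

text \<open>The top digit l of the index enters only through the cross term 2 u i l / p. Summing
  over l kills every i prime to p, and the remaining i = p i' reproduce the sum two levels
  lower.\<close>

lemma quad_sum_rec:
  assumes u: "u \<in> padic_units"
  shows "quad_sum u (k + 2) = of_nat CARD('p) * quad_sum u k"
proof -
  let ?q = "CARD('p)"
  let ?p = "padic_p :: 'p padic"
  have pq: "(of_nat ?q :: 'p padic) = ?p" by (simp add: padic_p_def)
  have nu: "padic_norm u = 1" using u by (simp add: padic_units_def)
  \<comment> \<open>For P = p^k and integral y the remainder u P y^2 is integral, so \<psi> does not
    see it.\<close>
  have expand: "u * (x + P * ?p * y)\<^sup>2 / (P * ?p * ?p) - (u * x\<^sup>2 / (P * ?p * ?p) + 2 * u * x * y / ?p) =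
      u * P * y\<^sup>2" if "P \<noteq> 0" for x y P :: "'p padic"
    using that by (simp add: field_simps power2_eq_square)
  have step: "\<psi> (u * (of_nat (i + ?q ^ (k + 1) * l))\<^sup>2 / ?p ^ (k + 2)) =
      \<psi> (u * (of_nat i)\<^sup>2 / ?p ^ (k + 2)) * \<psi> (2 * u * of_nat i * of_nat l / ?p)" for i l
  proof -
    have "(of_nat (i + ?q ^ (k + 1) * l) :: 'p padic) = of_nat i + ?p ^ k * ?p * of_nat l"
      by (simp add: pq[symmetric])
    moreover have "?p ^ (k + 2) = ?p ^ k * ?p * ?p" by simp
    ultimately have "u * (of_nat (i + ?q ^ (k + 1) * l))\<^sup>2 / ?p ^ (k + 2) -
        (u * (of_nat i)\<^sup>2 / ?p ^ (k + 2) + 2 * u * of_nat i * of_nat l / ?p) = u * ?p ^ k * (of_nat l)\<^sup>2"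
      using expand[of "?p ^ k" "of_nat i" "of_nat l"] by (simp only: power_not_zero padic_p_nonzero simp_thms)
    moreover have "padic_norm (u * ?p ^ k * (of_nat l)\<^sup>2) \<le> 1"
    proof -
      have "inverse (real ?q) ^ k \<le> 1" using card_gt_1[where 'p = 'p] by (intro power_le_one) (auto simp: inverse_le_1_iff)
      thus ?thesis
        by (simp add: padic_norm_mult padic_norm_power nu padic_norm_p padic_norm_of_nat_le power_le_one mult_le_one)
    qed
    ultimately show ?thesis by (simp only: psi_add[symmetric]) (intro psi_cong, simp)
  qed
  have inner: "(\<Sum>l<?q. \<psi> (2 * u * of_nat i * of_nat l / ?p)) = (if ?q dvd i then of_nat ?q else 0)" for i
  proof (cases "?q dvd i")
    case True
    have "\<psi> (2 * u * of_nat i * of_nat l / ?p) = 1" for l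
    proof (rule psi_int)
      obtain i' where "i = ?q * i'" using True by auto
      hence "2 * u * of_nat i * of_nat l / ?p = 2 * u * of_nat i' * of_nat l" by (simp add: pq)
      thus "padic_norm (2 * u * of_nat i * of_nat l / ?p) \<le> 1"
        by (simp add: padic_norm_mult nu padic_norm_2[OF odd_card] padic_norm_of_nat_le mult_le_one)
    qed
    thus ?thesis using True by simp
  next
    case False
    hence "padic_norm (of_nat i :: 'p padic) = 1"
      using padic_norm_of_nat_less_1_iff[of i, where 'p = 'p] padic_norm_of_nat_le[of i, where 'p = 'p] by linarith
    hence "2 * u * of_nat i \<in> padic_units"
      by (simp add: padic_units_def padic_norm_mult nu padic_norm_2[OF odd_card])
    thus ?thesis using residue_character_sum[OF residue_character_psi] False by simp
  qed
  have "quad_sum u (k + 2) = (\<Sum>j<?q ^ (k + 1) * ?q. \<psi> (u * (of_nat j)\<^sup>2 / ?p ^ (k + 2)))"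
    by (simp add: quad_sum_def mult_ac)
  also have "\<dots> = (\<Sum>i<?q ^ (k + 1). \<psi> (u * (of_nat i)\<^sup>2 / ?p ^ (k + 2)) * (if ?q dvd i then of_nat ?q else 0))"
    by (simp only: sum_mixed_radix step sum_distrib_left[symmetric] inner)
  also have "\<dots> = (\<Sum>i<?q * ?q ^ k. \<psi> (u * (of_nat i)\<^sup>2 / ?p ^ (k + 2)) * (if ?q dvd i then of_nat ?q else 0))"
    by simp
  also have "\<dots> = (\<Sum>i<?q. if i = 0 then of_nat ?q * quad_sum u k else 0)"
    unfolding sum_mixed_radix
  proof (intro sum.cong refl)
    fix i assume i: "i \<in> {..<?q}"
    have dv: "?q dvd i + ?q * l \<longleftrightarrow> i = 0" for l using i by (auto simp: dvd_add_left_iff dest: dvd_imp_le)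
    have "\<psi> (u * (of_nat (?q * l))\<^sup>2 / ?p ^ (k + 2)) = \<psi> (u * (of_nat l)\<^sup>2 / ?p ^ k)" for l
      by (simp add: pq power2_eq_square field_simps)
    thus "(\<Sum>l<?q ^ k. \<psi> (u * (of_nat (i + ?q * l))\<^sup>2 / ?p ^ (k + 2)) * (if ?q dvd i + ?q * l then of_nat ?q else 0)) =
        (if i = 0 then of_nat ?q * quad_sum u k else 0)"
      by (simp only: dv) (simp add: quad_sum_def sum_distrib_left mult.commute)
  qed
  also have "\<dots> = of_nat ?q * quad_sum u k" by simp
  finally show ?thesis .
qed

text \<open>The factor p in the recursion is positive, so the phase depends on k only through its
  parity.\<close>

lemma sgn_quad_sum:
  assumes u: "u \<in> padic_units"
  shows "sgn (quad_sum u k) = (if even k then 1 else of_int (padic_legendre u) * sgn psi_gauss)"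
proof (induction k rule: less_induct)
  case (less k)
  consider "k = 0" | "k = 1" | l where "k = l + 2" by (metis One_nat_def add_2_eq_Suc' not0_implies_Suc)
  thus ?case
  proof cases
    case 1
    thus ?thesis by (simp add: quad_sum_0)
  next
    case 2
    have "sgn (of_int (padic_legendre u) :: complex) = of_int (padic_legendre u)"
      using u by (simp add: legendre_unit[OF odd_card])
    thus ?thesis using 2 quad_sum_1[OF u] by (simp add: sgn_mult)
  next
    case 3
    have "sgn (of_nat CARD('p) :: complex) = 1" using sgn_of_real[of "real CARD('p)", where 'a = complex] by simp
    thus ?thesis using less.IH[of l] unfolding 3 quad_sum_rec[OF u] by (simp add: sgn_mult)
  qed
qed

text \<open>The condition on k turns a (j / p^N)^2 into u j^2 / p^k with u the unit part of a. The
  summand then has period p^k in j, so the Riemann sums are constant for M \<ge> k.\<close>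

lemma ball_integral_quadratic:
  assumes a: "a \<noteq> 0" and N: "padic_ord a + int k = 2 * int N"
  shows "ball_integral N (\<lambda>x. \<psi> (a * x\<^sup>2)) =
    of_real (real CARD('p) ^ N / real CARD('p) ^ k) * quad_sum (unit_part a) k"
proof -
  let ?q = "CARD('p)" and ?u = "unit_part a"
  let ?p = "padic_p :: 'p padic"
  have pq: "(of_nat ?q :: 'p padic) = ?p" by (simp add: padic_p_def)
  have nu: "padic_norm ?u = 1" using unit_part_unit[OF a] by (simp add: padic_units_def)
  have arg: "a * (of_nat j / ?p ^ N)\<^sup>2 = ?u * (of_nat j)\<^sup>2 / ?p ^ k" for j
  proof -
    have "a * ?p ^ k = ?u * ?p powi (padic_ord a + int k)"
      by (subst unit_part_eq[of a]) (simp add: power_int_add)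
    also have "\<dots> = ?u * ?p ^ (2 * N)" unfolding N by (simp flip: power_int_of_nat)
    finally show ?thesis by (simp add: field_simps power_mult power2_eq_square)
  qed
  have per: "\<psi> (?u * (of_nat (i + ?q ^ k * l))\<^sup>2 / ?p ^ k) = \<psi> (?u * (of_nat i)\<^sup>2 / ?p ^ k)" for i l
  proof (rule psi_cong)
    have "?u * (of_nat (i + ?q ^ k * l))\<^sup>2 / ?p ^ k - ?u * (of_nat i)\<^sup>2 / ?p ^ k =
        ?u * of_nat (2 * i * l + ?q ^ k * l * l)"
      by (simp add: pq field_simps power2_eq_square)
    thus "padic_norm (?u * (of_nat (i + ?q ^ k * l))\<^sup>2 / ?p ^ k - ?u * (of_nat i)\<^sup>2 / ?p ^ k) \<le> 1"
      by (simp only: padic_norm_mult nu padic_norm_of_nat_le mult_1)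
  qed
  have "(\<Sum>j<?q ^ (N + M). \<psi> (a * (of_nat j / ?p ^ N)\<^sup>2)) / of_nat (?q ^ M) =
      of_real (real ?q ^ N / real ?q ^ k) * quad_sum ?u k" if M: "M \<ge> k" for M
  proof -
    have "?q ^ (N + M) = ?q ^ k * ?q ^ (N + M - k)" using M by (simp flip: power_add)
    hence "(\<Sum>j<?q ^ (N + M). \<psi> (a * (of_nat j / ?p ^ N)\<^sup>2)) = (\<Sum>i<?q ^ k. \<Sum>l<?q ^ (N + M - k). \<psi> (?u * (of_nat i)\<^sup>2 / ?p ^ k))"
      by (simp only: arg sum_mixed_radix per)
    also have "\<dots> = of_nat ?q ^ (N + M - k) * quad_sum ?u k"
      by (simp add: quad_sum_def sum_distrib_left)
    also have "(of_nat ?q ^ (N + M - k) :: complex) = of_nat ?q ^ (N + M) / of_nat ?q ^ k"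
      using M by (simp add: power_diff)
    finally show ?thesis by (simp add: power_add field_simps)
  qed
  hence "eventually (\<lambda>M. (\<Sum>j<?q ^ (N + M). \<psi> (a * (of_nat j / ?p ^ N)\<^sup>2)) / of_nat (?q ^ M) =
      of_real (real ?q ^ N / real ?q ^ k) * quad_sum ?u k) sequentially"
    by (auto simp: eventually_sequentially)
  thus ?thesis unfolding ball_integral_def by (intro limI tendsto_eventually)
qed

text \<open>For large N the phase is constant, because k = 2 N - ord a keeps the parity of ord a. So
  the limit is attained.\<close>

lemma weil_index_formula:
  assumes a: "a \<noteq> 0"
  shows "weil_index (\<lambda>x. \<psi> (a * x)) = (if even (padic_ord a) then 1 else of_int (unit_sign a) * sgn psi_gauss)"
proof -
  let ?L = "if even (padic_ord a) then 1 else of_int (unit_sign a) * sgn psi_gauss"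
  have "sgn (ball_integral N (\<lambda>x. \<psi> (a * x\<^sup>2))) = ?L" if N: "N \<ge> nat \<bar>padic_ord a\<bar>" for N
  proof -
    define k where "k = nat (2 * int N - padic_ord a)"
    have k: "padic_ord a + int k = 2 * int N" using N by (simp add: k_def)
    hence "even k \<longleftrightarrow> even (padic_ord a)" by presburger
    moreover have "sgn (of_real (real CARD('p) ^ N / real CARD('p) ^ k) :: complex) = 1"
      by (simp only: sgn_of_real) simp
    ultimately show ?thesis
      using ball_integral_quadratic[OF a k] sgn_quad_sum[OF unit_part_unit[OF a], of k]
      by (simp only: sgn_mult unit_sign_def mult_1)
  qed
  hence "eventually (\<lambda>N. sgn (ball_integral N (\<lambda>x. \<psi> (a * x\<^sup>2))) = ?L) sequentially"
    unfolding eventually_sequentially by blast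
  thus ?thesis unfolding weil_index_def by (intro limI tendsto_eventually)
qed

lemma psi_gauss_square: "psi_gauss\<^sup>2 = of_int (padic_legendre (-1 :: 'p padic)) * of_nat CARD('p)"
  unfolding psi_gauss_def by (rule gauss_sum_square[OF residue_character_psi odd_card])

lemma legendre_minus_1_cases: "padic_legendre (-1 :: 'p padic) = 1 \<or> padic_legendre (-1 :: 'p padic) = -1"
  using legendre_unit[OF odd_card, of "-1"] by (simp add: padic_units_def)

lemma norm_psi_gauss: "norm psi_gauss = sqrt (real CARD('p))"
proof -
  have "(norm psi_gauss)\<^sup>2 = norm (of_int (padic_legendre (-1 :: 'p padic)) * of_nat CARD('p) :: complex)"
    by (simp flip: psi_gauss_square add: norm_power)
  also have "\<dots> = real CARD('p)" using legendre_minus_1_cases by (auto simp: norm_mult)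
  finally show ?thesis by (metis norm_ge_zero real_sqrt_unique)
qed

lemma sgn_psi_gauss: "sgn psi_gauss * sgn psi_gauss = of_int (padic_legendre (-1 :: 'p padic))"
proof -
  have "sgn psi_gauss * sgn psi_gauss = psi_gauss\<^sup>2 / of_real ((norm psi_gauss)\<^sup>2)"
    by (simp add: sgn_eq power2_eq_square)
  also have "\<dots> = of_int (padic_legendre (-1 :: 'p padic))"
    unfolding norm_psi_gauss psi_gauss_square by simp
  finally show ?thesis .
qed

lemma weil_gamma_formula:
  assumes a: "a \<noteq> 0"
  shows "weil_gamma a \<psi> = (if even (padic_ord a) then 1 else of_int (unit_sign a) * sgn psi_gauss)"
  using weil_index_formula[OF a] weil_index_formula[of 1] by (simp add: weil_gamma_def)

text \<open>The Gauss sum of \<psi> has absolute value sqrt p, so its phase times sqrt p is the sum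
  itself.\<close>

lemma sqrt_p_star_eq: "sqrt_p_star \<psi> = psi_gauss"
  using norm_psi_gauss card_pos[where 'p = 'p]
  by (simp add: sqrt_p_star_def weil_gamma_formula unit_sign_def legendre_1[OF odd_card] sgn_eq)

text \<open>When both orders are odd, the squared phase of the Gauss sum is the Legendre symbol of
  -1, which is the extra factor of the Hilbert symbol in that case.\<close>

lemma weil_gamma_mult:
  assumes a: "a \<noteq> 0" and b: "b \<noteq> 0"
  shows "weil_gamma (a * b) \<psi> = weil_gamma a \<psi> * weil_gamma b \<psi> * of_int (hilbert_symbol a b)"
proof -
  have ab: "a * b \<noteq> 0" using a b by simp
  have m1: "unit_sign (-1 :: 'p padic) = padic_legendre (-1 :: 'p padic)"
    by (simp add: unit_sign_def padic_units_def)
  have sq: "of_int (unit_sign x) * (of_int (unit_sign x) * z) = (z :: complex)" if "x \<noteq> 0" for x :: "'p padic" and z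
    using unit_sign_cases[OF odd_card that] by auto
  have sq1: "sgn psi_gauss * (sgn psi_gauss * of_int (padic_legendre (-1 :: 'p padic))) = 1"
    using sgn_psi_gauss legendre_minus_1_cases by (auto simp flip: mult.assoc)
  show ?thesis
    unfolding weil_gamma_formula[OF ab] weil_gamma_formula[OF a] weil_gamma_formula[OF b]
      hilbert_formula[OF odd_card a b] padic_ord_mult[OF a b] unit_sign_mult[OF odd_card a b] m1
    by (cases "odd (padic_ord a)"; cases "odd (padic_ord b)") (simp_all add: sq[OF a] sq[OF b] sq1 mult_ac)
qed

end

section \<open>The function supported on one double coset\<close>

lemma mat2_nth [simp]:
  "mat2 a b c d $ 1 $ 1 = a" "mat2 a b c d $ 1 $ 2 = b" "mat2 a b c d $ 2 $ 1 = c" "mat2 a b c d $ 2 $ 2 = d"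
  by (simp_all add: mat2_def)

lemma matrix_mult_nth:
  fixes A B :: "'p::prime_card matr"
  shows "(A ** B) $ i $ j = A $ i $ 1 * B $ 1 $ j + A $ i $ 2 * B $ 2 $ j"
  by (simp add: matrix_matrix_mult_def sum_2)

lemma matr_eqI:
  fixes A B :: "'p::prime_card matr"
  assumes "A $ 1 $ 1 = B $ 1 $ 1" "A $ 1 $ 2 = B $ 1 $ 2" "A $ 2 $ 1 = B $ 2 $ 1" "A $ 2 $ 2 = B $ 2 $ 2"
  shows "A = B"
  using assms by (simp add: vec_eq_iff forall_2)

lemma SL2_iff: "g \<in> SL2 \<longleftrightarrow> g $ 1 $ 1 * g $ 2 $ 2 - g $ 1 $ 2 * g $ 2 $ 1 = 1"
  by (simp add: SL2_def det_2)

lemma SL2_mult: "g \<in> SL2 \<Longrightarrow> h \<in> SL2 \<Longrightarrow> g ** h \<in> SL2"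
  by (simp add: SL2_def det_mul)

lemma s_p_cases: "s_p g = 1 \<or> s_p g = -1"
  using hilbert_cases by (auto simp: s_p_def)

lemma hilbert_self_inverse [simp]:
  "hilbert_symbol a b * hilbert_symbol a b = 1" "hilbert_symbol a b * (hilbert_symbol a b * k) = k"
  for a b :: "'p::prime_card padic"
  using hilbert_cases[of a b] by auto

lemma cocycle_cases: "cocycle g h = 1 \<or> cocycle g h = -1"
  unfolding cocycle_def
  using s_p_cases[of g] s_p_cases[of h] s_p_cases[of "g ** h"]
    hilbert_cases[of "tau (g ** h) * tau g" "tau (g ** h) * tau h"]
  by auto

lemma cover_group_iff: "x \<in> cover_group \<longleftrightarrow> fst x \<in> SL2 \<and> (snd x = 1 \<or> snd x = -1)"
  by (cases x) (auto simp: cover_group_def full_preimage_def)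

lemma cover_group_mult: "x \<in> cover_group \<Longrightarrow> y \<in> cover_group \<Longrightarrow> x \<odot> y \<in> cover_group"
  using cocycle_cases[of "fst x" "fst y"]
  by (auto simp: cover_group_iff cover_mult_def SL2_mult)

lemma K0_iff:
  "k \<in> K0 m \<longleftrightarrow> k $ 1 $ 1 * k $ 2 $ 2 - k $ 1 $ 2 * k $ 2 $ 1 = 1 \<and> k $ 1 $ 1 \<in> padic_ints \<and>
     k $ 1 $ 2 \<in> padic_ints \<and> k $ 2 $ 2 \<in> padic_ints \<and> k $ 2 $ 1 \<in> padic_ideal m"
  using padic_ideal_antimono[of "k $ 2 $ 1" m 0]
  by (auto simp: K0_def SL2_ints_def SL2_iff forall_2 padic_ideal_0_iff)

lemma K0_preimage_cover: "k \<in> full_preimage (K0 m) \<Longrightarrow> k \<in> cover_group"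
  by (auto simp: full_preimage_def cover_group_def K0_def SL2_ints_def)

lemma borel_cover: "b \<in> cover_borel \<Longrightarrow> b \<in> cover_group"
  by (auto simp: full_preimage_def cover_group_def cover_borel_def)

section \<open>Principal units and their square roots\<close>

lemma unit_filtration_iff:
  "m > 0 \<Longrightarrow> x \<in> unit_filtration m \<longleftrightarrow> x - 1 \<in> padic_ideal m"
  for x :: "'p::prime_card padic"
  using unit_add_ideal[of 1 "x - 1" m] by (auto simp: unit_filtration_def)

lemma unit_filtration_unit: "x \<in> unit_filtration m \<Longrightarrow> x \<in> padic_units"
  by (simp add: unit_filtration_def)

lemma unit_filtration_mult:
  fixes x y :: "'p::prime_card padic"
  assumes "x \<in> unit_filtration m" "y \<in> unit_filtration m" "m > 0"
  shows "x * y \<in> unit_filtration m"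
proof -
  have "y \<in> padic_ints" using assms(2) unit_filtration_unit padic_units_ints by blast
  hence "(x - 1) * y + (y - 1) \<in> padic_ideal m"
    using assms by (intro padic_ideal_add padic_ideal_mult) (auto simp: unit_filtration_iff)
  thus ?thesis using assms(3) by (simp add: unit_filtration_iff algebra_simps)
qed

lemma unit_filtration_inverse:
  fixes x :: "'p::prime_card padic"
  assumes "x \<in> unit_filtration m" "m > 0"
  shows "inverse x \<in> unit_filtration m"
proof -
  have x: "x \<in> padic_units" using assms unit_filtration_unit by blast
  have "inverse x - 1 = (x - 1) * (- inverse x)" using unit_nonzero[OF x] by (simp add: field_simps)
  also have "\<dots> \<in> padic_ideal m"
    using assms x by (intro padic_ideal_mult padic_units_ints padic_units_minus padic_units_inverse)
      (auto simp: unit_filtration_iff)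
  finally show ?thesis using assms by (simp add: unit_filtration_iff)
qed

text \<open>Hensel gives a root y congruent to 1 modulo p. In x - 1 = (y - 1)(2 + (y - 1)) the
  second factor is a unit, so y is as close to 1 as x is.\<close>

lemma unit_filtration_sqrt:
  fixes x :: "'p::prime_card padic"
  assumes odd: "odd CARD('p)" and x: "x \<in> unit_filtration m" and m: "m > 0"
  shows "\<exists>y\<in>unit_filtration m. y\<^sup>2 = x"
proof -
  have x1: "x - 1 \<in> padic_ideal m" using x m by (simp add: unit_filtration_iff)
  hence "padic_norm (x - 1\<^sup>2) < 1" using padic_ideal_antimono[of "x - 1" m 1] m
    by (simp add: padic_ideal_1_iff[symmetric])
  then obtain y where y: "y\<^sup>2 = x" "padic_norm (y - 1) < 1"
    using hensel_square_root[OF odd padic_units_1] by blast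
  have "padic_norm (2 + (y - 1)) = 1"
    using padic_norm_add_eq[of "y - 1" 2] y(2) padic_norm_2[OF odd] by simp
  moreover have "x - 1 = (y - 1) * (2 + (y - 1))" by (simp add: y(1)[symmetric] power2_eq_square algebra_simps)
  ultimately have "padic_norm (y - 1) = padic_norm (x - 1)" by (simp only: padic_norm_mult mult_1_right)
  hence "y - 1 \<in> padic_ideal m" using x1 by (simp add: padic_ideal_iff)
  thus ?thesis using y m by (auto simp: unit_filtration_iff)
qed

text \<open>The point \<open>g\<close> lies in \<open>B y(Q) K\<^sub>2\<^sub>n\<close>, with \<open>Q = \<kappa> p\<^sup>n\<close>, iff its bottom row is proportional to \<open>(Q w\<^sup>2, 1)\<close>
  for a unit \<open>w\<close>; then \<open>g\<close> is \<open>h(t) y(Q) h(w)\<close> with \<open>t = (d w)\<^sup>-\<^sup>1\<close>, up to a left factor \<open>x(s)\<close>.\<close>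

definition cell_param :: "'p::prime_card padic \<Rightarrow> 'p matr \<Rightarrow> 'p padic \<Rightarrow> bool" where
  "cell_param Q g w \<longleftrightarrow> w \<in> padic_units \<and> g $ 2 $ 2 \<noteq> 0 \<and> g $ 2 $ 1 = g $ 2 $ 2 * Q * w\<^sup>2"

text \<open>The Hilbert symbols are the cocycle of the product \<open>(h(t), 1) (y(Q), 1) (h(w), 1)\<close>.\<close>

definition cell_value :: "('p::prime_card padic \<Rightarrow> complex) \<Rightarrow> ('p padic \<Rightarrow> complex) \<Rightarrow> ('p padic \<Rightarrow> complex) \<Rightarrow>
    'p padic \<Rightarrow> 'p matr \<Rightarrow> 'p padic \<Rightarrow> complex" where
  "cell_value \<mu> \<psi> \<eta> Q g w = (let t = inverse (g $ 2 $ 2 * w) in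
     of_int (hilbert_symbol (Q * w) t * hilbert_symbol w Q * s_p g) *
     of_real (padic_norm t) * \<mu> t * inverse (weil_gamma t \<psi>) * \<eta> w)"

text \<open>The chosen w is harmless by \<open>cell_value_unique\<close>. The restriction makes the
  function \<open>extensional\<close>, as membership in \<open>principal_series\<close>
  demands.\<close>

definition cell_function :: "('p::prime_card padic \<Rightarrow> complex) \<Rightarrow> ('p padic \<Rightarrow> complex) \<Rightarrow> ('p padic \<Rightarrow> complex) \<Rightarrow>
    'p padic \<Rightarrow> 'p cover \<Rightarrow> complex" where
  "cell_function \<mu> \<psi> \<eta> Q = restrict (\<lambda>x. if \<exists>w. cell_param Q (fst x) w
     then of_int (snd x) * cell_value \<mu> \<psi> \<eta> Q (fst x) (SOME w. cell_param Q (fst x) w) else 0) cover_group"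

context
  fixes \<mu> \<psi> \<eta> :: "'p::prime_card padic \<Rightarrow> complex" and n :: nat and \<kappa> Q :: "'p padic"
  assumes odd_card: "odd CARD('p)" and psi: "additive_character \<psi>" "conductor_zero \<psi>"
    and mu: "mult_character \<mu>" and mu_cond: "\<forall>u\<in>unit_filtration n. \<mu> u = 1" and n: "n > 0"
    and eta: "(\<forall>u\<in>padic_units. \<eta> u = 1) \<or> (\<forall>u\<in>padic_units. \<eta> u = of_int (padic_legendre u))"
    and mu_eta: "\<mu> (-1) = \<eta> (-1)" and kappa: "\<kappa> \<in> padic_units" and Q_def: "Q = \<kappa> * padic_p ^ n"
begin

lemma minus_1_unit: "(-1 :: 'p padic) \<in> padic_units"
  by (simp add: padic_units_def)

lemma Q_nonzero: "Q \<noteq> 0"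
  using unit_nonzero[OF kappa] by (simp add: Q_def)

lemma Q_ideal: "Q \<in> padic_ideal n"
  using kappa by (simp add: Q_def padic_ideal_iff padic_norm_mult padic_norm_power padic_norm_p padic_units_def)

lemma eta_mult: "u \<in> padic_units \<Longrightarrow> v \<in> padic_units \<Longrightarrow> \<eta> (u * v) = \<eta> u * \<eta> v"
  using eta by (auto simp: padic_units_mult legendre_mult[OF odd_card])

lemma eta_square: "u \<in> padic_units \<Longrightarrow> \<eta> u * \<eta> u = 1"
  using eta legendre_square[OF odd_card] by (auto simp flip: of_int_mult)

text \<open>Principal units are squares of units, and \<eta> is quadratic.\<close>

lemma eta_filtration: "u \<in> unit_filtration m \<Longrightarrow> m > 0 \<Longrightarrow> \<eta> u = 1"
proof -
  assume u: "u \<in> unit_filtration m" "m > 0"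
  obtain y where y: "y \<in> padic_units" "y\<^sup>2 = u"
    using unit_filtration_sqrt[OF odd_card u] unit_filtration_unit by blast
  thus ?thesis using eta_mult[OF y(1) y(1)] eta_square[OF y(1)] by (simp add: power2_eq_square)
qed

lemma mu_mult: "x \<noteq> 0 \<Longrightarrow> y \<noteq> 0 \<Longrightarrow> \<mu> (x * y) = \<mu> x * \<mu> y"
  using mu by (simp add: mult_character_def)

lemma weil_gamma_mult_square:
  assumes "x \<noteq> 0" "y \<noteq> 0"
  shows "weil_gamma (x * y\<^sup>2) \<psi> = weil_gamma x \<psi>"
proof -
  have "even (padic_ord (y\<^sup>2))" using assms by (simp add: power2_eq_square padic_ord_mult)
  hence "weil_gamma (y\<^sup>2) \<psi> = 1" using weil_gamma_formula[OF odd_card psi, of "y\<^sup>2"] assms by simp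
  thus ?thesis using weil_gamma_mult[OF odd_card psi assms(1), of "y\<^sup>2"] assms hilbert_square[of y x]
    by (simp add: hilbert_commute)
qed

lemmas hilbert_left = hilbert_mult_left[OF odd_card]
lemmas hilbert_right = hilbert_mult_right[OF odd_card]

lemma hilbert_inverse_right: "y \<noteq> 0 \<Longrightarrow> hilbert_symbol x (inverse y) = hilbert_symbol x (y :: 'p padic)"
  using hilbert_mult_square_right[of "inverse y" x y] by (simp add: power2_eq_square field_simps)

text \<open>Only w and -w compete, since w^2 is determined. Passing to -w replaces t by -t: the
  first symbol gains (-1, t)(Q, -1), the second gains (Q, -1), the Weil factor gains (-1, t), and
  \<mu>(-1) \<eta>(-1) = 1.\<close>

lemma cell_value_unique:
  assumes "cell_param Q g w" "cell_param Q g v"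
  shows "cell_value \<mu> \<psi> \<eta> Q g v = cell_value \<mu> \<psi> \<eta> Q g w"
proof -
  let ?d = "g $ 2 $ 2"
  have w: "w \<in> padic_units" and d: "?d \<noteq> 0" using assms by (auto simp: cell_param_def)
  have w0: "w \<noteq> 0" using w by (rule unit_nonzero)
  have "v\<^sup>2 = w\<^sup>2" using assms Q_nonzero by (auto simp: cell_param_def)
  hence "v = w \<or> v = - w" by (simp add: power2_eq_iff)
  moreover have "cell_value \<mu> \<psi> \<eta> Q g (- w) = cell_value \<mu> \<psi> \<eta> Q g w"
  proof -
    define t where "t = inverse (?d * w)"
    have t0: "t \<noteq> 0" using d w0 by (simp add: t_def)
    have t': "inverse (?d * (- w)) = -1 * t" by (simp add: t_def)
    have H11: "hilbert_symbol (-1) (-1 :: 'p padic) = 1" by (rule hilbert_units[OF odd_card minus_1_unit minus_1_unit])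
    have H1w: "hilbert_symbol w (-1) = 1" by (rule hilbert_units[OF odd_card w minus_1_unit])
    have "hilbert_symbol (-1 * (Q * w)) (-1 * t) = hilbert_symbol (-1) t * hilbert_symbol Q (-1) * hilbert_symbol (Q * w) t"
      using hilbert_left[of "-1" "Q * w" "-1 * t"] hilbert_right[of "-1" "-1" t] hilbert_right[of "Q * w" "-1" t]
        hilbert_left[of Q w "-1"] t0 w0 Q_nonzero H11 H1w by simp
    moreover have "hilbert_symbol (-1 * w) Q = hilbert_symbol Q (-1) * hilbert_symbol w Q"
      using w0 Q_nonzero hilbert_left[of "-1" w Q] by (simp add: hilbert_commute[of Q])
    moreover have "weil_gamma (-1 * t) \<psi> = weil_gamma t \<psi> * of_int (hilbert_symbol (-1) t)"
      using weil_gamma_mult[OF odd_card psi, of "-1" t] t0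
        weil_gamma_formula[OF odd_card psi, of "-1"] minus_1_unit by simp
    moreover have "\<mu> (-1 * t) * \<eta> (-1 * w) = \<mu> t * \<eta> w"
      using mu_mult[of "-1" t] eta_mult[OF minus_1_unit w] t0 mu_eta eta_square[OF minus_1_unit] by simp
    ultimately show ?thesis
      unfolding cell_value_def Let_def t' t_def[symmetric]
      using hilbert_cases[of "-1" t] hilbert_cases[of Q "-1"]
      by auto
  qed
  ultimately show ?thesis by auto
qed

lemma cell_function_eq:
  assumes "x \<in> cover_group" "cell_param Q (fst x) w"
  shows "cell_function \<mu> \<psi> \<eta> Q x = of_int (snd x) * cell_value \<mu> \<psi> \<eta> Q (fst x) w"
proof -
  have "cell_param Q (fst x) (SOME w. cell_param Q (fst x) w)" using assms(2) by (rule someI)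
  thus ?thesis using assms cell_value_unique[OF assms(2)] unfolding cell_function_def restrict_apply
    by (metis (no_types, lifting))
qed

lemma cell_function_0: "x \<in> cover_group \<Longrightarrow> \<nexists>w. cell_param Q (fst x) w \<Longrightarrow> cell_function \<mu> \<psi> \<eta> Q x = 0"
  by (auto simp: cell_function_def)

text \<open>Left translation keeps w and multiplies t by the diagonal entry a. Up to
  \<open>s_p\<close> factors the cocycle is (Q w, a)(a, t): the first symbol accounts for the change
  of (Q w, t), the second for the failure of the Weil factor to be multiplicative.\<close>

lemma cell_value_borel:
  assumes b: "b \<in> SL2" "b $ 2 $ 1 = 0" and g: "cell_param Q g w"
  shows "cell_param Q (b ** g) w"
    "of_int (cocycle b g) * cell_value \<mu> \<psi> \<eta> Q (b ** g) w =
      of_real (padic_norm (b $ 1 $ 1)) * \<mu> (b $ 1 $ 1) * inverse (weil_gamma (b $ 1 $ 1) \<psi>) * cell_value \<mu> \<psi> \<eta> Q g w"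
proof -
  define a where "a = b $ 1 $ 1"
  define c where "c = g $ 2 $ 1"
  define d where "d = g $ 2 $ 2"
  define t where "t = inverse (d * w)"
  have "a * b $ 2 $ 2 = 1" using b by (simp add: SL2_iff a_def)
  hence a0: "a \<noteq> 0" and b22: "b $ 2 $ 2 = inverse a" by (auto simp: inverse_unique)
  have w: "w \<in> padic_units" and d0: "d \<noteq> 0" and c: "c = d * Q * w\<^sup>2"
    using g by (auto simp: cell_param_def c_def d_def)
  have w0: "w \<noteq> 0" using w by (rule unit_nonzero)
  have c0: "c \<noteq> 0" using c d0 w0 Q_nonzero by simp
  have t0: "t \<noteq> 0" using d0 w0 by (simp add: t_def)
  have bg: "(b ** g) $ 2 $ 1 = inverse a * c" "(b ** g) $ 2 $ 2 = inverse a * d"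
    using b by (simp_all add: matrix_mult_nth b22 c_def d_def)
  show "cell_param Q (b ** g) w"
    using w d0 a0 c by (simp add: cell_param_def bg)
  have t': "inverse ((b ** g) $ 2 $ 2 * w) = a * t" using a0 by (simp add: bg t_def)
  \<comment> \<open>Expressing c through t instead of d shows that, up to squares, it is the product
    Q w t.\<close>
  have ct: "c = Q * w * inverse t" using d0 w0 by (simp add: c t_def power2_eq_square)
  have "hilbert_symbol (inverse a * c * inverse a) (inverse a * c * c) = hilbert_symbol (c * (inverse a)\<^sup>2) (a * (c * inverse a)\<^sup>2)"
    using a0 by (intro arg_cong2[where f = hilbert_symbol]) (simp_all add: power2_eq_square field_simps)
  also have "\<dots> = hilbert_symbol c a"
    using a0 c0 by (simp only: hilbert_mult_square hilbert_mult_square_right mult_eq_0_iff inverse_nonzero_iff_nonzero simp_thms)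
  also have "\<dots> = hilbert_symbol (Q * w) a * hilbert_symbol a t"
    using a0 t0 w0 Q_nonzero unfolding ct
    by (subst hilbert_left) (auto simp: hilbert_commute[of "inverse t"] hilbert_inverse_right)
  finally have coc: "cocycle b g = hilbert_symbol (Q * w) a * hilbert_symbol a t * s_p g * s_p (b ** g)"
    using b c0 a0 by (simp add: cocycle_def tau_def bg b22 s_p_def[of b] flip: c_def)
  have "hilbert_symbol (Q * w) (a * t) = hilbert_symbol (Q * w) a * hilbert_symbol (Q * w) t"
    using a0 t0 w0 Q_nonzero by (intro hilbert_right) auto
  moreover have "weil_gamma (a * t) \<psi> = weil_gamma a \<psi> * weil_gamma t \<psi> * of_int (hilbert_symbol a t)"
    by (rule weil_gamma_mult[OF odd_card psi a0 t0])
  ultimately show "of_int (cocycle b g) * cell_value \<mu> \<psi> \<eta> Q (b ** g) w =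
      of_real (padic_norm (b $ 1 $ 1)) * \<mu> (b $ 1 $ 1) * inverse (weil_gamma (b $ 1 $ 1) \<psi>) * cell_value \<mu> \<psi> \<eta> Q g w"
    unfolding cell_value_def Let_def t' coc a_def[symmetric] d_def[symmetric] t_def[symmetric]
    using hilbert_cases[of "Q * w" a] hilbert_cases[of a t] s_p_cases[of "b ** g"]
    by (auto simp: padic_norm_mult mu_mult[OF a0 t0] mult_ac)
qed

lemma K0_diag_units:
  fixes k :: "'p matr"
  assumes k: "k \<in> K0 (2 * n)"
  shows "k $ 1 $ 1 \<in> padic_units" "k $ 2 $ 2 \<in> padic_units" "k $ 1 $ 1 * k $ 2 $ 2 \<in> unit_filtration n"
proof -
  have eq: "k $ 1 $ 1 * k $ 2 $ 2 - 1 = k $ 2 $ 1 * k $ 1 $ 2" using k by (simp add: K0_iff algebra_simps)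
  have "k $ 2 $ 1 * k $ 1 $ 2 \<in> padic_ideal (2 * n)" using k by (auto simp: K0_iff intro: padic_ideal_mult)
  hence "k $ 1 $ 1 * k $ 2 $ 2 - 1 \<in> padic_ideal n" unfolding eq using padic_ideal_antimono by fastforce
  thus 1: "k $ 1 $ 1 * k $ 2 $ 2 \<in> unit_filtration n" using n by (simp add: unit_filtration_iff)
  have "padic_norm (k $ 1 $ 1) * padic_norm (k $ 2 $ 2) = 1"
    using unit_filtration_unit[OF 1] by (simp add: padic_units_def padic_norm_mult)
  moreover have "padic_norm (k $ 1 $ 1) \<le> 1" "padic_norm (k $ 2 $ 2) \<le> 1" using k by (auto simp: K0_iff padic_ints_def)
  ultimately have "padic_norm (k $ 1 $ 1) = 1 \<and> padic_norm (k $ 2 $ 2) = 1"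
    using mult_left_le_one_le[of "padic_norm (k $ 1 $ 1)" "padic_norm (k $ 2 $ 2)"]
      mult_left_le_one_le[of "padic_norm (k $ 2 $ 2)" "padic_norm (k $ 1 $ 1)"]
    by (simp add: mult.commute)
  thus "k $ 1 $ 1 \<in> padic_units" "k $ 2 $ 2 \<in> padic_units" by (simp_all add: padic_units_def)
qed

text \<open>This identity expresses that \<open>s\<^sub>p\<close> splits the cocycle over \<open>SL\<^sub>2(\<int>\<^sub>p)\<close>.\<close>

lemma hilbert_tau_s_p:
  fixes k :: "'p matr"
  assumes k: "k \<in> K0 (2 * n)"
  shows "hilbert_symbol (k $ 1 $ 1) (tau k) * s_p k = 1"
proof -
  note u = K0_diag_units[OF k]
  have nz: "k $ 1 $ 1 \<noteq> 0" "k $ 2 $ 2 \<noteq> 0" using u unit_nonzero by auto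
  show ?thesis
  proof (cases "k $ 2 $ 1 = 0")
    case True
    thus ?thesis using hilbert_units[OF odd_card u(1,2)] by (simp add: tau_def s_p_def)
  next
    case False
    have "square_mod_p (k $ 1 $ 1 * k $ 2 $ 2)"
      using unit_filtration_sqrt[OF odd_card u(3) n] unit_square_mod_p_iff[OF odd_card] unit_filtration_unit u(3) by blast
    hence "padic_legendre (k $ 1 $ 1) * padic_legendre (k $ 2 $ 2) = 1"
      using legendre_mult[OF odd_card u(1,2)] legendre_unit[OF odd_card] u padic_units_mult by metis
    thus ?thesis using False nz u
      by (simp add: tau_def s_p_def hilbert_formula[OF odd_card] unit_sign_def)
  qed
qed

text \<open>The bottom row becomes (d Q w^2 ka E1, d kd E2) with principal units E1 and E2. So w is
  multiplied by ka up to a principal unit, and t changes by a principal unit only. The value gains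
  \<eta>(ka) = \<eta>(kd) and the symbols (ka, t)(ka, Q), which the cocycle cancels.\<close>

lemma cell_value_K0:
  assumes k: "k \<in> K0 (2 * n)" and g: "cell_param Q g w"
  shows "\<exists>v. cell_param Q (g ** k) v \<and>
    of_int (cocycle g k) * cell_value \<mu> \<psi> \<eta> Q (g ** k) v = cell_value \<mu> \<psi> \<eta> Q g w * \<eta> (k $ 2 $ 2)"
proof -
  define c where "c = g $ 2 $ 1"
  define d where "d = g $ 2 $ 2"
  define ka where "ka = k $ 1 $ 1"
  define kb where "kb = k $ 1 $ 2"
  define kc where "kc = k $ 2 $ 1"
  define kd where "kd = k $ 2 $ 2"
  define t where "t = inverse (d * w)"
  have w: "w \<in> padic_units" and d0: "d \<noteq> 0" and c: "c = d * Q * w\<^sup>2"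
    using g by (auto simp: cell_param_def c_def d_def)
  have w0: "w \<noteq> 0" using w by (rule unit_nonzero)
  have c0: "c \<noteq> 0" using c d0 w0 Q_nonzero by simp
  have t0: "t \<noteq> 0" using d0 w0 by (simp add: t_def)
  have ka: "ka \<in> padic_units" and kd: "kd \<in> padic_units" and akd: "ka * kd \<in> unit_filtration n"
    using K0_diag_units[OF k] by (simp_all add: ka_def kd_def)
  have ka0: "ka \<noteq> 0" and kd0: "kd \<noteq> 0" using ka kd unit_nonzero by auto
  have kb: "kb \<in> padic_ints" and kc: "kc \<in> padic_ideal (2 * n)" using k by (simp_all add: K0_iff kb_def kc_def)
  \<comment> \<open>The level 2n enters here: kc lies in p^(2n) Z_p and Q has order n, so the
    quotient still lies in p^n Z_p.\<close>
  define E1 where "E1 = 1 + kc / (Q * w\<^sup>2 * ka)"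
  define E2 where "E2 = 1 + Q * w\<^sup>2 * kb / kd"
  have "padic_norm (kc / (Q * w\<^sup>2 * ka)) = padic_norm kc / inverse (real CARD('p)) ^ n"
    using w ka kappa by (simp add: Q_def padic_norm_divide padic_norm_mult padic_norm_power padic_norm_p padic_units_def)
  also have "\<dots> \<le> inverse (real CARD('p)) ^ n"
    using kc by (subst pos_divide_le_eq) (simp_all add: padic_ideal_iff mult_2 power_add)
  finally have E1: "E1 \<in> unit_filtration n" using n by (simp add: E1_def unit_filtration_iff padic_ideal_iff)
  have "Q * (w\<^sup>2 * kb / kd) \<in> padic_ideal n"
    using w kd kb Q_ideal by (intro padic_ideal_mult)
      (auto simp: padic_ints_def padic_units_def padic_norm_divide padic_norm_mult padic_norm_power)
  hence E2: "E2 \<in> unit_filtration n" using n by (simp add: E2_def unit_filtration_iff mult.assoc)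
  have E20: "E2 \<noteq> 0" using unit_filtration_unit[OF E2] unit_nonzero by blast
  \<comment> \<open>The unit r is dictated by the requirement that the ratio of the new bottom row
    be Q v^2 for v = w ka r.\<close>
  have "E1 * inverse (E2 * (ka * kd)) \<in> unit_filtration n"
    by (intro unit_filtration_mult unit_filtration_inverse E1 E2 akd n)
  then obtain r where r: "r \<in> unit_filtration n" "r\<^sup>2 = E1 * inverse (E2 * (ka * kd))"
    using unit_filtration_sqrt[OF odd_card _ n] by blast
  have ru: "r \<in> padic_units" using r unit_filtration_unit by blast
  have r0: "r \<noteq> 0" using ru by (rule unit_nonzero)
  obtain e where e: "e \<in> unit_filtration n" "e\<^sup>2 = E1" using unit_filtration_sqrt[OF odd_card E1 n] by blast
  have e0: "e \<noteq> 0" using e unit_filtration_unit unit_nonzero by blast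
  \<comment> \<open>F is the factor by which t changes. It is trivial under \<mu> by the conductor,
    and as a square f^2 it drops out of symbols and Weil factors.\<close>
  define F where "F = inverse (ka * kd * E2 * r)"
  have F: "F \<in> unit_filtration n" unfolding F_def
    by (intro unit_filtration_mult unit_filtration_inverse r E2 akd n)
  obtain f where f: "f \<in> unit_filtration n" "f\<^sup>2 = F" using unit_filtration_sqrt[OF odd_card F n] by blast
  have f0: "f \<noteq> 0" using f unit_filtration_unit unit_nonzero by blast
  obtain q where q: "q \<in> unit_filtration n" "q\<^sup>2 = r" using unit_filtration_sqrt[OF odd_card r(1) n] by blast
  have q0: "q \<noteq> 0" using q unit_filtration_unit unit_nonzero by blast
  define v where "v = w * ka * r"
  have v: "v \<in> padic_units" using w ka ru by (simp add: v_def padic_units_mult)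
  have gk21: "(g ** k) $ 2 $ 1 = d * Q * w\<^sup>2 * ka * E1"
    using ka0 w0 Q_nonzero
    by (simp add: matrix_mult_nth c_def[symmetric] d_def[symmetric] ka_def[symmetric] kc_def[symmetric] c E1_def field_simps)
  have gk22: "(g ** k) $ 2 $ 2 = d * kd * E2"
    using kd0
    by (simp add: matrix_mult_nth c_def[symmetric] d_def[symmetric] kb_def[symmetric] kd_def[symmetric] c E2_def field_simps)
  have E1r: "E1 = r\<^sup>2 * E2 * ka * kd" using r(2) E20 ka0 kd0 by (simp add: field_simps)
  have param: "cell_param Q (g ** k) v"
    unfolding cell_param_def gk21 gk22 using v d0 kd0 E20
    by (simp add: E1r v_def power2_eq_square mult_ac)
  have t': "inverse ((g ** k) $ 2 $ 2 * v) = t * f\<^sup>2"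
    using d0 kd0 E20 w0 ka0 r0 by (simp add: gk22 f(2) F_def v_def t_def field_simps)
  have nf: "padic_norm (t * f\<^sup>2) = padic_norm t"
    using unit_filtration_unit[OF f(1)] by (simp add: padic_norm_mult padic_norm_power padic_units_def)
  have F0: "F \<noteq> 0" using unit_filtration_unit[OF F] unit_nonzero by blast
  have muf: "\<mu> (t * f\<^sup>2) = \<mu> t" using mu_mult[OF t0 F0] mu_cond F by (simp add: f(2))
  have etav: "\<eta> v = \<eta> w * \<eta> kd"
  proof -
    have "\<eta> (ka * kd) = 1" using eta_filtration[OF akd n] .
    hence "\<eta> ka = \<eta> kd" using eta_mult[OF ka kd] eta_square[OF kd] by (metis mult.assoc mult.right_neutral mult_1)
    moreover have "\<eta> r = 1" using eta_filtration[OF r(1) n] .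
    ultimately show ?thesis using eta_mult[OF padic_units_mult[OF w ka] ru] eta_mult[OF w ka] by (simp add: v_def)
  qed
  let ?H = "hilbert_symbol"
  have tk: "tau k \<noteq> 0" using kd0 by (simp add: tau_def kd_def)
  have gk0: "(g ** k) $ 2 $ 1 \<noteq> 0" using gk21 d0 Q_nonzero w0 ka0 e0 e(2) by auto
  \<comment> \<open>The right-hand side displays square classes: ka in the first argument and Q w t
    \<open>tau k\<close> / ka in the second. The bulky square is (e ka / t)^2.\<close>
  have "?H (tau (g ** k) * tau g) (tau (g ** k) * tau k) =
      ?H (ka * (d * Q * w\<^sup>2 * e)\<^sup>2) (Q * w * t * (e * ka * inverse (ka * t) * ka)\<^sup>2 * inverse ka * tau k)"
  proof (rule arg_cong2[where f = hilbert_symbol])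
    show "tau (g ** k) * tau g = ka * (d * Q * w\<^sup>2 * e)\<^sup>2"
      using gk0 c0 by (simp add: tau_def gk21 c_def[symmetric] c e(2)[symmetric] power2_eq_square mult_ac)
    show "tau (g ** k) * tau k = Q * w * t * (e * ka * inverse (ka * t) * ka)\<^sup>2 * inverse ka * tau k"
      using gk0 ka0 t0 d0 w0 by (simp add: tau_def[of "g ** k"] gk21 e(2)[symmetric] t_def power2_eq_square field_simps)
  qed
  also have "\<dots> = ?H ka (Q * w * t * inverse ka * tau k * (e * ka * inverse (ka * t) * ka)\<^sup>2)"
    using d0 Q_nonzero w0 e0 by (subst hilbert_mult_square) (simp_all add: mult_ac)
  also have "\<dots> = ?H ka (Q * w * t * inverse ka * tau k)"
    using e0 ka0 t0 by (intro hilbert_mult_square_right) simp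
  also have "\<dots> = ?H ka Q * ?H ka w * ?H ka t * ?H ka ka * ?H ka (tau k)"
    using Q_nonzero w0 t0 ka0 tk by (simp add: hilbert_right hilbert_inverse_right)
  also have "\<dots> = ?H ka Q * ?H ka t * ?H ka (tau k)"
    by (simp add: hilbert_units[OF odd_card ka w] hilbert_units[OF odd_card ka ka])
  finally have "cocycle g k = ?H ka Q * ?H ka t * (?H ka (tau k) * s_p k) * s_p g * s_p (g ** k)"
    by (simp add: cocycle_def mult_ac)
  hence coc: "cocycle g k = ?H ka Q * ?H ka t * s_p g * s_p (g ** k)"
    using hilbert_tau_s_p[OF k] by (simp add: ka_def)
  have H1: "?H (Q * v) (t * f\<^sup>2) = ?H (Q * w) t * ?H ka t"
  proof -
    have "?H (Q * v) (t * f\<^sup>2) = ?H (Q * w * ka * q\<^sup>2) t"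
      using hilbert_mult_square_right[OF f0] by (simp add: v_def q(2) mult_ac)
    also have "\<dots> = ?H (Q * w * ka) t" by (rule hilbert_mult_square[OF q0])
    also have "\<dots> = ?H (Q * w) t * ?H ka t" using Q_nonzero w0 ka0 t0 by (intro hilbert_left) auto
    finally show ?thesis .
  qed
  have H2: "?H v Q = ?H w Q * ?H ka Q"
    using hilbert_mult_square[OF q0, of "w * ka" Q] hilbert_left[OF w0 ka0 Q_nonzero] by (simp add: v_def q(2))
  have "of_int (cocycle g k) * cell_value \<mu> \<psi> \<eta> Q (g ** k) v = cell_value \<mu> \<psi> \<eta> Q g w * \<eta> kd"
    unfolding cell_value_def Let_def t' H1 H2 coc nf muf etav weil_gamma_mult_square[OF t0 f0]
      d_def[symmetric] t_def[symmetric]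
    using hilbert_cases[of ka Q] hilbert_cases[of ka t] s_p_cases[of "g ** k"]
    by (auto simp: mult_ac)
  thus ?thesis using param by (auto simp: kd_def)
qed

lemma cell_param_borel_iff:
  assumes b: "b \<in> SL2" "b $ 2 $ 1 = 0"
  shows "cell_param Q (b ** g) w \<longleftrightarrow> cell_param Q g w"
proof -
  have "b $ 2 $ 2 \<noteq> 0" using b by (auto simp: SL2_iff)
  thus ?thesis using b(2) by (simp add: cell_param_def matrix_mult_nth mult.assoc)
qed

text \<open>For the direction that is not already known, apply the same computation to the inverse
  of k, written out as the adjugate.\<close>

lemma cell_param_K0_iff:
  assumes k: "k \<in> K0 (2 * n)"
  shows "(\<exists>w. cell_param Q (g ** k) w) \<longleftrightarrow> (\<exists>w. cell_param Q g w)"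
proof
  define k' where "k' = mat2 (k $ 2 $ 2) (- k $ 1 $ 2) (- k $ 2 $ 1) (k $ 1 $ 1)"
  have k': "k' \<in> K0 (2 * n)"
    using k by (auto simp: K0_iff k'_def padic_ints_def padic_ideal_iff algebra_simps)
  have det: "k $ 1 $ 1 * k $ 2 $ 2 = 1 + k $ 1 $ 2 * k $ 2 $ 1" using k by (simp add: K0_iff algebra_simps)
  have "k ** k' = mat 1"
    by (rule matr_eqI) (simp_all add: matrix_mult_nth k'_def mat_def det mult.commute)
  hence "(g ** k) ** k' = g" by (metis matrix_mul_assoc matrix_mul_rid)
  moreover assume "\<exists>w. cell_param Q (g ** k) w"
  ultimately show "\<exists>w. cell_param Q g w" using cell_value_K0[OF k'] by metis
next
  assume "\<exists>w. cell_param Q g w"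
  thus "\<exists>w. cell_param Q (g ** k) w" using cell_value_K0[OF k] by blast
qed

lemma cell_function_borel:
  assumes b: "b \<in> cover_borel" and g: "g \<in> cover_group"
  shows "cell_function \<mu> \<psi> \<eta> Q (b \<odot> g) = mu_B \<mu> \<psi> b * cell_function \<mu> \<psi> \<eta> Q g"
proof -
  have bg: "b \<odot> g \<in> cover_group" using b g borel_cover cover_group_mult by blast
  have B: "fst b \<in> SL2" "fst b $ 2 $ 1 = 0" using b by (auto simp: cover_borel_def full_preimage_def)
  show ?thesis
  proof (cases "\<exists>w. cell_param Q (fst g) w")
    case True
    then obtain w where w: "cell_param Q (fst g) w" by blast
    have "cell_param Q (fst (b \<odot> g)) w" using cell_value_borel(1)[OF B w] by (simp add: cover_mult_def)
    thus ?thesis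
      using cell_function_eq[OF bg] cell_function_eq[OF g w] cell_value_borel(2)[OF B w]
      by (simp add: cover_mult_def mu_B_def Let_def mult_ac)
  next
    case False
    hence "\<nexists>w. cell_param Q (fst (b \<odot> g)) w" using cell_param_borel_iff[OF B, of "fst g"] by (simp add: cover_mult_def)
    thus ?thesis using cell_function_0[OF g False] cell_function_0[OF bg] by simp
  qed
qed

lemma cell_function_K0:
  assumes k: "k \<in> full_preimage (K0 (2 * n))" and g: "g \<in> cover_group"
  shows "cell_function \<mu> \<psi> \<eta> Q (g \<odot> k) = cell_function \<mu> \<psi> \<eta> Q g * eta_cover \<eta> k"
proof -
  have gk: "g \<odot> k \<in> cover_group" using k g K0_preimage_cover cover_group_mult by blast
  have K: "fst k \<in> K0 (2 * n)" using k by (auto simp: full_preimage_def)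
  show ?thesis
  proof (cases "\<exists>w. cell_param Q (fst g) w")
    case True
    then obtain w where w: "cell_param Q (fst g) w" by blast
    obtain v where v: "cell_param Q (fst g ** fst k) v" "of_int (cocycle (fst g) (fst k)) *
        cell_value \<mu> \<psi> \<eta> Q (fst g ** fst k) v = cell_value \<mu> \<psi> \<eta> Q (fst g) w * \<eta> (fst k $ 2 $ 2)"
      using cell_value_K0[OF K w] by blast
    have "cell_param Q (fst (g \<odot> k)) v" using v(1) by (simp add: cover_mult_def)
    thus ?thesis
      using cell_function_eq[OF gk] cell_function_eq[OF g w] v(2)
      by (simp add: cover_mult_def eta_cover_def mult_ac)
  next
    case False
    hence "\<nexists>w. cell_param Q (fst (g \<odot> k)) w" using cell_param_K0_iff[OF K, of "fst g"] by (simp add: cover_mult_def)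
    thus ?thesis using cell_function_0[OF g False] cell_function_0[OF gk] by simp
  qed
qed

section \<open>Identification of the cell function with \<open>f_kappa\<close>\<close>

lemma lower_y_cover: "(lower_y s, 1) \<in> cover_group"
  by (simp add: cover_group_iff lower_y_def SL2_iff)

lemma hilbert_1_right [simp]: "hilbert_symbol x (1 :: 'p padic) = 1"
  using hilbert_square[of 1 x] by (simp add: hilbert_commute)

lemma s_p_lower_y [simp]: "s_p (lower_y s :: 'p matr) = 1"
  by (simp add: s_p_def lower_y_def)

lemma mu_1: "\<mu> 1 = 1"
  using mu_cond n by (auto simp: unit_filtration_iff padic_ideal_iff)

lemma cell_function_lower_y: "cell_function \<mu> \<psi> \<eta> Q (lower_y Q, 1) = 1"
proof -
  have "cell_param Q (fst (lower_y Q, 1)) 1" by (simp add: cell_param_def lower_y_def)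
  from cell_function_eq[OF lower_y_cover this] show ?thesis
    using eta_filtration[of 1 1] hilbert_square[of 1 Q] weil_gamma_formula[OF odd_card psi, of 1]
    by (simp add: cell_value_def Let_def s_p_lower_y mu_1 unit_filtration_iff padic_ideal_iff)
       (simp add: lower_y_def mu_1)
qed

text \<open>Solving b y(Q) h(w) = g for b gives an explicit upper triangular matrix, and h(w) lies
  in \<open>K0 (2 * n)\<close>. The sign attached to b is chosen to cancel the two cocycle values of
  the product.\<close>

lemma cell_param_imp_double_coset:
  assumes g: "g \<in> cover_group" and w: "cell_param Q (fst g) w"
  shows "\<exists>b k. b \<in> cover_borel \<and> k \<in> full_preimage (K0 (2 * n)) \<and> g = b \<odot> (lower_y Q, 1) \<odot> k"
proof -
  let ?g = "fst g"
  have wu: "w \<in> padic_units" and d0: "?g $ 2 $ 2 \<noteq> 0" and c: "?g $ 2 $ 1 = ?g $ 2 $ 2 * Q * w\<^sup>2"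
    using w by (auto simp: cell_param_def)
  have w0: "w \<noteq> 0" using wu by (rule unit_nonzero)
  have det: "?g $ 1 $ 1 * ?g $ 2 $ 2 - ?g $ 1 $ 2 * ?g $ 2 $ 1 = 1" and e: "snd g = 1 \<or> snd g = -1"
    using g by (auto simp: cover_group_iff SL2_iff)
  define b where "b = mat2 (1 / (?g $ 2 $ 2 * w)) (?g $ 1 $ 2 * w) 0 (?g $ 2 $ 2 * w)"
  define c1 where "c1 = cocycle b (lower_y Q)"
  define c2 where "c2 = cocycle (b ** lower_y Q) (diag_h w)"
  have prod: "b ** lower_y Q ** diag_h w = ?g"
  proof (rule matr_eqI)
    have "?g $ 1 $ 1 * ?g $ 2 $ 2 = 1 + ?g $ 1 $ 2 * (?g $ 2 $ 2 * Q * w\<^sup>2)" using det c by (simp add: algebra_simps)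
    hence "?g $ 1 $ 1 = inverse (?g $ 2 $ 2) + ?g $ 1 $ 2 * Q * w\<^sup>2" using d0 by (simp add: field_simps)
    thus "(b ** lower_y Q ** diag_h w) $ 1 $ 1 = ?g $ 1 $ 1"
      using w0 d0 by (simp add: matrix_mult_nth b_def lower_y_def diag_h_def power2_eq_square field_simps)
  qed (use w0 d0 c in \<open>simp_all add: matrix_mult_nth b_def lower_y_def diag_h_def power2_eq_square mult_ac\<close>)
  have "b \<in> SL2" "b $ 2 $ 1 = 0" using w0 d0 by (simp_all add: SL2_iff b_def)
  hence "(b, snd g * c1 * c2) \<in> cover_borel"
    using e cocycle_cases[of b "lower_y Q"] cocycle_cases[of "b ** lower_y Q" "diag_h w"]
    by (auto simp: cover_borel_def full_preimage_def c1_def c2_def)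
  moreover have "diag_h w \<in> K0 (2 * n)"
    using wu w0 by (simp add: K0_iff diag_h_def padic_ideal_iff padic_units_inverse padic_units_ints) (simp add: padic_ints_def)
  hence "(diag_h w, 1) \<in> full_preimage (K0 (2 * n))" by (simp add: full_preimage_def)
  moreover have "g = (b, snd g * c1 * c2) \<odot> (lower_y Q, 1) \<odot> (diag_h w, 1)"
    unfolding cover_mult_def using prod cocycle_cases[of b "lower_y Q"] cocycle_cases[of "b ** lower_y Q" "diag_h w"]
    by (auto simp: c1_def c2_def prod_eq_iff)
  ultimately show ?thesis by blast
qed

text \<open>Local constancy follows from right equivariance: the principal congruence subgroup of
  level 2n lies in \<open>K0 (2 * n)\<close>, and \<eta> is trivial on its lower right
  entries.\<close>

lemma cell_function_isotypic: "cell_function \<mu> \<psi> \<eta> Q \<in> eta_isotypic \<mu> \<psi> \<eta> (2 * n)"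
proof -
  have "locally_constant (cell_function \<mu> \<psi> \<eta> Q)"
    unfolding locally_constant_def
  proof
    fix g :: "'p cover" assume g: "g \<in> cover_group"
    have "cell_function \<mu> \<psi> \<eta> Q (g \<odot> (k, 1)) = cell_function \<mu> \<psi> \<eta> Q g"
      if k: "k \<in> principal_congruence (2 * n)" for k
    proof -
      have "(k - mat 1) $ 2 $ 1 \<in> padic_ideal (2 * n)" "(k - mat 1) $ 2 $ 2 \<in> padic_ideal (2 * n)"
        using k by (auto simp: principal_congruence_def)
      hence "k $ 2 $ 1 \<in> padic_ideal (2 * n)" "k $ 2 $ 2 \<in> unit_filtration (2 * n)"
        using n by (simp_all add: mat_def unit_filtration_iff)
      moreover from this have "k \<in> K0 (2 * n)" using k by (simp add: principal_congruence_def K0_def)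
      ultimately show ?thesis
        using cell_function_K0[of "(k, 1)" g] g eta_filtration[of "k $ 2 $ 2" "2 * n"] n
        by (simp add: full_preimage_def eta_cover_def)
    qed
    thus "\<exists>m. \<forall>k\<in>principal_congruence m. cell_function \<mu> \<psi> \<eta> Q (g \<odot> (k, 1)) = cell_function \<mu> \<psi> \<eta> Q g" by blast
  qed
  moreover have "cell_function \<mu> \<psi> \<eta> Q \<in> extensional cover_group" by (simp add: cell_function_def)
  ultimately show ?thesis
    using cell_function_borel cell_function_K0 by (simp add: eta_isotypic_def principal_series_def)
qed

text \<open>Uniqueness holds because the two conditions prescribe every value, one on the double
  coset and one off it, while extensionality settles the points outside the cover.\<close>

lemma f_kappa_eq: "f_kappa \<mu> \<psi> \<eta> n \<kappa> = cell_function \<mu> \<psi> \<eta> Q"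
  unfolding f_kappa_def Q_def[symmetric]
proof (rule the_equality, intro conjI ballI impI)
  let ?f = "cell_function \<mu> \<psi> \<eta> Q"
  show "?f \<in> eta_isotypic \<mu> \<psi> \<eta> (2 * n)" by (rule cell_function_isotypic)
  show val: "?f (b \<odot> (lower_y Q, 1) \<odot> k) = mu_B \<mu> \<psi> b * eta_cover \<eta> k"
    if "b \<in> cover_borel" "k \<in> full_preimage (K0 (2 * n))" for b k
    using that(2) cell_function_K0[OF _ cover_group_mult[OF borel_cover[OF that(1)] lower_y_cover], of k Q]
      cell_function_borel[OF that(1) lower_y_cover, of Q] cell_function_lower_y by simp
  show zero: "?f g = 0" if "g \<in> cover_group"
      "\<nexists>b k. b \<in> cover_borel \<and> k \<in> full_preimage (K0 (2 * n)) \<and> g = b \<odot> (lower_y Q, 1) \<odot> k" for g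
    using that cell_param_imp_double_coset cell_function_0 by blast
  fix f assume f: "f \<in> eta_isotypic \<mu> \<psi> \<eta> (2 * n) \<and>
     (\<forall>b\<in>cover_borel. \<forall>k\<in>full_preimage (K0 (2 * n)).
        f (b \<odot> (lower_y Q, 1) \<odot> k) = mu_B \<mu> \<psi> b * eta_cover \<eta> k) \<and>
     (\<forall>g\<in>cover_group.
        (\<nexists>b k. b \<in> cover_borel \<and> k \<in> full_preimage (K0 (2 * n)) \<and>
           g = b \<odot> (lower_y Q, 1) \<odot> k) \<longrightarrow> f g = 0)"
  show "f = ?f"
  proof (rule extensionalityI[of _ cover_group])
    show "f \<in> extensional cover_group" using f by (simp add: eta_isotypic_def principal_series_def)
    show "?f \<in> extensional cover_group" by (simp add: cell_function_def)
    fix g :: "'p cover" assume g: "g \<in> cover_group"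
    show "f g = ?f g"
    proof (cases "\<exists>b k. b \<in> cover_borel \<and> k \<in> full_preimage (K0 (2 * n)) \<and> g = b \<odot> (lower_y Q, 1) \<odot> k")
      case True
      thus ?thesis using f val by auto
    next
      case False
      hence "f g = 0" using f g by blast
      thus ?thesis using zero[OF g False] by simp
    qed
  qed
qed

end

section \<open>The Hecke operator\<close>

text \<open>For units, v / u lies in \<open>sqrt_units\<close> exactly when u and v have the same
  square modulo p.\<close>

definition unit_class :: "'p::prime_card padic \<Rightarrow> 'p padic set" where
  "unit_class u = {v \<in> padic_units. padic_norm (v\<^sup>2 - u\<^sup>2) < 1}"

lemma unit_class_eqI:
  fixes u v :: "'p::prime_card padic"
  assumes "padic_norm (u\<^sup>2 - v\<^sup>2) < 1"
  shows "unit_class u = unit_class v"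
  using congruent_trans assms congruent_sym[OF assms] by (auto simp: unit_class_def)

lemma unit_classes_eq: "unit_classes = unit_class ` (padic_units :: 'p::prime_card padic set)"
proof -
  have iff: "v / u \<in> sqrt_units \<longleftrightarrow> padic_norm (v\<^sup>2 - u\<^sup>2) < 1"
    if u: "u \<in> padic_units" and v: "v \<in> padic_units" for u v :: "'p padic"
  proof -
    have "(v / u)\<^sup>2 - 1 = (v\<^sup>2 - u\<^sup>2) / u\<^sup>2" using unit_nonzero[OF u] by (simp add: field_simps)
    moreover have "padic_norm (u\<^sup>2) = 1" using u by (simp add: padic_norm_power padic_units_def)
    ultimately have "padic_norm ((v / u)\<^sup>2 - 1) = padic_norm (v\<^sup>2 - u\<^sup>2)" by (simp only: padic_norm_divide div_by_1)
    thus ?thesis using padic_units_divide[OF v u] by (simp only: sqrt_units_def padic_ideal_1_iff mem_Collect_eq simp_thms)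
  qed
  have "{(u, v). u \<in> padic_units \<and> v \<in> padic_units \<and> v / u \<in> sqrt_units} `` {x} = unit_class x"
    if "x \<in> padic_units" for x :: "'p padic"
    using that iff[OF that] by (auto simp: unit_class_def)
  thus ?thesis unfolding unit_classes_def quotient_def by auto
qed

lemma congruent_inverse:
  fixes x y :: "'p::prime_card padic"
  assumes "x \<in> padic_units" "y \<in> padic_units" "padic_norm (x - y) < 1"
  shows "padic_norm (inverse x - inverse y) < 1"
proof -
  have "inverse x - inverse y = (y - x) / (x * y)"
    using unit_nonzero[OF assms(1)] unit_nonzero[OF assms(2)] by (simp add: field_simps)
  moreover have "padic_norm (x * y) = 1" using assms by (simp add: padic_norm_mult padic_units_def)
  ultimately have "padic_norm (inverse x - inverse y) = padic_norm (y - x)"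
    by (simp only: padic_norm_divide div_by_1)
  thus ?thesis using assms(3) by (simp add: padic_norm_diff_commute)
qed

lemma congruent_square:
  fixes x y :: "'p::prime_card padic"
  assumes "x \<in> padic_ints" "y \<in> padic_ints" "padic_norm (x - y) < 1 \<or> padic_norm (x + y) < 1"
  shows "padic_norm (x\<^sup>2 - y\<^sup>2) < 1"
proof -
  have le: "padic_norm (x + y) \<le> 1" "padic_norm (x - y) \<le> 1"
    using assms(1,2) padic_norm_add[of x y] padic_norm_diff[of x y] by (auto simp: padic_ints_def)
  have "padic_norm (x\<^sup>2 - y\<^sup>2) = padic_norm (x - y) * padic_norm (x + y)"
    by (simp add: padic_norm_mult[symmetric] power2_eq_square algebra_simps)
  also have "\<dots> < 1"
    using assms(3) le mult_left_le[of "padic_norm (x + y)" "padic_norm (x - y)"]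
      mult_left_le[of "padic_norm (x - y)" "padic_norm (x + y)"]
    by (auto simp: mult.commute intro: le_less_trans)
  finally show ?thesis .
qed

text \<open>The representatives are 1/j because the summand of the operator involves u^(-2), which
  then becomes j^2. For surjectivity a residue r above (p - 1) / 2 is folded to p - r.\<close>

lemma unit_classes_bij:
  assumes odd: "odd CARD('p::prime_card)"
  shows "bij_betw (\<lambda>j. unit_class (inverse (of_nat j) :: 'p padic)) {1..(CARD('p) - 1) div 2} unit_classes"
  unfolding bij_betw_def
proof
  let ?A = "{1..(CARD('p) - 1) div 2}"
  let ?f = "\<lambda>j. unit_class (inverse (of_nat j) :: 'p padic)"
  have u: "(of_nat j :: 'p padic) \<in> padic_units" if "j \<in> ?A" for j using half_unit[OF odd that] .
  have u2: "((of_nat j)\<^sup>2 :: 'p padic) \<in> padic_units" if "j \<in> ?A" for j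
    using u[OF that] by (simp add: power2_eq_square padic_units_mult)
  show "inj_on ?f ?A"
  proof (rule inj_onI)
    fix i j assume ij: "i \<in> ?A" "j \<in> ?A" "?f i = ?f j"
    have "inverse (of_nat i) \<in> ?f i" using u[OF ij(1)] by (simp add: unit_class_def padic_units_inverse)
    hence "padic_norm ((inverse (of_nat i))\<^sup>2 - (inverse (of_nat j))\<^sup>2 :: 'p padic) < 1"
      unfolding ij(3) by (simp add: unit_class_def)
    hence "padic_norm (inverse ((of_nat i)\<^sup>2) - inverse ((of_nat j)\<^sup>2) :: 'p padic) < 1"
      by (simp only: power_inverse)
    hence "padic_norm ((of_nat i)\<^sup>2 - (of_nat j)\<^sup>2 :: 'p padic) < 1"
      using congruent_inverse[of "inverse ((of_nat i)\<^sup>2)" "inverse ((of_nat j)\<^sup>2) :: 'p padic"] u2 ij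
      by (simp add: padic_units_inverse)
    thus "i = j" by (rule half_squares_distinct[OF odd ij(1,2)])
  qed
  show "?f ` ?A = unit_classes"
  proof
    show "?f ` ?A \<subseteq> unit_classes" unfolding unit_classes_eq using u padic_units_inverse by blast
    show "unit_classes \<subseteq> ?f ` ?A"
    proof
      fix C :: "'p padic set" assume "C \<in> unit_classes"
      then obtain x where x: "x \<in> padic_units" "C = unit_class x" by (auto simp: unit_classes_eq)
      have ix: "inverse x \<in> padic_units" using x padic_units_inverse by blast
      define r where "r = padic_residue (inverse x)"
      have r: "r \<in> {1..<CARD('p)}" "padic_norm (inverse x - of_nat r) < 1"
        using residue_unit_range[OF odd ix] padic_residue(2)[OF padic_units_ints[OF ix]] by (auto simp: r_def)
      have "\<exists>j\<in>?A. padic_norm ((inverse x)\<^sup>2 - (of_nat j)\<^sup>2) < 1"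
      proof (cases "r \<in> ?A")
        case True
        thus ?thesis using r(2) by (intro bexI[of _ r] congruent_square padic_units_ints ix padic_ints_of_nat) auto
      next
        case False
        hence "CARD('p) - r \<in> ?A" using r(1) half_card[OF odd] by auto
        moreover have "padic_norm (of_nat CARD('p) :: 'p padic) < 1"
          by (subst padic_norm_of_nat_less_1_iff) simp
        hence "padic_norm (inverse x + of_nat (CARD('p) - r)) < 1"
          using r padic_norm_add[of "inverse x - of_nat r" "of_nat CARD('p)"]
          by (simp add: of_nat_diff algebra_simps)
        ultimately show ?thesis
          by (intro bexI[of _ "CARD('p) - r"] congruent_square padic_units_ints ix padic_ints_of_nat) auto
      qed
      then obtain j where j: "j \<in> ?A" "padic_norm ((inverse x)\<^sup>2 - (of_nat j)\<^sup>2) < 1" by blast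
      have "padic_norm (inverse ((inverse x)\<^sup>2) - inverse ((of_nat j)\<^sup>2)) < 1"
        using ix u2[OF j(1)] j(2) by (intro congruent_inverse) (auto simp: power2_eq_square padic_units_mult)
      hence "padic_norm (x\<^sup>2 - (inverse (of_nat j))\<^sup>2) < 1" by (simp add: power_inverse)
      thus "C \<in> ?f ` ?A" using unit_class_eqI j(1) x(2) by blast
    qed
  qed
qed

lemma unit_class_some:
  assumes "C \<in> (unit_classes :: 'p::prime_card padic set set)"
  shows "(SOME u. u \<in> C) \<in> C" "(SOME u. u \<in> C) \<in> padic_units"
proof -
  obtain x where x: "x \<in> padic_units" "C = unit_class x" using assms by (auto simp: unit_classes_eq)
  hence "x \<in> C" by (simp add: unit_class_def)
  thus 1: "(SOME u. u \<in> C) \<in> C" by (rule someI)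
  thus "(SOME u. u \<in> C) \<in> padic_units" unfolding x by (simp add: unit_class_def)
qed

text \<open>The class of u fixes u^(-2) modulo p, which is all that \<xi> sees. So the
  representative picked by \<open>SOME\<close> may be replaced by 1/j, and a half Gauss sum
  remains.\<close>

lemma sum_unit_classes:
  fixes \<xi> :: "'p::prime_card padic \<Rightarrow> complex"
  assumes odd: "odd CARD('p)" and xi: "residue_character \<xi>" and c: "c \<in> padic_units"
  shows "(\<Sum>C\<in>unit_classes. \<xi> (c * inverse ((SOME u. u \<in> C)\<^sup>2))) = (gauss_sum \<xi> c - 1) / 2"
proof -
  let ?A = "{1..(CARD('p) - 1) div 2}"
  let ?f = "\<lambda>j. unit_class (inverse (of_nat j) :: 'p padic)"
  have "(\<Sum>C\<in>unit_classes. \<xi> (c * inverse ((SOME u. u \<in> C)\<^sup>2))) =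
      (\<Sum>j\<in>?A. \<xi> (c * inverse ((SOME u. u \<in> ?f j)\<^sup>2)))"
    by (rule sum.reindex_bij_betw[OF unit_classes_bij[OF odd], symmetric])
  also have "\<dots> = (\<Sum>j\<in>?A. \<xi> (c * (of_nat j)\<^sup>2))"
  proof (rule sum.cong[OF refl])
    fix j assume j: "j \<in> ?A"
    define u where "u = (SOME u. u \<in> ?f j)"
    have ju: "(of_nat j :: 'p padic) \<in> padic_units" by (rule half_unit[OF odd j])
    have "?f j \<in> unit_classes" unfolding unit_classes_eq using ju padic_units_inverse by blast
    from unit_class_some[OF this] have u: "u \<in> ?f j" "u \<in> padic_units" by (simp_all add: u_def)
    have "padic_norm (u\<^sup>2 - (inverse (of_nat j))\<^sup>2) < 1" using u(1) by (simp add: unit_class_def)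
    hence "padic_norm (inverse (u\<^sup>2) - inverse ((inverse (of_nat j))\<^sup>2)) < 1"
      using u(2) ju by (intro congruent_inverse) (auto simp: power2_eq_square padic_units_mult padic_units_inverse)
    hence "padic_norm (inverse (u\<^sup>2) - (of_nat j)\<^sup>2) < 1" by (simp add: power_inverse)
    hence "padic_norm (c * inverse (u\<^sup>2) - c * (of_nat j)\<^sup>2) < 1"
      using c by (intro congruent_mult) (auto simp: padic_units_def)
    moreover have "c * inverse (u\<^sup>2) \<in> padic_ints" "c * (of_nat j)\<^sup>2 \<in> padic_ints"
      using c u(2) ju by (auto simp: power2_eq_square intro!: padic_units_ints padic_units_mult padic_units_inverse)
    ultimately show "\<xi> (c * inverse ((SOME u. u \<in> ?f j)\<^sup>2)) = \<xi> (c * (of_nat j)\<^sup>2)"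
      unfolding u_def[symmetric] by (intro residue_character_cong[OF xi])
  qed
  also have "\<dots> = (gauss_sum \<xi> c - 1) / 2"
    using gauss_sum_half[OF xi odd padic_units_ints[OF c]] by simp
  finally show ?thesis .
qed

text \<open>The second condition on e says that multiplying by y(Y) changes the lower left entry
  only by the square e^2, so this product has trivial cocycle. In the first product the symbol (u,
  D) is cancelled by the value of \<open>s_p\<close> at y(D) h(u).\<close>

lemma hecke_point:
  fixes D Y u :: "'p::prime_card padic"
  assumes odd: "odd CARD('p)" and D: "D \<noteq> 0" and u: "u \<in> padic_units"
    and e: "e \<in> padic_units" "D * u + inverse u * Y = D * u * e\<^sup>2"
  shows "\<exists>g. (lower_y D, 1) \<odot> (diag_h u, 1) \<odot> (lower_y Y, 1) = (g, 1) \<and> g \<in> SL2 \<and>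
    g $ 2 $ 1 = D * u * e\<^sup>2 \<and> g $ 2 $ 2 = inverse u \<and> s_p g = hilbert_symbol u D"
proof -
  define g1 where "g1 = lower_y D ** diag_h u"
  define g where "g = g1 ** lower_y Y"
  have u0: "u \<noteq> 0" and e0: "e \<noteq> 0" using u e(1) unit_nonzero by auto
  have g1: "g1 $ 2 $ 1 = D * u" "g1 $ 2 $ 2 = inverse u"
    by (simp_all add: g1_def lower_y_def diag_h_def matrix_mult_nth)
  have g: "g $ 2 $ 1 = D * u * e\<^sup>2" "g $ 2 $ 2 = inverse u"
    using e(2) by (simp_all add: g_def lower_y_def matrix_mult_nth g1)
  have SL: "lower_y x \<in> SL2" "diag_h u \<in> SL2" for x :: "'p padic"
    using u0 by (simp_all add: SL2_iff lower_y_def diag_h_def)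
  have gSL: "g \<in> SL2" unfolding g_def g1_def by (intro SL2_mult SL)
  have sy: "s_p (lower_y x) = 1" for x :: "'p padic"
    using hilbert_square[of 1 x] by (simp add: s_p_def lower_y_def hilbert_commute)
  have sh: "s_p (diag_h u) = 1" by (simp add: s_p_def diag_h_def)
  have leg: "padic_legendre (inverse u) = padic_legendre u"
  proof -
    have "padic_legendre u * padic_legendre (inverse u) = 1"
      using legendre_mult[OF odd u padic_units_inverse[OF u]] legendre_1[OF odd] u0 by simp
    thus ?thesis using legendre_unit[OF odd u] legendre_unit[OF odd padic_units_inverse[OF u]] by (auto split: if_splits)
  qed
  \<comment> \<open>Both sides are the Legendre symbol of u if D has odd order, and 1
    otherwise.\<close>
  have s1: "s_p g1 = hilbert_symbol u D"
    using D u0 u leg padic_units_inverse[OF u] unit_sign_cases[OF odd D]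
    by (simp add: s_p_def g1 hilbert_formula[OF odd] padic_ord_mult unit_sign_def)
  have s2: "s_p g = s_p g1"
  proof -
    have "padic_ord (D * u * e\<^sup>2) = padic_ord (D * u)"
      using e D u0 e0 by (simp add: padic_ord_mult power2_eq_square)
    thus ?thesis using hilbert_mult_square[OF e0, of "D * u" "inverse u"] D u0 e0
      by (simp add: s_p_def g g1)
  qed
  have "hilbert_symbol (D * u * D) (D * u * inverse u) = hilbert_symbol u D"
    using hilbert_mult_square[OF D, of u D] u0 by (simp add: power2_eq_square mult_ac)
  hence c1: "cocycle (lower_y D) (diag_h u) = 1"
    using D u0 g1 by (simp add: cocycle_def sy sh g1_def[symmetric] s1 tau_def[of g1])
       (simp add: tau_def lower_y_def diag_h_def)
  have "hilbert_symbol (tau g * tau g1) x = 1" for x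
    using hilbert_square[of "D * u * e" x] D u0 e0 by (simp add: tau_def g g1 power2_eq_square mult_ac)
  hence c2: "cocycle g1 (lower_y Y) = 1"
    by (simp add: cocycle_def sy g_def[symmetric] s2 s1)
  have "(lower_y D, 1) \<odot> (diag_h u, 1) \<odot> (lower_y Y, 1) = (g, 1)"
    by (simp add: cover_mult_def c1 c2 g_def g1_def[symmetric])
  thus ?thesis using g gSL s1 s2 by auto
qed

text \<open>Up to the factor \<open>1/2\<close>, which absorbs a square root below, this is the character of \<open>p\<^sup>n\<^sup>-\<^sup>1 \<int>\<^sub>p / p\<^sup>n \<int>\<^sub>p\<close> induced by \<open>\<mu>\<^sup>-\<^sup>1\<close>.\<close>

definition conductor_character :: "('p::prime_card padic \<Rightarrow> complex) \<Rightarrow> nat \<Rightarrow> 'p padic \<Rightarrow> complex" where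
  "conductor_character \<mu> n x = inverse (\<mu> (1 + padic_p ^ (n - 1) * (x / 2)))"

section \<open>The additive character carried by \<mu>\<close>

context
  fixes \<mu> :: "'p::prime_card padic \<Rightarrow> complex" and n :: nat
  assumes odd_card: "odd CARD('p)" and mu: "mult_character \<mu>" and cond: "conductor_exponent \<mu> n" and n: "n > 1"
begin

lemma mu_cong:
  assumes "a \<in> padic_units" "b \<in> padic_units" "a - b \<in> padic_ideal n"
  shows "\<mu> a = \<mu> b"
proof -
  have b0: "b \<noteq> 0" and ab0: "a * inverse b \<noteq> 0"
    using unit_nonzero[OF assms(1)] unit_nonzero[OF assms(2)] by auto
  have "a * inverse b - 1 = (a - b) * inverse b" using b0 by (simp add: field_simps)
  also have "\<dots> \<in> padic_ideal n"
    using assms by (intro padic_ideal_mult padic_units_ints padic_units_inverse)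
  finally have "a * inverse b \<in> unit_filtration n" using n by (simp add: unit_filtration_iff)
  hence "\<mu> (a * inverse b) = 1" using cond by (simp add: conductor_exponent_def)
  moreover have "\<mu> ((a * inverse b) * b) = \<mu> (a * inverse b) * \<mu> b"
    using mu b0 ab0 unfolding mult_character_def by blast
  ultimately show ?thesis using b0 by (simp add: mult.assoc)
qed

lemma half_int: "x \<in> padic_ints \<Longrightarrow> x / 2 \<in> (padic_ints :: 'p padic set)"
  using padic_norm_2[OF odd_card] by (simp add: padic_ints_def padic_norm_divide)

lemma one_plus_ideal_unit:
  assumes "x \<in> padic_ideal (n - 1)"
  shows "1 + x \<in> (padic_units :: 'p padic set)"
  using unit_add_ideal[OF padic_units_1 assms] n by simp

lemma p_power_mult_ideal: "x \<in> padic_ints \<Longrightarrow> padic_p ^ m * x \<in> (padic_ideal m :: 'p padic set)"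
  by (rule padic_ideal_mult) simp

lemma ideal_mult_deep:
  assumes "x \<in> padic_ideal (n - 1)" "y \<in> padic_ideal (n - 1)"
  shows "x * y \<in> (padic_ideal n :: 'p padic set)"
  using padic_ideal_antimono[OF padic_ideal_mult_ideal[OF assms], of n] n by simp

text \<open>The difference of (1 + a)(1 + b) and 1 + a + b is a b, which lies in p^(2n-2) Z_p and so
  in p^n Z_p because n > 1. Nontriviality is the minimality of the conductor exponent.\<close>

lemma residue_character_conductor: "residue_character (conductor_character \<mu> n)"
  unfolding residue_character_def
proof (intro conjI ballI allI impI)
  let ?P = "padic_p ^ (n - 1) :: 'p padic"
  fix x y :: "'p padic" assume xy: "x \<in> padic_ints" "y \<in> padic_ints"
  define a where "a = ?P * (x / 2)"
  define b where "b = ?P * (y / 2)"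
  have a: "a \<in> padic_ideal (n - 1)" and b: "b \<in> padic_ideal (n - 1)"
    unfolding a_def b_def by (intro p_power_mult_ideal half_int xy)+
  have "(1 + a) * (1 + b) - (1 + (a + b)) = a * b" by (simp add: algebra_simps)
  hence "\<mu> ((1 + a) * (1 + b)) = \<mu> (1 + (a + b))"
    using a b ideal_mult_deep[OF a b] padic_ideal_add[OF a b]
    by (intro mu_cong padic_units_mult one_plus_ideal_unit) auto
  moreover have "\<mu> ((1 + a) * (1 + b)) = \<mu> (1 + a) * \<mu> (1 + b)"
    using mu one_plus_ideal_unit[OF a] one_plus_ideal_unit[OF b] unit_nonzero by (auto simp: mult_character_def)
  moreover have "?P * ((x + y) / 2) = a + b" by (simp add: a_def b_def field_simps)
  ultimately have "\<mu> (1 + ?P * ((x + y) / 2)) = \<mu> (1 + a) * \<mu> (1 + b)" by (simp only:)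
  thus "conductor_character \<mu> n (x + y) = conductor_character \<mu> n x * conductor_character \<mu> n y"
    by (simp only: conductor_character_def a_def[symmetric] b_def[symmetric] inverse_mult_distrib)
next
  fix x :: "'p padic" assume x: "padic_norm x < 1"
  have "x / 2 \<in> padic_ideal 1" using x padic_norm_2[OF odd_card] by (simp only: padic_ideal_1_iff padic_norm_divide div_by_1)
  hence "padic_p ^ (n - 1) * (x / 2) \<in> padic_ideal (n - 1 + 1)" by (intro padic_ideal_mult_ideal p_power_in_ideal)
  hence "1 + padic_p ^ (n - 1) * (x / 2) \<in> unit_filtration n" using n by (simp add: unit_filtration_iff)
  thus "conductor_character \<mu> n x = 1" using cond by (simp add: conductor_character_def conductor_exponent_def)
next
  obtain u where u: "u \<in> unit_filtration (n - 1)" "\<mu> u \<noteq> 1"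
    using cond n unfolding conductor_exponent_def by (metis diff_less less_trans zero_less_one)
  then obtain z where z: "z \<in> padic_ints" "u - 1 = padic_p ^ (n - 1) * z"
    using n by (auto simp: unit_filtration_iff padic_ideal_def)
  \<comment> \<open>Doubling z compensates for the factor 1/2 in
    \<open>conductor_character\<close>.\<close>
  have "u = 1 + padic_p ^ (n - 1) * (2 * z / 2)" using z(2) by (simp add: algebra_simps)
  moreover have "2 * z \<in> padic_ints" using z(1) padic_units_ints[OF padic_units_2[OF odd_card]] by (intro padic_ints_mult)
  ultimately show "\<exists>x\<in>padic_ints. conductor_character \<mu> n x \<noteq> 1"
    using u(2) unfolding conductor_character_def by (metis inverse_eq_1_iff)
qed

text \<open>The square root of \<open>1 + p\<^sup>n\<^sup>-\<^sup>1 x\<close> is \<open>1 + p\<^sup>n\<^sup>-\<^sup>1 x / 2\<close> modulo \<open>p\<^sup>n\<close>, because \<open>2 (n - 1) \<ge> n\<close>.\<close>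

lemma mu_square_root:
  assumes e: "e \<in> unit_filtration (n - 1)" "e\<^sup>2 = 1 + padic_p ^ (n - 1) * x" and x: "x \<in> padic_ints"
  shows "\<mu> (inverse e) = conductor_character \<mu> n x"
proof -
  let ?P = "padic_p ^ (n - 1) :: 'p padic"
  define y where "y = e - 1"
  have y: "y \<in> padic_ideal (n - 1)" using e(1) n by (simp add: y_def unit_filtration_iff)
  have eu: "e \<in> padic_units" using e unit_filtration_unit by blast
  have "y\<^sup>2 + 2 * y = ?P * x" using e(2) by (simp add: y_def power2_eq_square algebra_simps)
  hence "e - (1 + ?P * (x / 2)) = (y * y) * (- inverse 2)"
    by (simp add: y_def power2_eq_square field_simps)
  also have "\<dots> \<in> padic_ideal n"
    using y padic_units_2[OF odd_card]
    by (intro padic_ideal_mult ideal_mult_deep padic_units_ints padic_units_minus padic_units_inverse)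
  finally have "\<mu> e = \<mu> (1 + ?P * (x / 2))"
    using eu x by (intro mu_cong one_plus_ideal_unit p_power_mult_ideal half_int)
  moreover have "\<mu> (inverse e) = inverse (\<mu> e)"
  proof -
    have "(1 :: 'p padic) \<in> unit_filtration n" using n by (simp add: unit_filtration_iff padic_ideal_iff)
    hence "\<mu> 1 = 1" using cond by (simp add: conductor_exponent_def)
    hence "\<mu> e * \<mu> (inverse e) = 1"
      using mu unit_nonzero[OF eu] unfolding mult_character_def by (metis inverse_nonzero_iff_nonzero right_inverse)
    thus ?thesis by (metis inverse_unique)
  qed
  ultimately show ?thesis by (simp add: conductor_character_def)
qed

section \<open>Evaluation of the operator\<close>

context
  fixes \<psi> \<eta> :: "'p padic \<Rightarrow> complex" and \<kappa> \<beta> :: "'p padic"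
  assumes psi: "additive_character \<psi>" "conductor_zero \<psi>"
    and eta: "(\<forall>u\<in>padic_units. \<eta> u = 1) \<or> (\<forall>u\<in>padic_units. \<eta> u = of_int (padic_legendre u))"
    and mu_eta: "\<mu> (-1) = \<eta> (-1)" and kappa: "\<kappa> \<in> padic_units" and beta: "\<beta> \<in> padic_units"
begin

lemma mu_filtration: "\<forall>u\<in>unit_filtration n. \<mu> u = 1"
  using cond by (simp add: conductor_exponent_def)

lemma n_pos: "n > 0"
  using n by simp

lemmas cell_facts = odd_card psi mu mu_filtration n_pos eta mu_eta kappa refl

text \<open>Since 2n - 1 = n + (n - 1), factoring out \<delta> p^n u leaves 1 + p^(n-1) x with x a
  unit. As n > 1 this is a principal unit and has a square root.\<close>

lemma hecke_square_root:
  assumes delta: "\<delta> \<in> padic_units" and u: "u \<in> padic_units"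
  shows "\<exists>e. e \<in> unit_filtration (n - 1) \<and> e\<^sup>2 = 1 + padic_p ^ (n - 1) * (\<beta> / \<delta> * inverse (u\<^sup>2)) \<and>
    \<delta> * padic_p ^ n * u + inverse u * (\<beta> * padic_p ^ (2 * n - 1)) = \<delta> * padic_p ^ n * u * e\<^sup>2"
proof -
  let ?x = "\<beta> / \<delta> * inverse (u\<^sup>2)"
  have "?x \<in> padic_units"
    using beta delta u by (simp add: padic_units_mult padic_units_divide padic_units_inverse power2_eq_square)
  hence "padic_p ^ (n - 1) * ?x \<in> padic_ideal (n - 1)" by (intro p_power_mult_ideal padic_units_ints)
  hence "1 + padic_p ^ (n - 1) * ?x \<in> unit_filtration (n - 1)" using n by (simp add: unit_filtration_iff)
  then obtain e where e: "e \<in> unit_filtration (n - 1)" "e\<^sup>2 = 1 + padic_p ^ (n - 1) * ?x"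
    using unit_filtration_sqrt[OF odd_card] n by (metis zero_less_diff)
  have "2 * n - 1 = n + (n - 1)" using n by simp
  hence pp: "padic_p ^ (2 * n - 1) = (padic_p ^ n * padic_p ^ (n - 1) :: 'p padic)" by (simp only: power_add)
  have "\<delta> * padic_p ^ n * u + inverse u * (\<beta> * padic_p ^ (2 * n - 1)) = \<delta> * padic_p ^ n * u * e\<^sup>2"
    unfolding pp e(2) using unit_nonzero[OF u] unit_nonzero[OF delta] by (simp add: field_simps power2_eq_square)
  thus ?thesis using e by blast
qed

text \<open>Each summand vanishes separately: a cell parameter w would give \<delta> (u e)^2 =
  \<kappa> w^2 and make \<delta> / \<kappa> a square.\<close>

lemma hecke_V_off_support:
  assumes delta: "\<delta> \<in> padic_units" and ns: "\<not> square_mod_p (\<delta> / \<kappa>)"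
  shows "hecke_V \<eta> (2 * n - 1) \<beta> (f_kappa \<mu> \<psi> \<eta> n \<kappa>) (lower_y (\<delta> * padic_p ^ n), 1) = 0"
  unfolding hecke_V_def Let_def f_kappa_eq[OF cell_facts]
proof (rule sum.neutral, rule ballI)
  let ?Q = "\<kappa> * padic_p ^ n"
  fix C :: "'p padic set" assume "C \<in> unit_classes"
  define u where "u = (SOME u. u \<in> C)"
  have u: "u \<in> padic_units" unfolding u_def by (rule unit_class_some(2)) fact
  have u0: "u \<noteq> 0" using u by (rule unit_nonzero)
  obtain e where e: "e \<in> unit_filtration (n - 1)"
    "\<delta> * padic_p ^ n * u + inverse u * (\<beta> * padic_p ^ (2 * n - 1)) = \<delta> * padic_p ^ n * u * e\<^sup>2"
    using hecke_square_root[OF delta u] by blast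
  have eu: "e \<in> padic_units" using e unit_filtration_unit by blast
  have e0: "e \<noteq> 0" using eu by (rule unit_nonzero)
  have D0: "\<delta> * padic_p ^ n \<noteq> 0" using unit_nonzero[OF delta] by simp
  obtain g where g: "(lower_y (\<delta> * padic_p ^ n), 1) \<odot> (diag_h u, 1) \<odot> (lower_y (\<beta> * padic_p ^ (2 * n - 1)), 1) = (g, 1)"
    "g \<in> SL2" "g $ 2 $ 1 = \<delta> * padic_p ^ n * u * e\<^sup>2" "g $ 2 $ 2 = inverse u"
    using hecke_point[OF odd_card D0 u eu e(2)] by blast
  have "\<not> cell_param ?Q g w" for w
  proof
    assume "cell_param ?Q g w"
    hence w: "w \<in> padic_units" and "\<delta> * padic_p ^ n * u * e\<^sup>2 = inverse u * ?Q * w\<^sup>2"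
      using g by (auto simp: cell_param_def)
    hence "\<delta> * (u * e)\<^sup>2 = \<kappa> * w\<^sup>2" using u0 by (simp add: field_simps power2_eq_square)
    hence "(w / (u * e))\<^sup>2 = \<delta> / \<kappa>" using u0 e0 unit_nonzero[OF kappa] by (simp add: field_simps)
    moreover have "w / (u * e) \<in> padic_units" using w u eu by (intro padic_units_divide padic_units_mult)
    ultimately show False
      using ns unit_square_mod_p_iff[OF odd_card padic_units_divide[OF delta kappa]] by blast
  qed
  hence "cell_function \<mu> \<psi> \<eta> ?Q (g, 1) = 0"
    using g(2) by (intro cell_function_0[OF cell_facts]) (auto simp: cover_group_iff)
  thus "\<eta> (SOME u. u \<in> C) * cell_function \<mu> \<psi> \<eta> ?Q
      ((lower_y (\<delta> * padic_p ^ n), 1) \<odot> (diag_h (SOME u. u \<in> C), 1) \<odot> (lower_y (\<beta> * padic_p ^ (2 * n - 1)), 1)) = 0"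
    unfolding u_def[symmetric] g(1) by simp
qed

text \<open>The translated point has w = u e and d = 1/u, hence t = 1/e. As e is itself a square,
  the symbol with t and the Weil factor are trivial, and (u, Q) meets the equal value of
  \<open>s_p\<close>. With \<eta>(u)^2 = 1 only \<mu>(1/e) survives.\<close>

lemma hecke_V_on_support:
  "hecke_V \<eta> (2 * n - 1) \<beta> (f_kappa \<mu> \<psi> \<eta> n \<kappa>) (lower_y (\<kappa> * padic_p ^ n), 1) =
     (of_int (padic_legendre (\<beta> / \<kappa>)) * gauss_sum (conductor_character \<mu> n) 1 - 1) / 2"
proof -
  let ?Q = "\<kappa> * padic_p ^ n" and ?xi = "conductor_character \<mu> n"
  have bk: "\<beta> / \<kappa> \<in> padic_units" using beta kappa by (rule padic_units_divide)
  have Q0: "?Q \<noteq> 0" using unit_nonzero[OF kappa] by simp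
  have "\<eta> u * cell_function \<mu> \<psi> \<eta> ?Q
      ((lower_y ?Q, 1) \<odot> (diag_h u, 1) \<odot> (lower_y (\<beta> * padic_p ^ (2 * n - 1)), 1)) = ?xi (\<beta> / \<kappa> * inverse (u\<^sup>2))"
    if u: "u \<in> padic_units" for u
  proof -
    have u0: "u \<noteq> 0" using u by (rule unit_nonzero)
    obtain e where e: "e \<in> unit_filtration (n - 1)" "e\<^sup>2 = 1 + padic_p ^ (n - 1) * (\<beta> / \<kappa> * inverse (u\<^sup>2))"
      "\<kappa> * padic_p ^ n * u + inverse u * (\<beta> * padic_p ^ (2 * n - 1)) = \<kappa> * padic_p ^ n * u * e\<^sup>2"
      using hecke_square_root[OF kappa u] by blast
    have eu: "e \<in> padic_units" using e unit_filtration_unit by blast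
    have e0: "e \<noteq> 0" using eu by (rule unit_nonzero)
    have n1: "n - 1 > 0" using n by simp
    obtain r where r: "r \<in> unit_filtration (n - 1)" "r\<^sup>2 = e" using unit_filtration_sqrt[OF odd_card e(1) n1] by blast
    have r0: "r \<noteq> 0" using r unit_filtration_unit unit_nonzero by blast
    obtain g where g: "(lower_y ?Q, 1) \<odot> (diag_h u, 1) \<odot> (lower_y (\<beta> * padic_p ^ (2 * n - 1)), 1) = (g, 1)"
      "g \<in> SL2" "g $ 2 $ 1 = ?Q * u * e\<^sup>2" "g $ 2 $ 2 = inverse u" "s_p g = hilbert_symbol u ?Q"
      using hecke_point[OF odd_card Q0 u eu e(3)] by blast
    have param: "cell_param ?Q g (u * e)"
      using u eu u0 by (simp add: cell_param_def g padic_units_mult field_simps power2_eq_square)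
    have t: "inverse (g $ 2 $ 2 * (u * e)) = inverse e" using u0 by (simp add: g)
    have ie: "inverse e = 1 * (inverse r)\<^sup>2" by (simp add: r(2)[symmetric] power_inverse)
    have H: "hilbert_symbol x (inverse e) = 1" for x
      using hilbert_square[of "inverse r" x] ie by (simp add: hilbert_commute)
    have H2: "hilbert_symbol (u * e) ?Q = hilbert_symbol u ?Q"
      using hilbert_mult_square[OF r0, of u ?Q] by (simp add: r(2))
    have gam: "weil_gamma (inverse e) \<psi> = 1"
      using weil_gamma_formula[OF odd_card psi, of "inverse e"] e0 padic_units_inverse[OF eu] by simp
    have nrm: "padic_norm (inverse e) = 1" using padic_units_inverse[OF eu] by (simp add: padic_units_def)
    have etae: "\<eta> (u * e) = \<eta> u"
      using eta_mult[OF cell_facts u eu] eta_filtration[OF cell_facts e(1) n1] by simp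
    have x: "\<beta> / \<kappa> * inverse (u\<^sup>2) \<in> padic_ints"
      using bk u by (intro padic_units_ints padic_units_mult padic_units_inverse) (auto simp: power2_eq_square padic_units_mult)
    have "cell_value \<mu> \<psi> \<eta> ?Q g (u * e) = ?xi (\<beta> / \<kappa> * inverse (u\<^sup>2)) * \<eta> u"
      unfolding cell_value_def Let_def t H H2 g(5) gam nrm etae mu_square_root[OF e(1,2) x]
      using hilbert_cases[of u ?Q] by auto
    moreover have "(g, 1) \<in> cover_group" using g(2) by (simp add: cover_group_iff)
    ultimately show ?thesis
      unfolding g(1) using cell_function_eq[OF cell_facts, of "(g, 1)" "u * e"] param eta_square[OF cell_facts u]
      by (simp add: mult_ac)
  qed
  hence "hecke_V \<eta> (2 * n - 1) \<beta> (f_kappa \<mu> \<psi> \<eta> n \<kappa>) (lower_y ?Q, 1) =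
      (\<Sum>C\<in>unit_classes. ?xi (\<beta> / \<kappa> * inverse ((SOME u. u \<in> C)\<^sup>2)))"
    unfolding hecke_V_def Let_def f_kappa_eq[OF cell_facts]
    using unit_class_some(2) by (intro sum.cong) auto
  also have "\<dots> = (gauss_sum ?xi (\<beta> / \<kappa>) - 1) / 2"
    by (rule sum_unit_classes[OF odd_card residue_character_conductor bk])
  finally show ?thesis using gauss_sum_legendre[OF residue_character_conductor odd_card bk] by simp
qed

end
end

theorem proposition4p3:
  fixes \<mu> \<psi> :: "'p::prime_card padic \<Rightarrow> complex" and n :: nat
  assumes "odd CARD('p)"
    and "additive_character \<psi>" and "conductor_zero \<psi>"
    and "mult_character \<mu>" and "conductor_exponent \<mu> n" and "n > 1"
  shows "\<exists>s\<in>{1, -1 :: complex}. \<forall>(\<eta> :: 'p padic \<Rightarrow> complex) (lam :: 'p padic).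
    ((\<forall>u\<in>padic_units. \<eta> u = 1) \<or> (\<forall>u\<in>padic_units. \<eta> u = of_int (padic_legendre u))) \<longrightarrow>
    \<mu> (-1) = \<eta> (-1) \<longrightarrow>
    lam \<in> padic_units \<longrightarrow> \<not> square_mod_p lam \<longrightarrow>
    (\<forall>\<kappa>\<in>{1, lam}. \<forall>\<beta>\<in>{1, lam}. \<forall>\<delta>\<in>{1, lam}. \<beta> \<noteq> \<kappa> \<longrightarrow>
       hecke_V \<eta> (2 * n - 1) \<kappa> (f_kappa \<mu> \<psi> \<eta> n \<kappa>) (lower_y (\<delta> * padic_p ^ n), 1) =
         (if \<delta> = \<kappa> then (-1 + s * sqrt_p_star \<psi>) / 2 else 0) \<and>
       hecke_V \<eta> (2 * n - 1) \<beta> (f_kappa \<mu> \<psi> \<eta> n \<kappa>) (lower_y (\<delta> * padic_p ^ n), 1) =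
         (if \<delta> = \<kappa> then (-1 - s * sqrt_p_star \<psi>) / 2 else 0))"
proof -
  \<comment> \<open>G is built from \<mu> and n alone, so s can be fixed before \<eta> and lam are
    given.\<close>
  define G where "G = gauss_sum (conductor_character \<mu> n) 1"
  have "G\<^sup>2 = (sqrt_p_star \<psi>)\<^sup>2"
    unfolding G_def sqrt_p_star_eq[OF assms(1-3)] psi_gauss_square[OF assms(1-3)]
    by (rule gauss_sum_square[OF residue_character_conductor[OF assms(1,4-6)] assms(1)])
  hence "G = sqrt_p_star \<psi> \<or> G = - sqrt_p_star \<psi>" by (simp add: power2_eq_iff)
  then obtain s :: complex where s: "s \<in> {1, -1}" "G = s * sqrt_p_star \<psi>" by force
  show ?thesis
  proof (rule bexI[OF _ s(1)], intro allI impI ballI)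
    fix \<eta> :: "'p padic \<Rightarrow> complex" and lam \<kappa> \<beta> \<delta> :: "'p padic"
    assume eta: "(\<forall>u\<in>padic_units. \<eta> u = 1) \<or> (\<forall>u\<in>padic_units. \<eta> u = of_int (padic_legendre u))"
      and mu_eta: "\<mu> (-1) = \<eta> (-1)" and lam: "lam \<in> padic_units" "\<not> square_mod_p lam"
      and k: "\<kappa> \<in> {1, lam}" and b: "\<beta> \<in> {1, lam}" and d: "\<delta> \<in> {1, lam}" and bk: "\<beta> \<noteq> \<kappa>"
    have u: "\<kappa> \<in> padic_units" "\<beta> \<in> padic_units" "\<delta> \<in> padic_units" using k b d lam(1) by auto
    \<comment> \<open>The quotient of two distinct elements of {1, lam} is lam or its inverse, so
      both must be nonsquares.\<close>
    have "\<not> square_mod_p (inverse lam)"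
      using lam square_mod_p_mult_square[OF assms(1) padic_units_inverse[OF lam(1)] lam(1)] unit_nonzero[OF lam(1)] by auto
    hence ns: "\<not> square_mod_p (x / y)" if "x \<in> {1, lam}" "y \<in> {1, lam}" "x \<noteq> y" for x y
      using that lam(2) by (auto simp: inverse_eq_divide)
    note on = hecke_V_on_support[OF assms(1,4-6,2,3) eta mu_eta u(1), folded G_def]
    note off = hecke_V_off_support[OF assms(1,4-6,2,3) eta mu_eta u(1) _ u(3) ns[OF d k]]
    have "padic_legendre (\<kappa> / \<kappa>) = 1" "padic_legendre (\<beta> / \<kappa>) = -1"
      using unit_nonzero[OF u(1)] legendre_1[OF assms(1)]
        legendre_unit[OF assms(1) padic_units_divide[OF u(2,1)]] ns[OF b k bk] by auto
    thus "hecke_V \<eta> (2 * n - 1) \<kappa> (f_kappa \<mu> \<psi> \<eta> n \<kappa>) (lower_y (\<delta> * padic_p ^ n), 1) =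
         (if \<delta> = \<kappa> then (-1 + s * sqrt_p_star \<psi>) / 2 else 0) \<and>
       hecke_V \<eta> (2 * n - 1) \<beta> (f_kappa \<mu> \<psi> \<eta> n \<kappa>) (lower_y (\<delta> * padic_p ^ n), 1) =
         (if \<delta> = \<kappa> then (-1 - s * sqrt_p_star \<psi>) / 2 else 0)"
      using on[OF u(1)] on[OF u(2)] off[OF u(1)] off[OF u(2)] s(2) by auto
  qed
qed

end
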